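(* As $\beta \rightarrow 0$, the law of $\beta Q_2(\infty)$ converges weakly to the $\mathrm{Gamma}(2)$ distribution, i.e. the distribution with density $f(x) = xe^{-x}$, $x \ge 0$.
   Context: For $\beta>0$, consider the diffusion process $(Q_1,Q_2)$ with state space $(-\infty,0]\times(0,\infty)$ given, for $t\ge 0$, by $$Q_1(t) = Q_1(0) + \sqrt{2}\, W(t) - \beta t + \int_0^t (- Q_1(s) + Q_2(s))\, ds - L(t),\qquad Q_2(t) = Q_2(0) + L(t) - \int_0^t Q_2(s)\,ds,$$ where $W$ is a standard Brownian motion and $L$ is the unique nondecreasing nonnegative process in $D_{\mathbb{R}}[0,\infty)$ keeping $Q_1\le 0$ and satisfying $\int_0^\infty \mathbf{1}_{[Q_1(t)<0]}\,dL(t)=0$. For each $\beta>0$ this is an ergodic Markov process with a unique stationary distribution $\pi$ (depending on $\beta$); $(Q_1(\infty),Q_2(\infty))$ denotes a random variable with law $\pi$. *)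

theory Defs
  imports "HOL-Probability.Probability"
begin

definition standard_brownian_motion :: "'a measure \<Rightarrow> (real \<Rightarrow> 'a \<Rightarrow> real) \<Rightarrow> bool" where
  "standard_brownian_motion M W \<longleftrightarrow>
     prob_space M \<and>
     (\<forall>t\<ge>0. W t \<in> borel_measurable M) \<and>
     (AE \<omega> in M. W 0 \<omega> = 0) \<and>
     (AE \<omega> in M. continuous_on {0..} (\<lambda>t. W t \<omega>)) \<and>
     (\<forall>s t. 0 \<le> s \<longrightarrow> s < t \<longrightarrow>
        distributed M lborel (\<lambda>\<omega>. W t \<omega> - W s \<omega>) (normal_density 0 (sqrt (t - s)))) \<and>
     (\<forall>(n::nat) (\<tau> :: nat \<Rightarrow> real). 0 \<le> \<tau> 0 \<longrightarrow> mono \<tau> \<longrightarrow>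
        prob_space.indep_vars M (\<lambda>_. borel) (\<lambda>i \<omega>. W (\<tau> (Suc i)) \<omega> - W (\<tau> i) \<omega>) {..<n})"

text \<open>Membership of a path in \<open>D[0,\<infinity>)\<close>; values at negative times are irrelevant.\<close>

definition cadlag :: "(real \<Rightarrow> real) \<Rightarrow> bool" where
  "cadlag f \<longleftrightarrow>
     (\<forall>t\<ge>0. (f \<longlongrightarrow> f t) (at_right t)) \<and>
     (\<forall>t>0. \<exists>x. (f \<longlongrightarrow> x) (at_left t))"

text \<open>
  The pathwise equations, for single paths \<open>w, q1, q2, l\<close> on \<open>[0,\<infinity>)\<close>.  For the
  Lebesgue--Stieltjes integral against \<open>dl\<close> over \<open>[0,\<infinity>)\<close>, the path \<open>l\<close> is extended by \<open>0\<close>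
  to negative times; there is no atom at \<open>0\<close>, because the first equation at \<open>t = 0\<close> forces
  \<open>l 0 = 0\<close> whenever \<open>w 0 = 0\<close>.
\<close>

definition diffusion_path ::
    "real \<Rightarrow> (real \<Rightarrow> real) \<Rightarrow> (real \<Rightarrow> real) \<Rightarrow> (real \<Rightarrow> real) \<Rightarrow> (real \<Rightarrow> real) \<Rightarrow> bool" where
  "diffusion_path \<beta> w q1 q2 l \<longleftrightarrow>
     (\<forall>t\<ge>0. q1 t \<le> 0 \<and> q2 t > 0) \<and>
     (\<forall>t\<ge>0. set_integrable lborel {0..t} q1 \<and> set_integrable lborel {0..t} q2) \<and>
     (\<forall>t\<ge>0. q1 t = q1 0 + sqrt 2 * w t - \<beta> * t + (LBINT s:{0..t}. - q1 s + q2 s) - l t) \<and>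
     (\<forall>t\<ge>0. q2 t = q2 0 + l t - (LBINT s:{0..t}. q2 s)) \<and>
     cadlag l \<and> mono_on {0..} l \<and> (\<forall>t\<ge>0. 0 \<le> l t) \<and>
     (\<integral>\<^sup>+t\<in>{0..}. indicator {t. q1 t < 0} t
        \<partial>interval_measure (\<lambda>t. if t < 0 then 0 else l t)) = 0"

text \<open>
  The two independent objects, the initial state and the driving path, have different value
  types, so their independence is expressed through the sigma-algebras they generate.
\<close>

definition diffusion ::
    "'a measure \<Rightarrow> real \<Rightarrow> (real \<Rightarrow> 'a \<Rightarrow> real) \<Rightarrow> (real \<Rightarrow> 'a \<Rightarrow> real) \<Rightarrow> (real \<Rightarrow> 'a \<Rightarrow> real)
      \<Rightarrow> (real \<Rightarrow> 'a \<Rightarrow> real) \<Rightarrow> bool" where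
  "diffusion M \<beta> W Q1 Q2 L \<longleftrightarrow>
     standard_brownian_motion M W \<and>
     (\<forall>t\<ge>0. Q1 t \<in> borel_measurable M \<and> Q2 t \<in> borel_measurable M \<and> L t \<in> borel_measurable M) \<and>
     prob_space.indep_set M
       (sets (vimage_algebra (space M) (\<lambda>\<omega>. (Q1 0 \<omega>, Q2 0 \<omega>)) borel))
       (sets (vimage_algebra (space M) (\<lambda>\<omega>. \<lambda>t\<in>{0..}. W t \<omega>) (Pi\<^sub>M {0..} (\<lambda>_. borel)))) \<and>
     (AE \<omega> in M. diffusion_path \<beta> (\<lambda>t. W t \<omega>) (\<lambda>t. Q1 t \<omega>) (\<lambda>t. Q2 t \<omega>) (\<lambda>t. L t \<omega>))"

text \<open>
  \<open>p\<close> is a stationary distribution: the diffusion started from \<open>p\<close> has law \<open>p\<close> at all times.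
  By uniqueness in law it does not matter on which probability space, or by which solution, the
  process started from \<open>p\<close> is realised, so one realisation on \<open>M\<close> is required.  (Demanding the
  property of all realisations on \<open>M\<close> instead would hold vacuously if \<open>M\<close> were too small to
  carry one.)
\<close>

definition stationary_distribution :: "'a measure \<Rightarrow> real \<Rightarrow> (real \<times> real) measure \<Rightarrow> bool" where
  "stationary_distribution M \<beta> p \<longleftrightarrow>
     (\<exists>W Q1 Q2 L. diffusion M \<beta> W Q1 Q2 L \<and>
        (\<forall>t\<ge>0. distr M borel (\<lambda>\<omega>. (Q1 t \<omega>, Q2 t \<omega>)) = p))"

end

theory Submission
  imports Defs
begin

text \<open>
  Put \<open>U = - Q1\<close>, \<open>Y = Q2\<close> and \<open>S = Q1 + Q2\<close>.  The reflection term drops out of \<open>S\<close>: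
  \<open>dS = sqrt 2 dW + (U - \<beta>) dt\<close> and \<open>dY = dL - Y dt\<close>.  For a function \<open>F (S, Y)\<close> whose derivative in \<open>Y\<close>
  vanishes where \<open>U = 0\<close>, comparing the stationary law at time \<open>0\<close> with that at a small time \<open>h\<close> gives
  \<open>E [F_ss + (U - \<beta>) F_s - Y F_y] = 0\<close>.  Only the independence of \<open>W\<close> from the initial state
  is used; the second-order error of the reflection lives on the event that \<open>U\<close> hits \<open>0\<close> before \<open>h\<close>,
  whose probability vanishes because \<open>U\<close> has no atom at \<open>0\<close>.

  A quartic Lyapunov function yields moments, then \<open>F = S\<close> and \<open>F = U^3\<close> give
  \<open>E U = \<beta>\<close> and \<open>E U^2\<close>, \<open>E (U^2 Y) = O(\<beta>)\<close>.  Testing with \<open>F_s = S m (\<beta> S)\<close> and with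
  \<open>F = U^2 m (\<beta> Y)\<close>, the latter to replace \<open>U Y\<close> by \<open>1\<close>, shows that \<open>X = \<beta> S\<close> satisfies the Stein
  identity \<open>E [X m' (X) + (2 - X) m (X)] = 0\<close> of the Gamma(2) law up to \<open>O(\<beta>)\<close>.  For
  \<open>m x = exp (\<i> \<theta> x)\<close> this is a linear differential equation for the characteristic function of \<open>X\<close>,
  so that it tends to \<open>(1 - \<i> \<theta>)^-2\<close>.
\<close>

section \<open>Pathwise estimates\<close>

text \<open>Why \<open>U Y\<close> may be replaced by 1: for small \<beta> the coordinate
  \<open>U\<close> is fast compared with \<open>Y\<close>. With \<open>Y\<close> frozen at y it
  resembles a Brownian motion of variance 2 and drift -y reflected at 0, whose stationary law is
  exponential with rate y, so \<open>U Y\<close> has conditional mean about 1. To leading order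
  U^2/2 solves the corresponding Poisson equation, with right-hand side 1 - U y and zero slope at
  the boundary.

  The obstacle is that the increment over [0,h] must be expanded with expected error o(h) from the
  pathwise equations alone. The noise enters only through its value at h and one random bound
  \<zeta> for |W| on [0,h], with E \<zeta>^4 = O(h^2). The interior errors h \<zeta> and \<zeta>^3
  are O(h^(3/2)), but the reflection error \<zeta>^2 + h has exactly the critical order h; only the
  vanishing probability of reflection makes it negligible.

  Moments come in two layers. The Lyapunov constants may blow up as \<beta> tends to 0 and give
  integrability only; the bounds of order \<beta> come from exact identities.\<close>

lemma power_le_one_plus_power:
  fixes x :: real
  assumes "0 \<le> x" "m \<le> n"
  shows "x ^ m \<le> 1 + x ^ n"
proof (cases "x \<le> 1")
  case True
  then have "x ^ m \<le> 1" using assms by (simp add: power_le_one)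
  then show ?thesis using zero_le_power[OF assms(1), of n] by linarith
next
  case False
  then have "x ^ m \<le> x ^ n" using assms by (intro power_increasing) auto
  then show ?thesis by simp
qed

lemma abs_le_one_plus_power4: "\<bar>x\<bar> \<le> 1 + x ^ 4" for x :: real
  using power_le_one_plus_power[of "\<bar>x\<bar>" 1 4] by (simp add: power_even_abs)

lemma abs_le_one_plus_square: "\<bar>x\<bar> \<le> 1 + x\<^sup>2" for x :: real
  using power_le_one_plus_power[of "\<bar>x\<bar>" 1 2] by simp

text \<open>The measure dl has no mass where \<open>q\<close> is negative, hence none on the set of
  times in [0,h] with \<open>l\<close> above \<open>m\<close>. That set is an interval ending at
  \<open>h\<close>, across which \<open>l\<close> would gain a positive amount. This one-sided
  maximum principle stands in for the explicit running-maximum formula of the reflection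
  term.\<close>

lemma skorokhod_le:
  fixes l q :: "real \<Rightarrow> real"
  assumes "cadlag l" and mono: "mono_on {0..} l" and nonneg: "\<forall>t\<ge>0. 0 \<le> l t"
    and supp: "(\<integral>\<^sup>+t\<in>{0..}. indicator {t. q t < 0} t
        \<partial>interval_measure (\<lambda>t. if t < 0 then 0 else l t)) = 0"
    and "0 \<le> h" "0 \<le> m"
    and neg: "\<And>s. 0 \<le> s \<Longrightarrow> s \<le> h \<Longrightarrow> m < l s \<Longrightarrow> q s < 0"
  shows "l h \<le> m"
proof (rule ccontr)
  assume contra: "\<not> l h \<le> m"
  define G where "G = (\<lambda>t. if t < 0 then 0 else l t)"
  define \<mu> where "\<mu> = interval_measure G"
  define A where "A = {s. 0 \<le> s \<and> s \<le> h \<and> m < l s}"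
  define \<tau> where "\<tau> = Inf A"
  have Gmono: "G x \<le> G y" if "x \<le> y" for x y
    using that mono nonneg by (auto simp: G_def mono_on_def)
  have Gright: "continuous (at_right a) G" for a
  proof (cases "a < 0")
    case True
    then have "eventually (\<lambda>t. G t = 0) (at_right a)"
      using eventually_at_right_real[of a 0] by (auto elim!: eventually_mono simp: G_def)
    then show ?thesis
      using True by (auto simp: continuous_within G_def intro: tendsto_eventually)
  next
    case False
    then have "(l \<longlongrightarrow> l a) (at_right a)"
      using \<open>cadlag l\<close> by (auto simp: cadlag_def)
    moreover have "eventually (\<lambda>t. G t = l t) (at_right a)"
      using False by (auto simp: eventually_at_filter G_def)
    ultimately have "(G \<longlongrightarrow> l a) (at_right a)"
      by (simp add: tendsto_cong)
    with False show ?thesis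
      by (auto simp: continuous_within G_def)
  qed
  have Ioc: "emeasure \<mu> {a<..b} = ennreal (G b - G a)" if "a \<le> b" for a b
    unfolding \<mu>_def using that Gmono Gright by (intro emeasure_interval_measure_Ioc) auto
  \<comment> \<open>The set where \<open>q\<close> is negative need not be Borel:
    \<open>nn_integral_mono\<close> compares arbitrary integrands, and only \<open>B\<close> must be
    measurable for its indicator to integrate to its measure.\<close>
  have null: "emeasure \<mu> B = 0" if "B \<in> sets borel" "B \<subseteq> A" for B
  proof -
    have "emeasure \<mu> B = (\<integral>\<^sup>+t. indicator B t \<partial>\<mu>)"
      using that by (simp add: \<mu>_def)
    also have "\<dots> \<le> (\<integral>\<^sup>+t\<in>{0..}. indicator {t. q t < 0} t \<partial>\<mu>)"
      using that neg by (intro nn_integral_mono) (auto simp: A_def indicator_def)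
    finally show ?thesis
      using supp by (simp add: \<mu>_def G_def)
  qed
  have "h \<in> A"
    using contra \<open>0 \<le> h\<close> by (auto simp: A_def)
  have bdd: "bdd_below A"
    by (auto simp: A_def bdd_below_def)
  have \<tau>: "0 \<le> \<tau>" "\<tau> \<le> h"
    using \<open>h \<in> A\<close> bdd by (auto simp: \<tau>_def A_def intro: cInf_greatest cInf_lower)
  have up: "s \<in> A" if "\<tau> < s" "s \<le> h" for s
  proof -
    obtain r where "r \<in> A" "r < s"
      using cInf_lessD[of A s] \<open>\<tau> < s\<close> \<open>h \<in> A\<close> by (auto simp: \<tau>_def)
    then have "l r \<le> l s"
      using mono by (auto simp: A_def mono_on_def)
    with \<open>r \<in> A\<close> \<open>r < s\<close> \<open>s \<le> h\<close> show ?thesis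
      by (auto simp: A_def)
  qed
  have "l h - m > 0"
    using contra by simp
  show False
  proof (cases "\<tau> \<in> A")
    case False
    have "emeasure \<mu> {\<tau><..h} = 0"
      using up by (intro null) auto
    then have "G h - G \<tau> \<le> 0"
      using Ioc[OF \<tau>(2)] by (simp add: ennreal_eq_0_iff)
    with \<tau> False contra show False
      by (auto simp: G_def A_def)
  next
    \<comment> \<open>Here \<open>l\<close> jumps above \<open>m\<close> at \<tau>, possibly at
      \<tau> = 0, where the extension by 0 jumps. The atom at \<tau> has to be counted, so the mass
      of the closed interval is obtained as a limit of half-open ones starting slightly to its
      left.\<close>
    case True
    have "emeasure \<mu> {\<tau>..h} = 0"
    proof (rule null)
      show "{\<tau>..h} \<subseteq> A"
        using up True by (metis atLeastAtMost_iff order_le_less subsetI)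
    qed simp
    \<comment> \<open>On [0,\<tau>) this is the minimality of \<tau>; at negative times the
      extension vanishes, and \<open>0 \<le> m\<close> is what is needed.\<close>
    have below: "G a \<le> m" if "a < \<tau>" for a
    proof (cases "a < 0")
      case False
      have "a \<notin> A"
        using that cInf_lower[OF _ bdd, of a] by (auto simp: \<tau>_def)
      with False that \<tau> show ?thesis by (auto simp: A_def G_def)
    qed (use \<open>0 \<le> m\<close> in \<open>auto simp: G_def\<close>)
    define X where "X = (\<lambda>n. \<tau> - 1 / real (Suc n))"
    have X: "X n < \<tau>" for n by (simp add: X_def)
    have "incseq X"
      by (auto simp: X_def incseq_def frac_le)
    have "X \<longlonglongrightarrow> \<tau> - 0"
      unfolding X_def by (intro tendsto_intros LIMSEQ_Suc[OF lim_1_over_n])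
    then have lim: "X \<longlonglongrightarrow> \<tau>" by simp
    have "(\<lambda>n. emeasure \<mu> {X n<..h}) \<longlonglongrightarrow> emeasure \<mu> (\<Inter>n. {X n<..h})"
    proof (rule Lim_emeasure_decseq)
      show "decseq (\<lambda>n. {X n<..h})"
        using \<open>incseq X\<close> by (force simp: decseq_def incseq_def)
      show "emeasure \<mu> {X n<..h} \<noteq> \<infinity>" for n
        using X[of n] \<tau> by (subst Ioc) auto
    qed (auto simp: \<mu>_def)
    moreover have "(\<Inter>n. {X n<..h}) = {\<tau>..h}"
    proof (intro equalityI subsetI)
      fix x assume "x \<in> (\<Inter>n. {X n<..h})"
      then show "x \<in> {\<tau>..h}"
        using LIMSEQ_le_const2[OF lim, of x] by (auto intro: less_imp_le)
    next
      fix x assume "x \<in> {\<tau>..h}"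
      then show "x \<in> (\<Inter>n. {X n<..h})"
        using X by (auto intro: less_le_trans)
    qed
    moreover have "ennreal (l h - m) \<le> emeasure \<mu> {X n<..h}" for n
    proof -
      have "X n \<le> h" using X[of n] \<tau> by auto
      then show ?thesis
        using below[OF X[of n]] \<open>0 \<le> h\<close> by (subst Ioc) (auto simp: G_def intro!: ennreal_leI)
    qed
    ultimately have "ennreal (l h - m) \<le> emeasure \<mu> {\<tau>..h}"
      by (intro LIMSEQ_le_const) auto
    with \<open>emeasure \<mu> {\<tau>..h} = 0\<close> \<open>l h - m > 0\<close> show False
      by simp
  qed
qed

lemma set_lebesgue_integral_approx:
  fixes f :: "real \<Rightarrow> real"
  assumes int: "set_integrable lborel {0..h} f" and "0 \<le> h"
    and bound: "\<And>s. 0 \<le> s \<Longrightarrow> s \<le> h \<Longrightarrow> \<bar>f s - c\<bar> \<le> d"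
  shows "\<bar>(LBINT s:{0..h}. f s) - h * c\<bar> \<le> h * d"
proof -
  have const: "set_integrable lborel {0..h} (\<lambda>_. k)" "(LBINT s:{0..h}. k) = h * k" for k :: real
    using \<open>0 \<le> h\<close> by (auto simp: set_integrable_def set_lebesgue_integral_def)
  have "(LBINT s:{0..h}. f s) \<le> (LBINT s:{0..h}. c + d)"
    using bound by (intro set_integral_mono int const) (auto simp: abs_le_iff algebra_simps)
  moreover have "(LBINT s:{0..h}. c - d) \<le> (LBINT s:{0..h}. f s)"
  proof (intro set_integral_mono int const)
    fix s assume "s \<in> {0..h}"
    then show "c - d \<le> f s" using bound[of s] by (auto simp: abs_le_iff)
  qed
  ultimately show ?thesis
    by (simp add: const abs_le_iff algebra_simps)
qed

section \<open>A priori bounds for a single path on a short interval\<close>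

locale driven_path =
  fixes \<beta> :: real and w q1 q2 l :: "real \<Rightarrow> real" and h \<zeta> :: real
  assumes path: "diffusion_path \<beta> w q1 q2 l"
    and beta: "0 < \<beta>" and h: "0 \<le> h" "h \<le> 1 / 4"
    and w: "\<And>s. 0 \<le> s \<Longrightarrow> s \<le> h \<Longrightarrow> \<bar>w s\<bar> \<le> \<zeta>"
begin

definition N where "N = q2 0 - q1 0"
text \<open>The bound for \<open>- q1 + q2\<close> on all of [0,h] that \<open>B_bound\<close>
  establishes, with coefficients rounded up; \<open>N\<close> measures the initial state.\<close>

definition B where "B = 2 * N + 10 * \<zeta> + 2 * \<beta>"

lemma nonneg: "0 \<le> s \<Longrightarrow> q1 s \<le> 0" "0 \<le> s \<Longrightarrow> 0 < q2 s" "0 \<le> s \<Longrightarrow> 0 \<le> l s"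
  and integrable: "0 \<le> s \<Longrightarrow> set_integrable lborel {0..s} q1" "0 \<le> s \<Longrightarrow> set_integrable lborel {0..s} q2"
  and q1_eq: "0 \<le> s \<Longrightarrow> q1 s = q1 0 + sqrt 2 * w s - \<beta> * s + (LBINT r:{0..s}. - q1 r + q2 r) - l s"
  and q2_eq: "0 \<le> s \<Longrightarrow> q2 s = q2 0 + l s - (LBINT r:{0..s}. q2 r)"
  using path unfolding diffusion_path_def by blast+

lemma support:
  "cadlag l" "mono_on {0..} l" "\<forall>t\<ge>0. 0 \<le> l t"
  "(\<integral>\<^sup>+t\<in>{0..}. indicator {t. q1 t < 0} t \<partial>interval_measure (\<lambda>t. if t < 0 then 0 else l t)) = 0"
  using path unfolding diffusion_path_def by blast+

lemma l_mono: "0 \<le> s \<Longrightarrow> s \<le> t \<Longrightarrow> l s \<le> l t"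
  using support(2) by (auto simp: mono_on_def)

lemma zeta_nonneg: "0 \<le> \<zeta>"
  using w[of 0] h by auto

lemma N_nonneg: "0 \<le> N"
  using nonneg(1,2)[of 0] by (auto simp: N_def)

lemma B_nonneg: "0 \<le> B"
  using zeta_nonneg N_nonneg beta by (auto simp: B_def)

lemma sqrt2_w: "0 \<le> s \<Longrightarrow> s \<le> h \<Longrightarrow> \<bar>sqrt 2 * w s\<bar> \<le> 3 / 2 * \<zeta>"
proof -
  assume "0 \<le> s" "s \<le> h"
  have "sqrt 2 \<le> 3 / 2"
    by (rule real_le_lsqrt) (auto simp: power2_eq_square)
  then show ?thesis
    using w[OF \<open>0 \<le> s\<close> \<open>s \<le> h\<close>] unfolding abs_mult by (intro mult_mono) auto
qed

lemma integrable_total: "0 \<le> s \<Longrightarrow> set_integrable lborel {0..s} (\<lambda>r. - q1 r + q2 r)"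
  using set_integral_add(1)[of lborel "{0..s}" "\<lambda>r. - q1 r" q2] integrable[of s]
  by (auto simp: set_integrable_def)

lemma set_integrable_const_Icc: "set_integrable lborel {0..s::real} (\<lambda>_. k :: real)"
  unfolding set_integrable_def
  by (intro integrable_scaleR_left) (auto simp: integrable_indicator_iff emeasure_lborel_Icc_eq)

lemma integral_nonneg:
  "0 \<le> s \<Longrightarrow> 0 \<le> (LBINT r:{0..s}. - q1 r + q2 r)" "0 \<le> s \<Longrightarrow> 0 \<le> (LBINT r:{0..s}. q2 r)"
  unfolding set_lebesgue_integral_def using nonneg
  by (intro Bochner_Integration.integral_nonneg; force simp: indicator_def)+

lemma skorokhod:
  assumes "0 \<le> m"
    and "\<And>s. 0 \<le> s \<Longrightarrow> s \<le> h \<Longrightarrow> q1 0 + sqrt 2 * w s - \<beta> * s + (LBINT r:{0..s}. - q1 r + q2 r) \<le> m"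
  shows "l h \<le> m"
proof (rule skorokhod_le[where q = q1 and l = l and h = h and m = m])
  fix s assume that: "0 \<le> s" "s \<le> h" "m < l s"
  show "q1 s < 0" 
    using assms(2)[OF that(1,2)] q1_eq[OF that(1)] that by simp
qed (fact support h \<open>0 \<le> m\<close>)+

text \<open>The integral terms in the equations of \<open>q2\<close> and \<open>- q1\<close> have a
  favourable sign, so both paths are controlled by the still unknown \<open>l h\<close> without a
  Gronwall argument. The third bound feeds this back into the free part of the path.\<close>

lemma bounds_from_reflection:
  assumes "0 \<le> s" "s \<le> h"
  shows "q2 s \<le> q2 0 + l h" "- q1 s \<le> - q1 0 + 3 / 2 * \<zeta> + \<beta> * h + l h"
    "(LBINT r:{0..s}. - q1 r + q2 r) \<le> h * (N + 3 / 2 * \<zeta> + \<beta> * h + 2 * l h)"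
proof -
  have ls: "l r \<le> l h" if "0 \<le> r" "r \<le> h" for r
    using l_mono that by auto
  have 1: "q2 r \<le> q2 0 + l h" if "0 \<le> r" "r \<le> h" for r
    using q2_eq[OF that(1)] integral_nonneg(2)[OF that(1)] ls[OF that] by linarith
  have 2: "- q1 r \<le> - q1 0 + 3 / 2 * \<zeta> + \<beta> * h + l h" if "0 \<le> r" "r \<le> h" for r
  proof -
    have "\<beta> * r \<le> \<beta> * h" using that beta by (auto intro: mult_left_mono)
    then show ?thesis
      using q1_eq[OF that(1)] integral_nonneg(1)[OF that(1)] ls[OF that] sqrt2_w[OF that] by linarith
  qed
  let ?M = "N + 3 / 2 * \<zeta> + \<beta> * h + 2 * l h"
  have M: "0 \<le> ?M"
    using N_nonneg zeta_nonneg beta h nonneg(3)[OF h(1)] by (intro add_nonneg_nonneg mult_nonneg_nonneg) auto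
  have "(LBINT r:{0..s}. - q1 r + q2 r) \<le> (LBINT r:{0..s}. ?M)"
  proof (intro set_integral_mono integrable_total \<open>0 \<le> s\<close>)
    fix r assume "r \<in> {0..s}"
    then show "- q1 r + q2 r \<le> ?M"
      using 1[of r] 2[of r] assms by (auto simp: N_def)
  qed (rule set_integrable_const_Icc)
  also have "\<dots> = s * ?M"
    using \<open>0 \<le> s\<close> by (simp add: set_lebesgue_integral_def)
  also have "\<dots> \<le> h * ?M"
    using M assms by (intro mult_right_mono) auto
  finally show "(LBINT r:{0..s}. - q1 r + q2 r) \<le> h * ?M" .
  show "q2 s \<le> q2 0 + l h" "- q1 s \<le> - q1 0 + 3 / 2 * \<zeta> + \<beta> * h + l h"
    using 1[OF assms] 2[OF assms] .
qed

lemma h_mult: "0 \<le> x \<Longrightarrow> h * x \<le> x / 4"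
  using mult_right_mono[OF h(2), of x] by simp

text \<open>The Skorokhod estimate bounds \<open>l h\<close> by an expression that itself contains
  \<open>2 * (h * l h)\<close>. Since h is at most 1/4, this is at most half of \<open>l h\<close>
  and can be absorbed on the left.\<close>

lemma l_bound: "l h \<le> 4 * \<zeta> + 2 * h * (N + \<beta>)"
proof -
  let ?M = "N + 3 / 2 * \<zeta> + \<beta> * h + 2 * l h"
  have lh: "0 \<le> l h" using nonneg h by auto
  have M: "0 \<le> ?M"
    using N_nonneg zeta_nonneg beta h lh by (intro add_nonneg_nonneg mult_nonneg_nonneg) auto
  have "l h \<le> 3 / 2 * \<zeta> + h * ?M"
  proof (rule skorokhod)
    show "0 \<le> 3 / 2 * \<zeta> + h * ?M" using M zeta_nonneg h by auto
    fix s assume s: "0 \<le> s" "s \<le> h"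
    show "q1 0 + sqrt 2 * w s - \<beta> * s + (LBINT r:{0..s}. - q1 r + q2 r) \<le> 3 / 2 * \<zeta> + h * ?M"
      using bounds_from_reflection(3)[OF s] sqrt2_w[OF s] nonneg(1)[of 0] mult_nonneg_nonneg[of \<beta> s] beta s
      by linarith
  qed
  also have "\<dots> = 3 / 2 * \<zeta> + h * N + 3 / 2 * (h * \<zeta>) + h * (\<beta> * h) + 2 * (h * l h)"
    by (simp add: algebra_simps)
  finally have "l h \<le> 3 / 2 * \<zeta> + h * N + 3 / 2 * (h * \<zeta>) + h * (\<beta> * h) + 2 * (h * l h)" .
  moreover have "h * l h \<le> l h / 4" "h * \<zeta> \<le> \<zeta> / 4"
    using h_mult lh zeta_nonneg by auto
  moreover have "h * (\<beta> * h) \<le> h * \<beta>"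
    using h beta by (intro mult_left_mono) (auto simp: mult_le_cancel_left1)
  ultimately show ?thesis
    using zeta_nonneg by (simp add: algebra_simps)
qed

lemma B_bound:
  assumes "0 \<le> s" "s \<le> h"
  shows "- q1 s + q2 s \<le> B"
proof -
  have "- q1 s + q2 s \<le> N + 3 / 2 * \<zeta> + h * \<beta> + 2 * l h"
    using bounds_from_reflection[OF assms] by (simp add: N_def algebra_simps)
  moreover have "h * \<beta> \<le> \<beta> / 4" "h * N \<le> N / 4"
    using h_mult beta N_nonneg by auto
  moreover have "l h \<le> 4 * \<zeta> + 2 * (h * N) + 2 * (h * \<beta>)"
    using l_bound by (simp add: algebra_simps)
  ultimately show ?thesis
    using zeta_nonneg beta N_nonneg unfolding B_def by linarith
qed

lemma integral_le_B:
  assumes "0 \<le> s" "s \<le> h"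
  shows "(LBINT r:{0..s}. - q1 r + q2 r) \<le> h * B" "(LBINT r:{0..s}. q2 r) \<le> h * B"
proof -
  have *: "(LBINT r:{0..s}. f r) \<le> h * B"
    if "set_integrable lborel {0..s} f" "\<And>r. 0 \<le> r \<Longrightarrow> r \<le> h \<Longrightarrow> f r \<le> B" for f
  proof -
    have "(LBINT r:{0..s}. f r) \<le> (LBINT r:{0..s}. B)"
      using that assms by (intro set_integral_mono) (auto simp: set_integrable_const_Icc)
    also have "\<dots> = s * B"
      using \<open>0 \<le> s\<close> by (simp add: set_lebesgue_integral_def)
    also have "\<dots> \<le> h * B"
      using B_nonneg assms by (intro mult_right_mono) auto
    finally show ?thesis .
  qed
  show "(LBINT r:{0..s}. - q1 r + q2 r) \<le> h * B"
    using assms B_bound integrable_total by (intro *) auto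
  have "q2 r \<le> B" if "0 \<le> r" "r \<le> h" for r
    using B_bound[OF that] nonneg(1)[OF that(1)] by simp
  then show "(LBINT r:{0..s}. q2 r) \<le> h * B"
    using assms integrable by (intro *) auto
qed

text \<open>A path starting further from the boundary than noise and drift can carry it within the
  step never gets there: its free part stays nonpositive, so the Skorokhod estimate with level 0
  gives \<open>l h = 0\<close>.\<close>

lemma hit_bound:
  assumes "0 < l h"
  shows "- q1 0 \<le> 3 / 2 * \<zeta> + h * B"
proof (rule ccontr)
  assume "\<not> ?thesis"
  then have "l h \<le> 0"
  proof (intro skorokhod)
    fix s assume s: "0 \<le> s" "s \<le> h" and *: "\<not> - q1 0 \<le> 3 / 2 * \<zeta> + h * B"
    show "q1 0 + sqrt 2 * w s - \<beta> * s + (LBINT r:{0..s}. - q1 r + q2 r) \<le> 0"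
      using integral_le_B(1)[OF s] sqrt2_w[OF s] mult_nonneg_nonneg[of \<beta> s] beta s * by linarith
  qed auto
  with assms show False by simp
qed

lemma free_part:
  "\<bar>q1 h - (q1 0 + sqrt 2 * w h - l h)\<bar> \<le> h * (B + \<beta>)"
proof -
  have "h * \<beta> \<ge> 0" "h * B \<ge> 0" using h beta B_nonneg by auto
  then show ?thesis
    using q1_eq[OF h(1)] integral_le_B(1)[OF h(1) order_refl] integral_nonneg(1)[OF h(1)]
    by (auto simp: abs_le_iff algebra_simps)
qed

lemma increments:
  assumes "0 \<le> s" "s \<le> h"
  shows "\<bar>q1 s - q1 0\<bar> \<le> 2 * \<zeta> + l h + h * (B + \<beta>)" "\<bar>q2 s - q2 0\<bar> \<le> l h + h * B"
proof -
  have "h * \<beta> \<ge> 0" "h * B \<ge> 0" "\<beta> * s \<le> h * \<beta>" "\<beta> * s \<ge> 0"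
    using h beta B_nonneg assms by (auto simp: mult.commute[of \<beta>] intro: mult_right_mono)
  then show "\<bar>q1 s - q1 0\<bar> \<le> 2 * \<zeta> + l h + h * (B + \<beta>)" "\<bar>q2 s - q2 0\<bar> \<le> l h + h * B"
    using q1_eq[OF assms(1)] q2_eq[OF assms(1)] integral_le_B[OF assms] integral_nonneg[OF assms(1)] sqrt2_w[OF assms]
      l_mono[OF assms] nonneg(3)[OF assms(1)] zeta_nonneg
    unfolding abs_le_iff distrib_left by (safe; linarith)+
qed

text \<open>The two occurrences of \<open>l\<close> and of the integral of \<open>q2\<close> cancel.
  What is left is the integral of \<open>- q1\<close>, and freezing \<open>q1\<close> at its initial
  value costs h times its oscillation.\<close>

lemma sum_increment:
  "\<bar>(q1 h + q2 h) - (q1 0 + q2 0) - sqrt 2 * w h - h * (- q1 0 - \<beta>)\<bar> \<le> h * (2 * \<zeta> + l h + h * (B + \<beta>))"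
proof -
  have "(LBINT r:{0..h}. - q1 r + q2 r) = (LBINT r:{0..h}. - q1 r) + (LBINT r:{0..h}. q2 r)"
    using integrable[OF h(1)] by (intro set_integral_add) (auto simp: set_integrable_def)
  then have "(q1 h + q2 h) - (q1 0 + q2 0) - sqrt 2 * w h - h * (- q1 0 - \<beta>)
      = (LBINT r:{0..h}. - q1 r) - h * (- q1 0)"
    using q1_eq[OF h(1)] q2_eq[OF h(1)] by (simp add: algebra_simps)
  moreover have "\<bar>(LBINT r:{0..h}. - q1 r) - h * (- q1 0)\<bar> \<le> h * (2 * \<zeta> + l h + h * (B + \<beta>))"
  proof (rule set_lebesgue_integral_approx)
    show "\<bar>- q1 s - - q1 0\<bar> \<le> 2 * \<zeta> + l h + h * (B + \<beta>)" if "0 \<le> s" "s \<le> h" for s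
      using increments(1)[OF that] by (simp add: abs_minus_commute)
  qed (use integrable[OF h(1)] h in \<open>auto simp: set_integrable_def\<close>)
  ultimately show ?thesis by simp
qed

lemma unreflected_increment:
  assumes "l h = 0"
  shows "\<bar>q2 h - q2 0 + h * q2 0\<bar> \<le> h * (h * B)"
proof -
  have "\<bar>(LBINT r:{0..h}. q2 r) - h * q2 0\<bar> \<le> h * (h * B)"
    using increments(2) assms by (intro set_lebesgue_integral_approx) (use integrable[OF h(1)] h in auto)
  then show ?thesis
    using q2_eq[OF h(1)] assms by (simp add: abs_le_iff)
qed

end

section \<open>Brownian motion on a short interval\<close>

text \<open>The weight \<open>10000 / 6561\<close> is \<open>(10 / 9)^4\<close>: level \<open>j\<close> then contributes at most \<open>c * (9 / 10)^j\<close>.\<close>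

lemma dyadic_chaining:
  fixes w :: "real \<Rightarrow> real"
  assumes cont: "continuous_on {0..h} w" and "0 < h" and w0: "w 0 = 0" and "0 \<le> c"
    and bound: "\<And>j. (10000 / 6561) ^ j * (\<Sum>k<2 ^ j. (w (h * real (Suc k) / 2 ^ j) - w (h * real k / 2 ^ j)) ^ 4) \<le> c ^ 4"
    and t: "0 \<le> t" "t \<le> h"
  shows "\<bar>w t\<bar> \<le> 10 * c"
proof -
  define D where "D = (\<lambda>j k. w (h * real (Suc k) / 2 ^ j) - w (h * real k / 2 ^ j))"
  have incr: "\<bar>D j k\<bar> \<le> c * (9 / 10) ^ j" if "k < 2 ^ j" for j k
  proof -
    have "D j k ^ 4 \<le> (\<Sum>k<2 ^ j. D j k ^ 4)"
      using that by (intro member_le_sum) auto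
    then have "(10000 / 6561) ^ j * D j k ^ 4 \<le> c ^ 4"
      using bound[of j] unfolding D_def
      by (meson mult_left_mono order_trans zero_le_power divide_nonneg_nonneg zero_le_numeral)
    then have "(6561 / 10000) ^ j * ((10000 / 6561) ^ j * D j k ^ 4) \<le> (6561 / 10000) ^ j * c ^ 4"
      by (rule mult_left_mono) auto
    moreover have "(6561 / 10000) ^ j * ((10000 / 6561) ^ j * D j k ^ 4) = D j k ^ 4"
      by (simp add: power_mult_distrib[symmetric] mult.assoc[symmetric])
    moreover have "(6561 / 10000 :: real) ^ j = ((9 / 10) ^ j) ^ 4"
      by (simp add: power_mult[symmetric] mult.commute[of j]) (simp add: power_mult power4_eq_xxxx)
    ultimately have "D j k ^ 4 \<le> (c * (9 / 10) ^ j) ^ 4"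
      unfolding power_mult_distrib by (metis mult.commute)
    then have "\<bar>D j k\<bar> ^ 4 \<le> (c * (9 / 10) ^ j) ^ 4"
      by (simp add: power_even_abs)
    then show ?thesis
      by (rule power_le_imp_le_base[where n = 3, simplified]) (use \<open>0 \<le> c\<close> in auto)
  qed
  \<comment> \<open>The geometric series with ratio 9/10 sums to 10, the factor in the
    conclusion.\<close>
  have sum_le: "c * (\<Sum>i\<le>j. (9 / 10) ^ i) \<le> 10 * c" for j
  proof -
    have "(\<Sum>i\<le>j. (9 / 10 :: real) ^ i) \<le> 10"
      by (subst sum_gp0) (auto simp: field_simps)
    then show ?thesis
      using mult_left_mono[of "\<Sum>i\<le>j. (9 / 10 :: real) ^ i" 10 c] \<open>0 \<le> c\<close> by (simp add: mult.commute)
  qed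
  \<comment> \<open>A grid point of even index lies on the coarser grid already; one of odd index is
    a single increment of the current level away from its left neighbour. So each level costs at
    most one increment.\<close>
  have dyadic: "\<bar>w (h * real k / 2 ^ j)\<bar> \<le> c * (\<Sum>i\<le>j. (9 / 10) ^ i)" if "k \<le> 2 ^ j" for k j
    using that
  proof (induction j arbitrary: k)
    case 0
    then consider "k = 0" | "k = 1" by fastforce
    then show ?case
      using incr[of 0 0] w0 \<open>0 \<le> c\<close> by cases (auto simp: D_def)
  next
    case (Suc j)
    have split: "c * (\<Sum>i\<le>Suc j. (9 / 10) ^ i) = c * (\<Sum>i\<le>j. (9 / 10) ^ i) + c * (9 / 10) ^ Suc j"
      by (simp add: distrib_left)
    have "0 \<le> c * (9 / 10) ^ Suc j"
      using \<open>0 \<le> c\<close> by simp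
    show ?case
    proof (cases "even k")
      case True
      then obtain m where k: "k = 2 * m" by (auto elim: evenE)
      then have "m \<le> 2 ^ j" using Suc.prems by simp
      moreover have "h * real k / 2 ^ Suc j = h * real m / 2 ^ j"
        by (simp add: k)
      ultimately show ?thesis
        using Suc.IH[of m] \<open>0 \<le> c * (9 / 10) ^ Suc j\<close> unfolding split by simp
    next
      case False
      then obtain m where k: "k = Suc (2 * m)" by (auto elim: oddE)
      then have m: "m \<le> 2 ^ j" "2 * m < 2 ^ Suc j" using Suc.prems by auto
      have eq: "h * real (2 * m) / 2 ^ Suc j = h * real m / 2 ^ j" by simp
      have "\<bar>w (h * real k / 2 ^ Suc j) - w (h * real m / 2 ^ j)\<bar> \<le> c * (9 / 10) ^ Suc j"
        using incr[OF m(2)] unfolding D_def eq k .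
      then show ?thesis
        using Suc.IH[OF m(1)] unfolding split by linarith
    qed
  qed
  \<comment> \<open>Dyadic approximations of \<open>t\<close> from the left, within h / 2^j;
    continuity carries the bound over to \<open>t\<close>.\<close>
  define k where "k = (\<lambda>j. nat \<lfloor>t / h * 2 ^ j\<rfloor>)"
  define x where "x = (\<lambda>j. h * real (k j) / 2 ^ j)"
  have th: "0 \<le> t / h" "t / h \<le> 1" using t \<open>0 < h\<close> by auto
  have k: "k j \<le> 2 ^ j" "real (k j) \<le> t / h * 2 ^ j" "t / h * 2 ^ j - 1 \<le> real (k j)" for j
  proof -
    have "0 \<le> t / h * 2 ^ j" using th(1) by (rule mult_nonneg_nonneg) simp
    then show "real (k j) \<le> t / h * 2 ^ j" "t / h * 2 ^ j - 1 \<le> real (k j)"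
      unfolding k_def by linarith+
    moreover have "t / h * 2 ^ j \<le> 1 * 2 ^ j"
      using th(2) by (rule mult_right_mono) simp
    ultimately have "real (k j) \<le> 2 ^ j" by linarith
    then show "k j \<le> 2 ^ j" by (metis of_nat_le_iff of_nat_numeral of_nat_power)
  qed
  have x_le: "x j \<le> t" "t - h * (1 / 2) ^ j \<le> x j" for j
  proof -
    show "x j \<le> t"
      using k(2)[of j] \<open>0 < h\<close> by (simp add: x_def field_simps)
    have "t \<le> (h * real (k j) + h) / 2 ^ j"
      using k(3)[of j] \<open>0 < h\<close> by (simp add: field_simps)
    then show "t - h * (1 / 2) ^ j \<le> x j"
      by (simp add: x_def power_one_over add_divide_distrib)
  qed
  have "(\<lambda>j. t - h * (1 / 2) ^ j) \<longlonglongrightarrow> t - h * 0"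
    by (intro tendsto_intros LIMSEQ_power_zero) auto
  then have lower: "(\<lambda>j. t - h * (1 / 2) ^ j) \<longlonglongrightarrow> t" by simp
  have lim: "x \<longlonglongrightarrow> t"
    by (rule real_tendsto_sandwich[OF _ _ lower tendsto_const]; rule always_eventually; rule allI; rule x_le)
  have "x j \<in> {0..h}" for j
    using x_le(1)[of j] t \<open>0 < h\<close> by (auto simp: x_def)
  then have "(\<lambda>j. w (x j)) \<longlonglongrightarrow> w t"
    using continuous_on_tendsto_compose[OF cont lim] t by auto
  moreover have "\<bar>w (x j)\<bar> \<le> 10 * c" for j
    using order_trans[OF dyadic[OF k(1)] sum_le, of j] by (simp add: x_def)
  ultimately show ?thesis
    by (intro LIMSEQ_le_const2[OF tendsto_rabs]) auto
qed

lemma normal_fourth_moment: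
  assumes "distributed M lborel X (normal_density 0 \<sigma>)" "0 < \<sigma>"
  shows "(\<integral>\<^sup>+x. ennreal (X x ^ 4) \<partial>M) = ennreal (3 * \<sigma> ^ 4)"
proof -
  have *: "has_bochner_integral lborel (\<lambda>x. normal_density 0 \<sigma> x * x ^ 4) (3 * \<sigma> ^ 4)"
    using normal_moment_even[OF \<open>0 < \<sigma>\<close>, of 0 2] \<open>0 < \<sigma>\<close>
    by (simp add: fact_numeral power4_eq_xxxx power2_eq_square field_simps)
  have "(\<integral>\<^sup>+x. ennreal (X x ^ 4) \<partial>M) = (\<integral>\<^sup>+x. ennreal (normal_density 0 \<sigma> x) * ennreal (x ^ 4) \<partial>lborel)"
    by (rule distributed_nn_integral[OF assms(1), symmetric]) auto
  also have "\<dots> = (\<integral>\<^sup>+x. ennreal (normal_density 0 \<sigma> x * x ^ 4) \<partial>lborel)"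
    by (simp add: ennreal_mult)
  also have "\<dots> = ennreal (3 * \<sigma> ^ 4)"
    using * by (subst nn_integral_eq_integral) (auto simp: has_bochner_integral_iff)
  finally show ?thesis .
qed

text \<open>The fourth powers of all dyadic increments are added up over all levels, with the
  weights of the chaining estimate. Level j has 2^j increments of fourth moment 3 (h / 2^j)^2, so
  with the weight (10000/6561)^j it contributes 3 h^2 (5000/6561)^j, which is summable. The result
  is a measurable bound for the running maximum, of the natural size sqrt h in fourth mean.\<close>

lemma brownian_sup_bound:
  assumes W: "standard_brownian_motion M W" and "0 < h"
  shows "\<exists>\<zeta>. \<zeta> \<in> borel_measurable M \<and> (\<forall>\<omega>. 0 \<le> \<zeta> \<omega>) \<and> integrable M (\<lambda>\<omega>. \<zeta> \<omega> ^ 4) \<and>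
    (\<integral>\<omega>. \<zeta> \<omega> ^ 4 \<partial>M) \<le> 130000 * h\<^sup>2 \<and> (AE \<omega> in M. \<forall>s. 0 \<le> s \<longrightarrow> s \<le> h \<longrightarrow> \<bar>W s \<omega>\<bar> \<le> \<zeta> \<omega>)"
proof -
  define Z where "Z = (\<lambda>j \<omega>. (10000 / 6561) ^ j * (\<Sum>k<2 ^ j. (W (h * real (Suc k) / 2 ^ j) \<omega> - W (h * real k / 2 ^ j) \<omega>) ^ 4))"
  define \<Xi> where "\<Xi> = (\<lambda>\<omega>. \<Sum>j. ennreal (Z j \<omega>))"
  \<comment> \<open>Where the series diverges, \<open>enn2real\<close> returns 0 and the bound would
    be false; this happens only on a null set because the series has finite expectation.\<close>
  define \<zeta> where "\<zeta> = (\<lambda>\<omega>. 10 * root 4 (enn2real (\<Xi> \<omega>)))"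
  have W_meas [measurable]: "W t \<in> borel_measurable M" if "0 \<le> t" for t
    using W that by (auto simp: standard_brownian_motion_def)
  have [measurable]: "W (h * real k / 2 ^ j) \<in> borel_measurable M" for k j :: nat
    using \<open>0 < h\<close> by (intro W_meas) auto
  have Z_meas [measurable]: "Z j \<in> borel_measurable M" for j
    unfolding Z_def by measurable
  have \<Xi>_meas [measurable]: "\<Xi> \<in> borel_measurable M"
    unfolding \<Xi>_def by measurable
  have Z_nonneg: "0 \<le> Z j \<omega>" for j \<omega>
    unfolding Z_def by (intro mult_nonneg_nonneg sum_nonneg) auto
  have moment: "(\<integral>\<^sup>+\<omega>. ennreal ((W (h * real (Suc k) / 2 ^ j) \<omega> - W (h * real k / 2 ^ j) \<omega>) ^ 4) \<partial>M)
      = ennreal (3 * (h / 2 ^ j)\<^sup>2)" for j k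
  proof -
    have eq: "h * real (Suc k) / 2 ^ j - h * real k / 2 ^ j = h / 2 ^ j"
      by (simp add: field_simps)
    have lt: "h * real k / 2 ^ j < h * real (Suc k) / 2 ^ j"
      using \<open>0 < h\<close> by (simp add: field_simps)
    have "distributed M lborel (\<lambda>\<omega>. W (h * real (Suc k) / 2 ^ j) \<omega> - W (h * real k / 2 ^ j) \<omega>)
        (normal_density 0 (sqrt (h * real (Suc k) / 2 ^ j - h * real k / 2 ^ j)))"
      using W lt \<open>0 < h\<close> unfolding standard_brownian_motion_def by auto
    moreover have "sqrt (h / 2 ^ j) ^ 4 = (h / 2 ^ j)\<^sup>2"
      using power_mult[of "sqrt (h / 2 ^ j)" 2 2] \<open>0 < h\<close> by simp
    ultimately show ?thesis
      using normal_fourth_moment[of M "\<lambda>\<omega>. W (h * real (Suc k) / 2 ^ j) \<omega> - W (h * real k / 2 ^ j) \<omega>" "sqrt (h / 2 ^ j)"]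
        \<open>0 < h\<close> unfolding eq by simp
  qed
  have Z_int: "(\<integral>\<^sup>+\<omega>. ennreal (Z j \<omega>) \<partial>M) = ennreal (3 * h\<^sup>2 * (5000 / 6561) ^ j)" for j
  proof -
    have "(\<integral>\<^sup>+\<omega>. ennreal (Z j \<omega>) \<partial>M) = (\<integral>\<^sup>+\<omega>. ennreal ((10000 / 6561) ^ j) *
        (\<Sum>k<2 ^ j. ennreal ((W (h * real (Suc k) / 2 ^ j) \<omega> - W (h * real k / 2 ^ j) \<omega>) ^ 4)) \<partial>M)"
      unfolding Z_def by (subst sum_ennreal) (auto simp: ennreal_mult')
    also have "\<dots> = ennreal ((10000 / 6561) ^ j) * (\<Sum>k<2 ^ j.
        \<integral>\<^sup>+\<omega>. ennreal ((W (h * real (Suc k) / 2 ^ j) \<omega> - W (h * real k / 2 ^ j) \<omega>) ^ 4) \<partial>M)"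
      by (subst nn_integral_cmult) (auto simp del: sum_ennreal of_nat_Suc intro!: arg_cong2[of _ _ _ _ "(*)"] nn_integral_sum)
    also have "\<dots> = ennreal ((10000 / 6561) ^ j) * ennreal (2 ^ j * (3 * (h / 2 ^ j)\<^sup>2))"
      unfolding moment by (simp add: ennreal_mult ennreal_of_nat_eq_real_of_nat)
    also have "\<dots> = ennreal ((10000 / 6561) ^ j * (2 ^ j * (3 * (h / 2 ^ j)\<^sup>2)))"
      by (simp add: ennreal_mult)
    also have "(10000 / 6561) ^ j * (2 ^ j * (3 * (h / 2 ^ j)\<^sup>2)) = 3 * h\<^sup>2 * ((10000 / 6561) ^ j / 2 ^ j)"
      by (simp add: power2_eq_square)
    also have "(10000 / 6561) ^ j / 2 ^ j = (5000 / 6561 :: real) ^ j"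
      by (simp add: power_divide[symmetric])
    finally show ?thesis .
  qed
  have "(\<integral>\<^sup>+\<omega>. \<Xi> \<omega> \<partial>M) = (\<Sum>j. ennreal (3 * h\<^sup>2 * (5000 / 6561) ^ j))"
    unfolding \<Xi>_def by (subst nn_integral_suminf) (auto simp: Z_int)
  \<comment> \<open>The sum is 3 * 6561 / 1561, slightly below 13. The factor 10 in \<zeta>
    contributes 10^4, which explains 130000.\<close>
  also have "\<dots> = ennreal (3 * h\<^sup>2 * (1 / (1 - 5000 / 6561)))"
    by (intro suminf_ennreal_eq sums_mult geometric_sums) auto
  also have "\<dots> \<le> ennreal (13 * h\<^sup>2)"
    by (intro ennreal_leI) auto
  finally have \<Xi>_int: "(\<integral>\<^sup>+\<omega>. \<Xi> \<omega> \<partial>M) \<le> ennreal (13 * h\<^sup>2)" .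
  then have "(\<integral>\<^sup>+\<omega>. \<Xi> \<omega> \<partial>M) \<noteq> \<infinity>"
    by (metis ennreal_neq_top infinity_ennreal_def neq_top_trans)
  then have fin: "AE \<omega> in M. \<Xi> \<omega> \<noteq> \<infinity>"
    by (intro nn_integral_PInf_AE) auto
  have pow: "\<zeta> \<omega> ^ 4 = 10000 * enn2real (\<Xi> \<omega>)" for \<omega>
    by (simp add: \<zeta>_def power_mult_distrib)
  have \<zeta>_meas [measurable]: "\<zeta> \<in> borel_measurable M"
    unfolding \<zeta>_def by measurable
  have "(\<integral>\<^sup>+\<omega>. ennreal (\<zeta> \<omega> ^ 4) \<partial>M) = (\<integral>\<^sup>+\<omega>. 10000 * \<Xi> \<omega> \<partial>M)"
    using fin by (intro nn_integral_cong_AE) (auto simp: pow ennreal_mult ennreal_enn2real_if)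
  also have "\<dots> \<le> 10000 * ennreal (13 * h\<^sup>2)"
    using \<Xi>_int by (subst nn_integral_cmult) (auto intro: mult_left_mono)
  also have "\<dots> = ennreal (130000 * h\<^sup>2)"
    by (simp add: ennreal_mult[symmetric] flip: ennreal_numeral)
  finally have le: "(\<integral>\<^sup>+\<omega>. ennreal (\<zeta> \<omega> ^ 4) \<partial>M) \<le> ennreal (130000 * h\<^sup>2)" .
  have int: "integrable M (\<lambda>\<omega>. \<zeta> \<omega> ^ 4)"
    using le_less_trans[OF le ennreal_less_top] by (intro integrableI_nonneg) auto
  moreover have "(\<integral>\<omega>. \<zeta> \<omega> ^ 4 \<partial>M) \<le> 130000 * h\<^sup>2"
  proof -
    have "ennreal (\<integral>\<omega>. \<zeta> \<omega> ^ 4 \<partial>M) \<le> ennreal (130000 * h\<^sup>2)"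
      using le int by (subst (asm) nn_integral_eq_integral) auto
    then show ?thesis by (subst (asm) ennreal_le_iff) auto
  qed
  moreover have "AE \<omega> in M. \<forall>s. 0 \<le> s \<longrightarrow> s \<le> h \<longrightarrow> \<bar>W s \<omega>\<bar> \<le> \<zeta> \<omega>"
  proof -
    have "AE \<omega> in M. W 0 \<omega> = 0" "AE \<omega> in M. continuous_on {0..} (\<lambda>t. W t \<omega>)"
      using W by (auto simp: standard_brownian_motion_def)
    with fin show ?thesis
    proof eventually_elim
      case (elim \<omega>)
      have "Z j \<omega> \<le> enn2real (\<Xi> \<omega>)" for j
      proof -
        have "ennreal (Z j \<omega>) \<le> \<Xi> \<omega>"
          unfolding \<Xi>_def using sum_le_suminf[of "\<lambda>j. ennreal (Z j \<omega>)" "{j}"] by simp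
        with elim(1) show ?thesis
          using Z_nonneg by (metis enn2real_ennreal enn2real_mono infinity_ennreal_def less_top)
      qed
      then have "Z j \<omega> \<le> root 4 (enn2real (\<Xi> \<omega>)) ^ 4" for j by simp
      then show ?case
        using dyadic_chaining[of h "\<lambda>t. W t \<omega>" "root 4 (enn2real (\<Xi> \<omega>))"] elim \<open>0 < h\<close>
        continuous_on_subset[of "{0..}" "\<lambda>t. W t \<omega>" "{0..h}"]
        by (auto simp: Z_def \<zeta>_def)
    qed
  qed
  ultimately show ?thesis
    by (intro exI[of _ \<zeta>]) (auto simp: \<zeta>_def)
qed

lemma brownian_distributed:
  assumes W: "standard_brownian_motion M W" and "0 < h"
  shows "distributed M lborel (W h) (normal_density 0 (sqrt h))"
proof -
  have meas [measurable]: "W t \<in> borel_measurable M" if "0 \<le> t" for t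
    using W that by (auto simp: standard_brownian_motion_def)
  have D: "distributed M lborel (\<lambda>\<omega>. W h \<omega> - W 0 \<omega>) (normal_density 0 (sqrt (h - 0)))"
    using W \<open>0 < h\<close> unfolding standard_brownian_motion_def by blast
  have "AE \<omega> in M. W 0 \<omega> = 0"
    using W by (auto simp: standard_brownian_motion_def)
  then have "distr M lborel (W h) = distr M lborel (\<lambda>\<omega>. W h \<omega> - W 0 \<omega>)"
    using \<open>0 < h\<close> by (intro distr_cong_AE) (auto elim!: eventually_mono)
  with D \<open>0 < h\<close> show ?thesis
    by (simp add: distributed_def)
qed

lemma brownian_moments:
  assumes W: "standard_brownian_motion M W" and "0 < h"
  shows "integrable M (W h)" "(\<integral>\<omega>. W h \<omega> \<partial>M) = 0"
    "integrable M (\<lambda>\<omega>. (W h \<omega>)\<^sup>2 - h)" "(\<integral>\<omega>. (W h \<omega>)\<^sup>2 - h \<partial>M) = 0"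
proof -
  interpret prob_space M using W by (simp add: standard_brownian_motion_def)
  note D = brownian_distributed[OF assms]
  have s: "0 < sqrt h" using \<open>0 < h\<close> by simp
  note n1 = normal_moment_nz_1[OF s, of 0] and n2 = normal_moment_even[OF s, of 0 1]
  show "integrable M (W h)"
    using distributed_integrable[OF D, of "\<lambda>x. x"] n1 by (auto simp: has_bochner_integral_iff)
  show "(\<integral>\<omega>. W h \<omega> \<partial>M) = 0"
    using normal_distributed_expectation[OF s D] .
  have i2: "integrable M (\<lambda>\<omega>. (W h \<omega>)\<^sup>2)"
    using distributed_integrable[OF D, of "\<lambda>x. x\<^sup>2"] n2 by (auto simp: has_bochner_integral_iff)
  then show "integrable M (\<lambda>\<omega>. (W h \<omega>)\<^sup>2 - h)" by simp
  have "(\<integral>\<omega>. (W h \<omega>)\<^sup>2 \<partial>M) = h"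
    using distributed_integral[OF D, of "\<lambda>x. x\<^sup>2"] n2 \<open>0 < h\<close> by (auto simp: has_bochner_integral_iff)
  then show "(\<integral>\<omega>. (W h \<omega>)\<^sup>2 - h \<partial>M) = 0"
    using i2 by (simp add: prob_space)
qed

text \<open>By scaling the probability does not depend on \<open>h\<close>. It is the fixed share of
  a putative atom at the boundary that is driven away to distance of order sqrt h, whatever the time
  step.\<close>

lemma brownian_lower_tail:
  assumes W: "standard_brownian_motion M W" and "0 < h"
  shows "measure M {\<omega> \<in> space M. W h \<omega> \<le> - 2 * sqrt h} = measure (density lborel std_normal_density) {..-2}"
proof -
  interpret prob_space M using W by (simp add: standard_brownian_motion_def)
  have D: "distributed M lborel (\<lambda>\<omega>. (W h \<omega> - 0) / sqrt h) std_normal_density"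
    using brownian_distributed[OF assms] normal_standard_normal_convert[of "sqrt h" "W h" 0] \<open>0 < h\<close> by simp
  have "measure (density lborel std_normal_density) {..-2} = measure (distr M lborel (\<lambda>\<omega>. (W h \<omega> - 0) / sqrt h)) {..-2}"
    using distributed_distr_eq_density[OF D] by simp
  also have "\<dots> = measure M ((\<lambda>\<omega>. (W h \<omega> - 0) / sqrt h) -` {..-2} \<inter> space M)"
    using distributed_measurable[OF D] by (intro measure_distr) auto
  also have "(\<lambda>\<omega>. (W h \<omega> - 0) / sqrt h) -` {..-2} \<inter> space M = {\<omega> \<in> space M. W h \<omega> \<le> - 2 * sqrt h}"
    using \<open>0 < h\<close> by (auto simp: field_simps)
  finally show ?thesis ..
qed

lemma std_normal_lower_tail_pos: "0 < measure (density lborel std_normal_density) {..-2}"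
proof -
  interpret prob_space "density lborel std_normal_density"
    by (rule prob_space_normal_density) simp
  have "emeasure (density lborel std_normal_density) {..-2} \<noteq> 0"
  proof
    assume "emeasure (density lborel std_normal_density) {..-2} = 0"
    then have "AE x in lborel. x \<in> {..-2 :: real} \<longrightarrow> False"
      by (subst (asm) emeasure_density)
        (auto simp: nn_integral_0_iff_AE normal_density_pos[THEN less_imp_neq, symmetric]
          indicator_def elim!: eventually_mono split: if_splits)
    then have "emeasure lborel {..-2 :: real} = 0"
      by (subst (asm) AE_iff_measurable[where N = "{..-2}"]) auto
    then have "emeasure lborel {-3..-2 :: real} = 0"
      using emeasure_mono[of "{-3..-2}" "{..-2}" "lborel :: real measure"] by auto
    then show False by simp
  qed
  then show ?thesis
    by (simp add: emeasure_eq_measure zero_less_measure_iff)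
qed

section \<open>Test functions and the generator\<close>

text \<open>Lipschitz on every square around the origin. This replaces bounds on third derivatives
  in the Taylor estimate, yields boundedness on squares and Borel measurability, and is stable under
  sums, products, sine and cosine, so that it can be verified by introduction rules.\<close>

definition loc_lip :: "(real \<Rightarrow> real \<Rightarrow> real) \<Rightarrow> bool" where
  "loc_lip f \<longleftrightarrow> (\<forall>R. \<exists>C. \<forall>s y s' y'. \<bar>s\<bar> \<le> R \<longrightarrow> \<bar>y\<bar> \<le> R \<longrightarrow> \<bar>s'\<bar> \<le> R \<longrightarrow> \<bar>y'\<bar> \<le> R \<longrightarrow>
     \<bar>f s y - f s' y'\<bar> \<le> C * (\<bar>s - s'\<bar> + \<bar>y - y'\<bar>))"

lemma loc_lipE:
  assumes "loc_lip f"
  obtains C where "0 \<le> C"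
    "\<And>s y s' y'. \<bar>s\<bar> \<le> R \<Longrightarrow> \<bar>y\<bar> \<le> R \<Longrightarrow> \<bar>s'\<bar> \<le> R \<Longrightarrow> \<bar>y'\<bar> \<le> R \<Longrightarrow>
       \<bar>f s y - f s' y'\<bar> \<le> C * (\<bar>s - s'\<bar> + \<bar>y - y'\<bar>)"
    "\<And>s y. \<bar>s\<bar> \<le> R \<Longrightarrow> \<bar>y\<bar> \<le> R \<Longrightarrow> \<bar>f s y\<bar> \<le> C"
proof -
  obtain C where C: "\<And>s y s' y'. \<bar>s\<bar> \<le> R \<Longrightarrow> \<bar>y\<bar> \<le> R \<Longrightarrow> \<bar>s'\<bar> \<le> R \<Longrightarrow> \<bar>y'\<bar> \<le> R \<Longrightarrow>
       \<bar>f s y - f s' y'\<bar> \<le> C * (\<bar>s - s'\<bar> + \<bar>y - y'\<bar>)"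
    using assms unfolding loc_lip_def by metis
  \<comment> \<open>One constant serves both as Lipschitz constant and as bound: the value at the
    origin plus the Lipschitz growth over the square. For negative \<open>R\<close> the claims on
    the square are vacuous.\<close>
  define D where "D = \<bar>C\<bar> * (1 + 2 * \<bar>R\<bar>) + \<bar>f 0 0\<bar>"
  have D: "\<bar>C\<bar> \<le> D"
    using mult_nonneg_nonneg[of "\<bar>C\<bar>" "2 * \<bar>R\<bar>"] by (simp add: D_def distrib_left)
  show ?thesis
  proof (rule that[of D])
    show "0 \<le> D" using D by linarith
    fix s y :: real assume sy: "\<bar>s\<bar> \<le> R" "\<bar>y\<bar> \<le> R"
    {
      fix s' y' assume "\<bar>s'\<bar> \<le> R" "\<bar>y'\<bar> \<le> R"
      then have "\<bar>f s y - f s' y'\<bar> \<le> C * (\<bar>s - s'\<bar> + \<bar>y - y'\<bar>)"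
        using C sy by auto
      also have "\<dots> \<le> D * (\<bar>s - s'\<bar> + \<bar>y - y'\<bar>)"
        using D by (intro mult_right_mono) auto
      finally show "\<bar>f s y - f s' y'\<bar> \<le> D * (\<bar>s - s'\<bar> + \<bar>y - y'\<bar>)" .
    }
    have "\<bar>f s y - f 0 0\<bar> \<le> C * (\<bar>s\<bar> + \<bar>y\<bar>)"
      using C[of s y 0 0] sy by auto
    also have "\<dots> \<le> \<bar>C\<bar> * (1 + 2 * \<bar>R\<bar>)"
      using sy by (intro mult_mono) auto
    finally show "\<bar>f s y\<bar> \<le> D" by (simp add: D_def)
  qed
qed

lemma loc_lip_const [intro]: "loc_lip (\<lambda>_ _. c)"
  unfolding loc_lip_def by (intro allI exI[of _ 0]) auto

lemma loc_lip_fst [intro]: "loc_lip (\<lambda>s _. s)"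
  unfolding loc_lip_def by (intro allI exI[of _ 1]) auto

lemma loc_lip_snd [intro]: "loc_lip (\<lambda>_ y. y)"
  unfolding loc_lip_def by (intro allI exI[of _ 1]) auto

lemma loc_lip_add [intro]:
  assumes "loc_lip f" "loc_lip g"
  shows "loc_lip (\<lambda>s y. f s y + g s y)"
  unfolding loc_lip_def
proof
  fix R
  from loc_lipE[OF assms(1), of R] obtain C where C: "\<And>s y s' y'. \<bar>s\<bar> \<le> R \<Longrightarrow> \<bar>y\<bar> \<le> R \<Longrightarrow> \<bar>s'\<bar> \<le> R \<Longrightarrow> \<bar>y'\<bar> \<le> R \<Longrightarrow>
       \<bar>f s y - f s' y'\<bar> \<le> C * (\<bar>s - s'\<bar> + \<bar>y - y'\<bar>)" by metis
  from loc_lipE[OF assms(2), of R] obtain D where D: "\<And>s y s' y'. \<bar>s\<bar> \<le> R \<Longrightarrow> \<bar>y\<bar> \<le> R \<Longrightarrow> \<bar>s'\<bar> \<le> R \<Longrightarrow> \<bar>y'\<bar> \<le> R \<Longrightarrow>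
       \<bar>g s y - g s' y'\<bar> \<le> D * (\<bar>s - s'\<bar> + \<bar>y - y'\<bar>)" by metis
  show "\<exists>K. \<forall>s y s' y'. \<bar>s\<bar> \<le> R \<longrightarrow> \<bar>y\<bar> \<le> R \<longrightarrow> \<bar>s'\<bar> \<le> R \<longrightarrow> \<bar>y'\<bar> \<le> R \<longrightarrow>
      \<bar>f s y + g s y - (f s' y' + g s' y')\<bar> \<le> K * (\<bar>s - s'\<bar> + \<bar>y - y'\<bar>)"
  proof (intro exI[of _ "C + D"] allI impI)
    fix s y s' y' assume *: "\<bar>s\<bar> \<le> R" "\<bar>y\<bar> \<le> R" "\<bar>s'\<bar> \<le> R" "\<bar>y'\<bar> \<le> R"
    show "\<bar>f s y + g s y - (f s' y' + g s' y')\<bar> \<le> (C + D) * (\<bar>s - s'\<bar> + \<bar>y - y'\<bar>)"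
      using C[OF *] D[OF *] unfolding distrib_right[of C D] by linarith
  qed
qed

lemma loc_lip_mult [intro]:
  assumes "loc_lip f" "loc_lip g"
  shows "loc_lip (\<lambda>s y. f s y * g s y)"
  unfolding loc_lip_def
proof
  fix R
  from loc_lipE[OF assms(1), of R] obtain C where C: "0 \<le> C" "\<And>s y s' y'. \<bar>s\<bar> \<le> R \<Longrightarrow> \<bar>y\<bar> \<le> R \<Longrightarrow> \<bar>s'\<bar> \<le> R \<Longrightarrow> \<bar>y'\<bar> \<le> R \<Longrightarrow>
       \<bar>f s y - f s' y'\<bar> \<le> C * (\<bar>s - s'\<bar> + \<bar>y - y'\<bar>)"
     "\<And>s y. \<bar>s\<bar> \<le> R \<Longrightarrow> \<bar>y\<bar> \<le> R \<Longrightarrow> \<bar>f s y\<bar> \<le> C" by metis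
  from loc_lipE[OF assms(2), of R] obtain D where D: "0 \<le> D" "\<And>s y s' y'. \<bar>s\<bar> \<le> R \<Longrightarrow> \<bar>y\<bar> \<le> R \<Longrightarrow> \<bar>s'\<bar> \<le> R \<Longrightarrow> \<bar>y'\<bar> \<le> R \<Longrightarrow>
       \<bar>g s y - g s' y'\<bar> \<le> D * (\<bar>s - s'\<bar> + \<bar>y - y'\<bar>)"
     "\<And>s y. \<bar>s\<bar> \<le> R \<Longrightarrow> \<bar>y\<bar> \<le> R \<Longrightarrow> \<bar>g s y\<bar> \<le> D" by metis
  show "\<exists>K. \<forall>s y s' y'. \<bar>s\<bar> \<le> R \<longrightarrow> \<bar>y\<bar> \<le> R \<longrightarrow> \<bar>s'\<bar> \<le> R \<longrightarrow> \<bar>y'\<bar> \<le> R \<longrightarrow>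
      \<bar>f s y * g s y - f s' y' * g s' y'\<bar> \<le> K * (\<bar>s - s'\<bar> + \<bar>y - y'\<bar>)"
  proof (intro exI[of _ "2 * C * D"] allI impI)
    fix s y s' y' assume *: "\<bar>s\<bar> \<le> R" "\<bar>y\<bar> \<le> R" "\<bar>s'\<bar> \<le> R" "\<bar>y'\<bar> \<le> R"
    let ?d = "\<bar>s - s'\<bar> + \<bar>y - y'\<bar>"
    have "\<bar>f s y * g s y - f s' y' * g s' y'\<bar> = \<bar>(f s y - f s' y') * g s y + f s' y' * (g s y - g s' y')\<bar>"
      by (simp add: algebra_simps)
    also have "\<dots> \<le> \<bar>f s y - f s' y'\<bar> * \<bar>g s y\<bar> + \<bar>f s' y'\<bar> * \<bar>g s y - g s' y'\<bar>"
      by (metis abs_triangle_ineq abs_mult)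
    also have "\<dots> \<le> (C * ?d) * D + C * (D * ?d)"
      using C(1) D(1) by (intro add_mono mult_mono C(2)[OF *] D(2)[OF *] C(3)[OF *(3,4)] D(3)[OF *(1,2)]) auto
    finally show "\<bar>f s y * g s y - f s' y' * g s' y'\<bar> \<le> 2 * C * D * ?d"
      by (simp add: algebra_simps)
  qed
qed

lemma loc_lip_minus [intro]: "loc_lip f \<Longrightarrow> loc_lip (\<lambda>s y. - f s y)"
  using loc_lip_mult[OF loc_lip_const[of "-1"], of f] by simp

lemma loc_lip_diff [intro]: "loc_lip f \<Longrightarrow> loc_lip g \<Longrightarrow> loc_lip (\<lambda>s y. f s y - g s y)"
  using loc_lip_add[OF _ loc_lip_minus, of f g] by simp

lemma loc_lip_power [intro]: "loc_lip f \<Longrightarrow> loc_lip (\<lambda>s y. f s y ^ n)"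
  by (induction n) auto

lemma abs_sin_diff_le: "\<bar>sin x - sin y\<bar> \<le> \<bar>x - y\<bar>" for x y :: real
proof -
  have "norm (sin x - sin y) \<le> 1 * norm (x - y)"
    by (rule field_differentiable_bound[of UNIV _ cos]) (auto intro!: derivative_eq_intros)
  then show ?thesis by simp
qed

lemma abs_cos_diff_le: "\<bar>cos x - cos y\<bar> \<le> \<bar>x - y\<bar>" for x y :: real
proof -
  have "norm (cos x - cos y) \<le> 1 * norm (x - y)"
    by (rule field_differentiable_bound[of UNIV _ "\<lambda>x. - sin x"]) (auto intro!: derivative_eq_intros)
  then show ?thesis by simp
qed

lemma loc_lip_sin [intro]: "loc_lip f \<Longrightarrow> loc_lip (\<lambda>s y. sin (f s y))"
  and loc_lip_cos [intro]: "loc_lip f \<Longrightarrow> loc_lip (\<lambda>s y. cos (f s y))"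
  unfolding loc_lip_def using abs_sin_diff_le abs_cos_diff_le by (meson order_trans)+

lemma loc_lip_continuous:
  assumes "loc_lip f"
  shows "continuous_on UNIV (\<lambda>(s, y). f s y)"
proof (subst continuous_on_eq_continuous_at, simp, safe)
  fix s y
  obtain C where C: "0 \<le> C" "\<And>s' y'. \<bar>s'\<bar> \<le> \<bar>s\<bar> + \<bar>y\<bar> + 1 \<Longrightarrow> \<bar>y'\<bar> \<le> \<bar>s\<bar> + \<bar>y\<bar> + 1 \<Longrightarrow>
       \<bar>f s' y' - f s y\<bar> \<le> C * (\<bar>s' - s\<bar> + \<bar>y' - y\<bar>)"
    by (rule loc_lipE[OF assms, of "\<bar>s\<bar> + \<bar>y\<bar> + 1"]) force
  have "((\<lambda>x. C * (\<bar>fst x - s\<bar> + \<bar>snd x - y\<bar>)) \<longlongrightarrow> C * (\<bar>fst (s, y) - s\<bar> + \<bar>snd (s, y) - y\<bar>)) (at (s, y))"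
    by (intro tendsto_intros)
  then have lim: "((\<lambda>x. C * (\<bar>fst x - s\<bar> + \<bar>snd x - y\<bar>)) \<longlongrightarrow> 0) (at (s, y))" by simp
  have "eventually (\<lambda>x. dist x (s, y) < 1) (at (s, y))"
    by (auto simp: eventually_at intro: exI[of _ 1])
  then have "eventually (\<lambda>x. norm ((\<lambda>(s, y). f s y) x - f s y) \<le> C * (\<bar>fst x - s\<bar> + \<bar>snd x - y\<bar>)) (at (s, y))"
  proof eventually_elim
    case (elim x)
    then have "\<bar>fst x - s\<bar> < 1" "\<bar>snd x - y\<bar> < 1"
      using dist_fst_le[of x "(s, y)"] dist_snd_le[of x "(s, y)"] by (auto simp: dist_real_def)
    then show ?case
      using C(2)[of "fst x" "snd x"] by (auto simp: case_prod_beta)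
  qed
  then have "((\<lambda>x. (\<lambda>(s, y). f s y) x - f s y) \<longlongrightarrow> 0) (at (s, y))"
    by (rule Lim_null_comparison[OF _ lim])
  from LIM_zero_cancel[OF this] show "isCont (\<lambda>(s, y). f s y) (s, y)"
    by (simp add: isCont_def)
qed

lemma loc_lip_measurable:
  assumes "loc_lip f"
  shows "(\<lambda>x :: real \<times> real. f (fst x + snd x) (snd x)) \<in> borel_measurable borel"
proof (rule borel_measurable_continuous_onI)
  have "continuous_on UNIV ((\<lambda>(s, y). f s y) \<circ> (\<lambda>x :: real \<times> real. (fst x + snd x, snd x)))"
    by (intro continuous_on_compose continuous_intros continuous_on_subset[OF loc_lip_continuous[OF assms]]) auto
  then show "continuous_on UNIV (\<lambda>x :: real \<times> real. f (fst x + snd x) (snd x))"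
    by (simp add: comp_def case_prod_beta)
qed

text \<open>
  In the coordinates \<open>s = q1 + q2\<close>, \<open>y = q2\<close> the reflection term only acts on \<open>y\<close>, and the
  boundary condition \<open>Fy s s = 0\<close> at \<open>q1 = 0\<close> makes its contribution vanish to first order.
\<close>

locale test_function =
  fixes F Fs Fss Fy :: "real \<Rightarrow> real \<Rightarrow> real"
  assumes Fs: "((\<lambda>s. F s y) has_real_derivative Fs s y) (at s)"
    and Fss: "((\<lambda>s. Fs s y) has_real_derivative Fss s y) (at s)"
    and Fy: "((\<lambda>y. F s y) has_real_derivative Fy s y) (at y)"
    and lip: "loc_lip F" "loc_lip Fs" "loc_lip Fss" "loc_lip Fy"
    and diagonal: "Fy s s = 0"

text \<open>The second derivative carries no factor 1/2 because the noise is sqrt 2 times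
  \<open>W\<close>. The derivatives are those in the coordinates (s, y), while the argument is a
  state (q1, q2).\<close>

definition gen :: "real \<Rightarrow> (real \<Rightarrow> real \<Rightarrow> real) \<Rightarrow> (real \<Rightarrow> real \<Rightarrow> real) \<Rightarrow> (real \<Rightarrow> real \<Rightarrow> real) \<Rightarrow> real \<times> real \<Rightarrow> real" where
  "gen \<beta> Fs Fss Fy = (\<lambda>(q1, q2). Fss (q1 + q2) q2 + (- q1 - \<beta>) * Fs (q1 + q2) q2 - q2 * Fy (q1 + q2) q2)"

lemma gen_bound:
  assumes b: "\<bar>Fss (q1 + q2) q2\<bar> \<le> \<kappa>" "\<bar>Fs (q1 + q2) q2\<bar> \<le> \<kappa>" "\<bar>Fy (q1 + q2) q2\<bar> \<le> \<kappa>"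
    and q: "0 \<le> - q1" "- q1 \<le> R" "0 \<le> q2" "q2 \<le> R" and "0 < \<beta>"
  shows "\<bar>gen \<beta> Fs Fss Fy (q1, q2)\<bar> \<le> \<kappa> * (1 + 2 * R + \<beta>)"
proof -
  have "\<bar>(- q1 - \<beta>) * Fs (q1 + q2) q2\<bar> \<le> (R + \<beta>) * \<kappa>" "\<bar>q2 * Fy (q1 + q2) q2\<bar> \<le> R * \<kappa>"
    unfolding abs_mult using b q \<open>0 < \<beta>\<close> by (auto intro!: mult_mono)
  then have "\<bar>gen \<beta> Fs Fss Fy (q1, q2)\<bar> \<le> \<kappa> + (R + \<beta>) * \<kappa> + R * \<kappa>"
    using b(1) unfolding gen_def prod.case by linarith
  also have "\<dots> = \<kappa> * (1 + 2 * R + \<beta>)" by (simp add: algebra_simps)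
  finally show ?thesis .
qed

text \<open>In the Lagrange form of the remainder the second derivative is taken at a point within
  |x| of \<open>s\<close>; its Lipschitz bound then yields the third power.\<close>

lemma (in test_function) taylor2:
  assumes K: "\<And>s s'. \<bar>s\<bar> \<le> R \<Longrightarrow> \<bar>s'\<bar> \<le> R \<Longrightarrow> \<bar>Fss s y - Fss s' y\<bar> \<le> K * \<bar>s - s'\<bar>"
    and "\<bar>s\<bar> \<le> R" "\<bar>s + x\<bar> \<le> R" "0 \<le> K"
  shows "\<bar>F (s + x) y - F s y - Fs s y * x - Fss s y * x\<^sup>2 / 2\<bar> \<le> K * \<bar>x\<bar> ^ 3"
proof (cases "x = 0")
  case False
  define diff where "diff = (\<lambda>m :: nat. if m = 0 then (\<lambda>s. F s y) else if m = 1 then (\<lambda>s. Fs s y) else (\<lambda>s. Fss s y))"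
  have "\<exists>t. (if s + x < s then s + x < t \<and> t < s else s < t \<and> t < s + x) \<and>
      F (s + x) y = (\<Sum>m<2. diff m s / fact m * (s + x - s) ^ m) + diff 2 t / fact 2 * (s + x - s) ^ 2"
    using False Fs Fss
    by (intro Taylor[where f = "\<lambda>s. F s y" and a = "min s (s + x)" and b = "max s (s + x)"])
      (auto simp: diff_def)
  then obtain t where t: "if x < 0 then s + x < t \<and> t < s else s < t \<and> t < s + x"
    and eq: "F (s + x) y = F s y + Fs s y * x + Fss t y / 2 * x\<^sup>2"
    by (auto simp: diff_def lessThan_nat_numeral lessThan_Suc eval_nat_numeral split: if_splits)
  have "\<bar>t\<bar> \<le> R" "\<bar>t - s\<bar> \<le> \<bar>x\<bar>"
    using t assms(2,3) by (auto split: if_splits)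
  then have "\<bar>Fss t y - Fss s y\<bar> \<le> K * \<bar>x\<bar>"
    using K[of t s] assms(2,4) by (meson mult_left_mono order_trans)
  then have "\<bar>Fss t y - Fss s y\<bar> * x\<^sup>2 \<le> K * \<bar>x\<bar> * x\<^sup>2"
    by (rule mult_right_mono) simp
  also have "K * \<bar>x\<bar> * x\<^sup>2 = K * \<bar>x\<bar> ^ 3"
    by (simp add: power2_eq_square power3_eq_cube abs_mult_self_eq)
  finally have "\<bar>(Fss t y - Fss s y) * x\<^sup>2\<bar> \<le> K * \<bar>x\<bar> ^ 3"
    by (simp add: abs_mult)
  moreover have "F (s + x) y - F s y - Fs s y * x - Fss s y * x\<^sup>2 / 2 = (Fss t y - Fss s y) * x\<^sup>2 / 2"
    unfolding eq by (simp add: field_simps)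
  ultimately show ?thesis
    by simp
qed (use \<open>0 \<le> K\<close> in auto)

text \<open>A single constant chosen generously enough to dominate the coefficients of all increment
  bounds for initial states with \<open>N \<le> R\<close>, for example 16 + 4R + 5\<beta>, and to
  satisfy C/4 + R + \<beta> + 3/2 \<le> C.\<close>

definition local_const :: "real \<Rightarrow> real \<Rightarrow> real" where
  "local_const \<beta> R = 20 + 6 * R + 6 * \<beta>"

section \<open>Expansion of a test function over one time step\<close>

context driven_path
begin

text \<open>The common scale of all increments over the step: \<zeta> for the noise, h for the
  drift.\<close>

definition \<delta> where "\<delta> = \<zeta> + h"

lemma local_bounds:
  assumes R: "N \<le> R" and z: "\<zeta> \<le> 1"
  shows "0 \<le> \<delta>" "\<delta> \<le> 5 / 4" "h \<le> \<delta>" "\<zeta> \<le> \<delta>" "20 \<le> local_const \<beta> R" "R \<le> local_const \<beta> R" "\<beta> \<le> local_const \<beta> R"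
    "\<bar>q1 0 + q2 0\<bar> \<le> R" "0 \<le> - q1 0" "- q1 0 \<le> R" "0 \<le> q2 0" "q2 0 \<le> R"
    "\<bar>(q1 h + q2 h) - (q1 0 + q2 0) - sqrt 2 * w h - h * (- q1 0 - \<beta>)\<bar> \<le> h * (local_const \<beta> R * \<delta>)"
    "\<bar>(q1 h + q2 h) - (q1 0 + q2 0)\<bar> \<le> local_const \<beta> R * \<delta>"
    "\<bar>q2 h - q2 0\<bar> \<le> local_const \<beta> R * \<delta>"
    "l h = 0 \<Longrightarrow> \<bar>q2 h - q2 0 + h * q2 0\<bar> \<le> h * (local_const \<beta> R * \<delta>)"
    "l h \<noteq> 0 \<Longrightarrow> - q1 0 \<le> local_const \<beta> R * \<delta>"
proof -
  have R0: "0 \<le> R" using N_nonneg R by simp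
  show \<delta>: "0 \<le> \<delta>" "\<delta> \<le> 5 / 4" "h \<le> \<delta>" "\<zeta> \<le> \<delta>" and c: "20 \<le> local_const \<beta> R" "R \<le> local_const \<beta> R" "\<beta> \<le> local_const \<beta> R"
    using zeta_nonneg h z R0 beta by (auto simp: \<delta>_def local_const_def)
  show q: "\<bar>q1 0 + q2 0\<bar> \<le> R" "0 \<le> - q1 0" "- q1 0 \<le> R" "0 \<le> q2 0" "q2 0 \<le> R"
    using nonneg(1,2)[of 0] R by (auto simp: N_def)
  define b where "b = 2 * R + 10 + 2 * \<beta>"
  have B: "B \<le> b" using R z by (simp add: B_def b_def)
  have mult: "x * y \<le> k * \<delta>" if "x \<le> \<delta>" "y \<le> k" "0 \<le> x" "0 \<le> k" for x y k
    using mult_mono[OF that(1,2) \<delta>(1)] that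
    by (metis mult.commute mult_left_mono mult_right_mono order_trans)
  have lh: "l h \<le> (4 + 2 * (R + \<beta>)) * \<delta>"
  proof -
    have "h * (N + \<beta>) \<le> (R + \<beta>) * \<delta>"
      using R R0 beta h \<delta> by (intro mult) auto
    then show ?thesis
      using l_bound \<delta>(4) by (simp add: algebra_simps)
  qed
  have hB: "h * (B + \<beta>) \<le> (b + \<beta>) * \<delta>" "h * B \<le> b * \<delta>"
    using B h \<delta> beta R0 by (auto intro!: mult simp: b_def)
  have hR: "h * (R + \<beta>) \<le> (R + \<beta>) * \<delta>"
    using h \<delta> beta R0 by (auto intro!: mult)
  have d1: "2 * \<zeta> + l h + h * (B + \<beta>) \<le> local_const \<beta> R * \<delta>"
  proof -
    have "2 * \<zeta> + l h + h * (B + \<beta>) \<le> 2 * \<delta> + (4 + 2 * (R + \<beta>)) * \<delta> + (b + \<beta>) * \<delta>"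
      using \<delta>(4) lh hB by linarith
    also have "\<dots> = (16 + 4 * R + 5 * \<beta>) * \<delta>"
      by (simp add: b_def algebra_simps)
    also have "\<dots> \<le> local_const \<beta> R * \<delta>"
      using \<delta>(1) R0 beta by (intro mult_right_mono) (auto simp: local_const_def)
    finally show ?thesis .
  qed
  show s1: "\<bar>(q1 h + q2 h) - (q1 0 + q2 0) - sqrt 2 * w h - h * (- q1 0 - \<beta>)\<bar> \<le> h * (local_const \<beta> R * \<delta>)"
    using sum_increment mult_left_mono[OF d1 h(1)] by linarith
  have "0 \<le> local_const \<beta> R * \<delta>" using c \<delta> by auto
  have "\<bar>h * (- q1 0 - \<beta>)\<bar> \<le> h * (R + \<beta>)"
    unfolding abs_mult using q h beta by (intro mult_mono) auto
  moreover have "h * (local_const \<beta> R * \<delta>) \<le> local_const \<beta> R * \<delta> / 4"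
    using h_mult \<open>0 \<le> local_const \<beta> R * \<delta>\<close> by blast
  moreover have "local_const \<beta> R * \<delta> / 4 + (R + \<beta>) * \<delta> + 3 / 2 * \<delta> = (local_const \<beta> R / 4 + R + \<beta> + 3 / 2) * \<delta>"
    by (simp add: algebra_simps)
  moreover have "(local_const \<beta> R / 4 + R + \<beta> + 3 / 2) * \<delta> \<le> local_const \<beta> R * \<delta>"
  proof (rule mult_right_mono[OF _ \<delta>(1)])
    show "local_const \<beta> R / 4 + R + \<beta> + 3 / 2 \<le> local_const \<beta> R"
      using R0 beta by (simp add: local_const_def field_simps)
  qed
  ultimately show "\<bar>(q1 h + q2 h) - (q1 0 + q2 0)\<bar> \<le> local_const \<beta> R * \<delta>"
    using s1 hR sqrt2_w[OF h(1) order_refl] \<delta>(4) by linarith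
  show "\<bar>q2 h - q2 0\<bar> \<le> local_const \<beta> R * \<delta>"
  proof -
    have "h * B \<le> h * (B + \<beta>)"
      using h beta by (intro mult_left_mono) auto
    then show ?thesis
      using increments(2)[OF h(1) order_refl] d1 zeta_nonneg by linarith
  qed
  have "b * \<delta> \<le> local_const \<beta> R * \<delta>" "(b + 3 / 2) * \<delta> \<le> local_const \<beta> R * \<delta>"
    using \<delta>(1) R0 beta by (auto simp: local_const_def b_def intro!: mult_right_mono)
  then show "\<bar>q2 h - q2 0 + h * q2 0\<bar> \<le> h * (local_const \<beta> R * \<delta>)" if "l h = 0"
    using unreflected_increment[OF that] hB(2) mult_left_mono[of "h * B" "local_const \<beta> R * \<delta>" h] h by linarith
  show "- q1 0 \<le> local_const \<beta> R * \<delta>" if "l h \<noteq> 0"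
  proof -
    have "0 < l h" using that nonneg(3)[OF h(1)] by simp
    then have "- q1 0 \<le> 3 / 2 * \<zeta> + h * B" by (rule hit_bound)
    also have "\<dots> \<le> (b + 3 / 2) * \<delta>"
      using \<delta>(4) hB(2) by (simp add: algebra_simps)
    finally show ?thesis using \<open>(b + 3 / 2) * \<delta> \<le> local_const \<beta> R * \<delta>\<close> by simp
  qed
qed

text \<open>A pathwise substitute for the Ito formula. The terms with \<open>w h\<close> and
  \<open>(w h)\<^sup>2 - h\<close> will have mean zero. The error is O(h \<delta> + \<delta>^3) in
  the interior; the larger \<delta>^2 + h appears only for starts so close to the boundary that
  reflection is possible. The enlargement of \<open>R\<close> to \<open>R'\<close> keeps both ends
  of the step in one square, since \<delta> is at most 5/4.\<close>

lemma one_step_taylor: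
  assumes "test_function F Fs Fss Fy"
    and R: "N \<le> R" and z: "\<zeta> \<le> 1" and R': "R' = R + 2 * local_const \<beta> R" and "0 \<le> K"
    and Kb: "\<And>s y. \<bar>s\<bar> \<le> R' \<Longrightarrow> \<bar>y\<bar> \<le> R' \<Longrightarrow> \<bar>Fs s y\<bar> \<le> K \<and> \<bar>Fss s y\<bar> \<le> K \<and> \<bar>Fy s y\<bar> \<le> K"
    and Kss: "\<And>s s' y. \<bar>s\<bar> \<le> R' \<Longrightarrow> \<bar>s'\<bar> \<le> R' \<Longrightarrow> \<bar>y\<bar> \<le> R' \<Longrightarrow> \<bar>Fss s y - Fss s' y\<bar> \<le> K * \<bar>s - s'\<bar>"
    and Ky: "\<And>s y s' y'. \<bar>s\<bar> \<le> R' \<Longrightarrow> \<bar>y\<bar> \<le> R' \<Longrightarrow> \<bar>s'\<bar> \<le> R' \<Longrightarrow> \<bar>y'\<bar> \<le> R' \<Longrightarrow>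
       \<bar>Fy s y - Fy s' y'\<bar> \<le> K * (\<bar>s - s'\<bar> + \<bar>y - y'\<bar>)"
  shows "\<bar>F (q1 h + q2 h) (q2 h) - F (q1 0 + q2 0) (q2 0) - Fs (q1 0 + q2 0) (q2 0) * (sqrt 2 * w h)
      - Fss (q1 0 + q2 0) (q2 0) * ((w h)\<^sup>2 - h) - h * gen \<beta> Fs Fss Fy (q1 0, q2 0)\<bar>
    \<le> 20 * K * local_const \<beta> R ^ 3 * (h * \<delta> + \<delta> ^ 3 + (\<delta>\<^sup>2 + h) * of_bool (- q1 0 \<le> local_const \<beta> R * \<delta>))"
proof -
  interpret test_function F Fs Fss Fy by fact
  note lb = local_bounds[OF R z]
  define S0 Y0 S1 Y1 where "S0 = q1 0 + q2 0" and "Y0 = q2 0" and "S1 = q1 h + q2 h" and "Y1 = q2 h"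
  define x C where "x = sqrt 2 * w h" and "C = local_const \<beta> R"
  define Ds Dy where "Ds = S1 - S0" and "Dy = Y1 - Y0"
  define a where "a = - q1 0 - \<beta>"
  have C: "20 \<le> C" "R \<le> C" "\<beta> \<le> C" and \<delta>: "0 \<le> \<delta>" "\<delta> \<le> 5 / 4" "h \<le> \<delta>"
    using lb by (auto simp: C_def)
  have C\<delta>: "0 \<le> C * \<delta>" "C * \<delta> \<le> 2 * C" using C \<delta> mult_left_mono[of \<delta> 2 C] by auto
  have Ds: "\<bar>Ds\<bar> \<le> C * \<delta>" "\<bar>Ds - x - h * a\<bar> \<le> h * (C * \<delta>)" and Dy: "\<bar>Dy\<bar> \<le> C * \<delta>"
    and U: "0 \<le> Y0 - S0" "\<bar>S0\<bar> \<le> R" "0 \<le> Y0" "Y0 \<le> R"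
    and noref: "l h = 0 \<Longrightarrow> \<bar>Dy + h * Y0\<bar> \<le> h * (C * \<delta>)"
    and ref: "l h \<noteq> 0 \<Longrightarrow> Y0 - S0 \<le> C * \<delta>"
    using lb by (auto simp: S0_def Y0_def S1_def Y1_def Ds_def Dy_def x_def C_def a_def)
  have a: "\<bar>a\<bar> \<le> 2 * C" using lb(3,6,7,9,10) C beta unfolding a_def by linarith
  have x: "\<bar>x\<bar> \<le> C * \<delta>"
  proof -
    have "\<bar>x\<bar> \<le> 3 / 2 * \<delta>"
      using sqrt2_w[OF h(1) order_refl] lb(4) by (auto simp: x_def)
    also have "\<dots> \<le> C * \<delta>" using C \<delta> by (intro mult_right_mono) auto
    finally show ?thesis .
  qed
  have box: "\<bar>S0\<bar> \<le> R'" "\<bar>S1\<bar> \<le> R'" "\<bar>Y0\<bar> \<le> R'" "\<bar>Y1\<bar> \<le> R'"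
    using U Ds(1) Dy C\<delta> C unfolding R' C_def[symmetric] Ds_def Dy_def by linarith+
  have pow: "C * C \<le> C ^ 3" "C \<le> C ^ 3"
    using C power_increasing[of 1 3 C] power_increasing[of 2 3 C] by (auto simp: power2_eq_square)
  \<comment> \<open>First \<open>s\<close> moves with \<open>y\<close> frozen, then \<open>y\<close>
    moves at the new \<open>s\<close>. Only the second part sees the reflection term.\<close>
  define E1 where "E1 = F S1 Y0 - F S0 Y0 - Fs S0 Y0 * x - Fss S0 Y0 * ((w h)\<^sup>2 - h) - h * (Fss S0 Y0 + a * Fs S0 Y0)"
  define E2 where "E2 = F S1 Y1 - F S1 Y0 + h * (Y0 * Fy S0 Y0)"
  have split: "F S1 Y1 - F S0 Y0 - Fs S0 Y0 * x - Fss S0 Y0 * ((w h)\<^sup>2 - h) - h * gen \<beta> Fs Fss Fy (q1 0, q2 0) = E1 + E2"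
    by (simp add: E1_def E2_def gen_def S0_def Y0_def a_def algebra_simps)
  have E1: "\<bar>E1\<bar> \<le> 10 * K * C ^ 3 * (h * \<delta>) + K * C ^ 3 * \<delta> ^ 3"
  proof -
    have "\<bar>F (S0 + Ds) Y0 - F S0 Y0 - Fs S0 Y0 * Ds - Fss S0 Y0 * Ds\<^sup>2 / 2\<bar> \<le> K * \<bar>Ds\<bar> ^ 3"
      using box Kss \<open>0 \<le> K\<close> by (intro taylor2[where R = R']) (auto simp: Ds_def)
    also have "\<dots> \<le> K * (C * \<delta>) ^ 3"
      using Ds \<open>0 \<le> K\<close> by (intro mult_left_mono power_mono) auto
    finally have T: "\<bar>F S1 Y0 - F S0 Y0 - Fs S0 Y0 * Ds - Fss S0 Y0 * Ds\<^sup>2 / 2\<bar> \<le> K * C ^ 3 * \<delta> ^ 3"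
      by (simp add: Ds_def power_mult_distrib mult.assoc)
    have wx: "(w h)\<^sup>2 = x\<^sup>2 / 2" by (simp add: x_def power_mult_distrib)
    \<comment> \<open>Besides the Taylor remainder, what is left is the drift error and half of Ds^2
      - x^2. The latter factors into Ds - x, which is O(h), and Ds + x, which is
      O(\<delta>).\<close>
    have "E1 = (F S1 Y0 - F S0 Y0 - Fs S0 Y0 * Ds - Fss S0 Y0 * Ds\<^sup>2 / 2)
        + (Fs S0 Y0 * (Ds - x - h * a) + Fss S0 Y0 * ((Ds - x) * (Ds + x)) / 2)"
      unfolding E1_def wx by (simp add: field_simps power2_eq_square)
    moreover have "\<bar>Fs S0 Y0 * (Ds - x - h * a)\<bar> \<le> K * (h * (C * \<delta>))"
      unfolding abs_mult[of "Fs S0 Y0"] using Kb[OF box(1,3)] Ds(2) \<open>0 \<le> K\<close> by (intro mult_mono) auto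
    moreover have "\<bar>Fss S0 Y0 * ((Ds - x) * (Ds + x))\<bar> \<le> K * (h * (4 * C) * (2 * (C * \<delta>)))"
    proof -
      have "\<bar>h * a\<bar> \<le> h * (2 * C)"
        unfolding abs_mult using a h by (intro mult_mono) auto
      moreover have "h * (C * \<delta>) \<le> h * (2 * C)"
        using h C\<delta> by (intro mult_left_mono) auto
      ultimately have "\<bar>Ds - x\<bar> \<le> h * (4 * C)"
        using Ds(2) by linarith
      moreover have "\<bar>Ds + x\<bar> \<le> 2 * (C * \<delta>)"
        using Ds x by linarith
      ultimately show ?thesis
        unfolding abs_mult using Kb[OF box(1,3)] \<open>0 \<le> K\<close> h C by (intro mult_mono) auto
    qed
    moreover have "K * (h * (C * \<delta>)) \<le> K * C ^ 3 * (h * \<delta>)"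
      using mult_left_mono[OF pow(2), of "K * (h * \<delta>)"] \<open>0 \<le> K\<close> h \<delta> by (simp add: algebra_simps)
    moreover have "K * (h * (4 * C) * (2 * (C * \<delta>))) \<le> 8 * (K * C ^ 3 * (h * \<delta>))"
      using mult_left_mono[OF pow(1), of "8 * K * (h * \<delta>)"] \<open>0 \<le> K\<close> h \<delta> by (simp add: algebra_simps)
    moreover have "0 \<le> K * C ^ 3 * (h * \<delta>)" using \<open>0 \<le> K\<close> h \<delta> C by auto
    ultimately show ?thesis
      using T unfolding mult.assoc[of 10] by linarith
  qed
  obtain y where y: "\<bar>y - Y0\<bar> \<le> \<bar>Dy\<bar>" "\<bar>y - Y1\<bar> \<le> \<bar>Dy\<bar>" "F S1 Y1 - F S1 Y0 = Dy * Fy S1 y"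
  proof (cases Y0 Y1 rule: linorder_cases)
    case less
    then obtain z where "Y0 < z" "z < Y1" "F S1 Y1 - F S1 Y0 = (Y1 - Y0) * Fy S1 z"
      using MVT2[of Y0 Y1 "F S1" "Fy S1"] Fy by auto
    then show ?thesis
      by (intro that[of z]) (auto simp: Dy_def algebra_simps)
  next
    case greater
    then obtain z where "Y1 < z" "z < Y0" "F S1 Y0 - F S1 Y1 = (Y0 - Y1) * Fy S1 z"
      using MVT2[of Y1 Y0 "F S1" "Fy S1"] Fy by auto
    then show ?thesis
      by (intro that[of z]) (auto simp: Dy_def algebra_simps)
  qed (use that in \<open>auto simp: Dy_def\<close>)
  have ybox: "\<bar>y\<bar> \<le> R'"
    using y(1,2) box(3,4) U C\<delta> C Dy unfolding R' C_def[symmetric] by linarith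
  have E2: "\<bar>E2\<bar> \<le> 10 * K * C ^ 3 * (h * \<delta>) + 10 * K * C ^ 3 * ((\<delta>\<^sup>2 + h) * of_bool (Y0 - S0 \<le> C * \<delta>))"
  proof (cases "l h = 0")
    case True
    \<comment> \<open>Without reflection \<open>Dy\<close> is itself O(h), so moving the argument of
      \<open>Fy\<close> by O(\<delta>) costs only O(h \<delta>).\<close>
    have "E2 = (Fy S1 y - Fy S0 Y0) * Dy + Fy S0 Y0 * (Dy + h * Y0)"
      using y(3) by (simp add: E2_def algebra_simps)
    moreover have "\<bar>(Fy S1 y - Fy S0 Y0) * Dy\<bar> \<le> (K * (2 * (C * \<delta>))) * (h * (3 * C))"
    proof -
      have "\<bar>S1 - S0\<bar> + \<bar>y - Y0\<bar> \<le> 2 * (C * \<delta>)"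
        using Ds(1) Dy y(1) by (simp add: Ds_def)
      then have "\<bar>Fy S1 y - Fy S0 Y0\<bar> \<le> K * (2 * (C * \<delta>))"
        using Ky[OF box(2) ybox box(1,3)] \<open>0 \<le> K\<close> by (meson mult_left_mono order_trans)
      moreover have "\<bar>Dy\<bar> \<le> h * (3 * C)"
      proof -
        have "h * (C * \<delta>) \<le> h * (2 * C)" "h * Y0 \<le> h * C" "0 \<le> h * Y0"
          using h C\<delta> U C by (auto intro: mult_left_mono)
        then show ?thesis using noref[OF True] by linarith
      qed
      ultimately show ?thesis
        unfolding abs_mult using h C C\<delta> \<open>0 \<le> K\<close> by (intro mult_mono) auto
    qed
    moreover have "\<bar>Fy S0 Y0 * (Dy + h * Y0)\<bar> \<le> K * (h * (C * \<delta>))"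
      unfolding abs_mult[of "Fy S0 Y0"] using Kb[OF box(1,3)] noref[OF True] \<open>0 \<le> K\<close> by (intro mult_mono) auto
    moreover have "K * (h * (C * \<delta>)) \<le> K * C ^ 3 * (h * \<delta>)"
      using mult_left_mono[OF pow(2), of "K * (h * \<delta>)"] \<open>0 \<le> K\<close> h \<delta> by (simp add: algebra_simps)
    moreover have "(K * (2 * (C * \<delta>))) * (h * (3 * C)) \<le> 6 * (K * C ^ 3 * (h * \<delta>))"
      using mult_left_mono[OF pow(1), of "6 * K * (h * \<delta>)"] \<open>0 \<le> K\<close> h \<delta> by (simp add: algebra_simps)
    moreover have "0 \<le> K * C ^ 3 * (h * \<delta>)" "0 \<le> 10 * K * C ^ 3 * ((\<delta>\<^sup>2 + h) * of_bool (Y0 - S0 \<le> C * \<delta>))"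
      using \<open>0 \<le> K\<close> h \<delta> C by auto
    ultimately show ?thesis
      unfolding mult.assoc[of 10] by linarith
  next
    case False
    note U0 = ref[OF False]
    \<comment> \<open>With reflection \<open>Dy\<close> is only O(\<delta>), but the start is near
      the boundary, so S1 and y differ by O(\<delta>). As \<open>Fy\<close> vanishes on the
      diagonal, \<open>Fy S1 y\<close> is O(\<delta>) too and the product is O(\<delta>^2).\<close>
    have "\<bar>Fy S1 y - Fy y y\<bar> \<le> K * (3 * (C * \<delta>))"
    proof -
      have "\<bar>S1 - y\<bar> + \<bar>y - y\<bar> \<le> 3 * (C * \<delta>)"
        using Ds(1) Dy y(1) U0 U(1) by (simp add: Ds_def)
      then show ?thesis
        using Ky[OF box(2) ybox ybox ybox] \<open>0 \<le> K\<close> by (meson mult_left_mono order_trans)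
    qed
    then have "\<bar>Dy * Fy S1 y\<bar> \<le> (C * \<delta>) * (K * (3 * (C * \<delta>)))"
      unfolding abs_mult using Dy \<open>0 \<le> K\<close> C\<delta> by (intro mult_mono) (auto simp: diagonal)
    moreover have "\<bar>h * (Y0 * Fy S0 Y0)\<bar> \<le> h * (C * K)"
      unfolding abs_mult using U C h Kb[OF box(1,3)] by (intro mult_mono) auto
    moreover have "(C * \<delta>) * (K * (3 * (C * \<delta>))) \<le> 3 * K * C ^ 3 * \<delta>\<^sup>2"
      using mult_left_mono[OF pow(1), of "3 * K * \<delta>\<^sup>2"] \<open>0 \<le> K\<close> by (simp add: algebra_simps power2_eq_square)
    moreover have "h * (C * K) \<le> K * C ^ 3 * h"
      using mult_left_mono[OF pow(2), of "K * h"] \<open>0 \<le> K\<close> h by (simp add: algebra_simps)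
    ultimately have "\<bar>E2\<bar> \<le> 3 * K * C ^ 3 * \<delta>\<^sup>2 + K * C ^ 3 * h"
      unfolding E2_def y(3) by linarith
    moreover have "0 \<le> K * C ^ 3 * (h * \<delta>)" "0 \<le> K * C ^ 3 * \<delta>\<^sup>2" "0 \<le> K * C ^ 3 * h"
      using \<open>0 \<le> K\<close> h \<delta> C by auto
    ultimately show ?thesis
      using U0 by (simp add: distrib_left mult.assoc)
  qed
  have "0 \<le> K * C ^ 3 * (h * \<delta>)" "0 \<le> K * C ^ 3 * \<delta> ^ 3" "0 \<le> K * C ^ 3 * ((\<delta>\<^sup>2 + h) * of_bool (Y0 - S0 \<le> C * \<delta>))"
    using \<open>0 \<le> K\<close> h \<delta> C by auto
  then have "\<bar>E1 + E2\<bar> \<le> 20 * K * C ^ 3 * (h * \<delta> + \<delta> ^ 3 + (\<delta>\<^sup>2 + h) * of_bool (Y0 - S0 \<le> C * \<delta>))"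
    using E1 E2 unfolding distrib_left mult.assoc by linarith
  moreover have "Y0 - S0 = - q1 0" by (simp add: Y0_def S0_def)
  ultimately show ?thesis
    unfolding split[symmetric] by (simp add: S0_def Y0_def S1_def Y1_def x_def C_def)
qed




end

section \<open>Stationary initial states\<close>

lemma (in prob_space) prob_tendsto_0:
  assumes meas: "\<And>n :: nat. A n \<in> events"
    and ev: "AE \<omega> in M. eventually (\<lambda>n. \<omega> \<notin> A n) sequentially"
  shows "(\<lambda>n. prob (A n)) \<longlonglongrightarrow> 0"
proof -
  have "(\<lambda>n. expectation (\<lambda>\<omega>. indicator (A n) \<omega>)) \<longlonglongrightarrow> expectation (\<lambda>_. 0 :: real)"
  proof (rule integral_dominated_convergence[where w = "\<lambda>_. 1"])
    show "AE \<omega> in M. (\<lambda>n. indicator (A n) \<omega>) \<longlonglongrightarrow> (0 :: real)"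
      using ev by eventually_elim (auto intro!: tendsto_eventually elim!: eventually_mono)
  qed (use meas in auto)
  moreover have "expectation (indicator (A n)) = prob (A n)" for n
    using meas[of n] sets.sets_into_space[OF meas[of n]] by (simp add: Int_absorb2)
  ultimately show ?thesis by simp
qed

lemma (in prob_space) prob_fourth_moment:
  assumes "\<zeta> \<in> borel_measurable M" "\<And>\<omega>. 0 \<le> \<zeta> \<omega>" "integrable M (\<lambda>\<omega>. \<zeta> \<omega> ^ 4)"
    and "expectation (\<lambda>\<omega>. \<zeta> \<omega> ^ 4) \<le> c" "0 < a"
  shows "prob {\<omega> \<in> space M. a \<le> \<zeta> \<omega>} \<le> c / a ^ 4"
proof -
  have "prob {\<omega> \<in> space M. a \<le> \<zeta> \<omega>} = prob {\<omega> \<in> space M. a ^ 4 \<le> \<zeta> \<omega> ^ 4}"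
    using assms(2,5) by (intro arg_cong[of _ _ prob] Collect_cong conj_cong refl) (simp add: power_mono_iff)
  also have "\<dots> \<le> expectation (\<lambda>\<omega>. \<zeta> \<omega> ^ 4) / a ^ 4"
    using assms by (intro integral_Markov_inequality_measure[where A = "{}"]) auto
  also have "\<dots> \<le> c / a ^ 4"
    using assms by (intro divide_right_mono) auto
  finally show ?thesis .
qed

locale stationary_diffusion = prob_space M for M :: "'a measure" +
  fixes \<beta> :: real and p :: "(real \<times> real) measure" and W Q1 Q2 L :: "real \<Rightarrow> 'a \<Rightarrow> real"
  assumes beta: "0 < \<beta>"
    and diff: "diffusion M \<beta> W Q1 Q2 L"
    and law: "\<And>t. 0 \<le> t \<Longrightarrow> distr M borel (\<lambda>\<omega>. (Q1 t \<omega>, Q2 t \<omega>)) = p"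
begin

lemma brownian: "standard_brownian_motion M W"
  using diff by (simp add: diffusion_def)

lemma W_measurable: "0 \<le> t \<Longrightarrow> W t \<in> borel_measurable M"
  using brownian by (simp add: standard_brownian_motion_def)

lemma Q_measurable:
  assumes "0 \<le> t"
  shows "Q1 t \<in> borel_measurable M" "Q2 t \<in> borel_measurable M"
    "(\<lambda>\<omega>. (Q1 t \<omega>, Q2 t \<omega>)) \<in> borel_measurable M"
  using diff assms by (auto simp: diffusion_def intro!: borel_measurable_Pair)

lemma paths: "AE \<omega> in M. diffusion_path \<beta> (\<lambda>t. W t \<omega>) (\<lambda>t. Q1 t \<omega>) (\<lambda>t. Q2 t \<omega>) (\<lambda>t. L t \<omega>)"
  using diff by (simp add: diffusion_def)

lemma state_space:
  assumes "0 \<le> t"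
  shows "AE \<omega> in M. Q1 t \<omega> \<le> 0 \<and> 0 < Q2 t \<omega>"
  using paths
proof eventually_elim
  case (elim \<omega>)
  then show ?case
    using assms unfolding diffusion_path_def by blast
qed

lemma expectation_law:
  fixes f :: "real \<times> real \<Rightarrow> real"
  assumes "f \<in> borel_measurable borel" "0 \<le> t"
  shows "expectation (\<lambda>\<omega>. f (Q1 t \<omega>, Q2 t \<omega>)) = (\<integral>x. f x \<partial>p)"
  using law[OF assms(2)] integral_distr[OF Q_measurable(3)[OF assms(2)] assms(1)] by simp

lemma prob_law:
  assumes "Measurable.pred borel P" "0 \<le> t"
  shows "prob {\<omega> \<in> space M. P (Q1 t \<omega>, Q2 t \<omega>)} = measure p {x. P x}"
proof -
  have "measure p {x. P x} = measure (distr M borel (\<lambda>\<omega>. (Q1 t \<omega>, Q2 t \<omega>))) {x. P x}"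
    using law[OF assms(2)] by simp
  also have "\<dots> = prob ((\<lambda>\<omega>. (Q1 t \<omega>, Q2 t \<omega>)) -` {x. P x} \<inter> space M)"
    using assms Q_measurable(3) by (intro measure_distr) (auto simp: pred_def)
  finally show ?thesis by (simp add: vimage_def Int_def conj_commute)
qed

text \<open>The definition of the diffusion makes the sigma-algebras of the initial state and of the
  whole driving path independent. \<open>W h\<close> is one coordinate of that path, so both
  generated sigma-algebras only get smaller.\<close>

lemma indep:
  fixes f :: "real \<times> real \<Rightarrow> real"
  assumes f: "f \<in> borel_measurable borel" and "0 \<le> h"
  shows "indep_var borel (\<lambda>\<omega>. f (Q1 0 \<omega>, Q2 0 \<omega>)) borel (W h)"
proof -
  define A where "A = vimage_algebra (space M) (\<lambda>\<omega>. (Q1 0 \<omega>, Q2 0 \<omega>)) borel"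
  define B where "B = vimage_algebra (space M) (\<lambda>\<omega>. \<lambda>t\<in>{0..}. W t \<omega>) (Pi\<^sub>M {0..} (\<lambda>_. borel :: real measure))"
  have AB: "indep_set (sets A) (sets B)"
    using diff by (simp add: diffusion_def A_def B_def)
  have 1: "sigma_sets (space M) {(\<lambda>\<omega>. f (Q1 0 \<omega>, Q2 0 \<omega>)) -` S \<inter> space M | S. S \<in> sets borel} \<subseteq> sets A"
  proof -
    have "(\<lambda>\<omega>. f (Q1 0 \<omega>, Q2 0 \<omega>)) -` S \<inter> space M \<in> sets A" if "S \<in> sets borel" for S
      using in_vimage_algebra[OF measurable_sets[OF f that], of "\<lambda>\<omega>. (Q1 0 \<omega>, Q2 0 \<omega>)" "space M"]
      by (simp add: A_def vimage_def)
    then have "{(\<lambda>\<omega>. f (Q1 0 \<omega>, Q2 0 \<omega>)) -` S \<inter> space M | S. S \<in> sets borel} \<subseteq> sets A" by blast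
    from sets.sigma_sets_subset[OF this] show ?thesis by (simp add: A_def)
  qed
  have 2: "sigma_sets (space M) {W h -` S \<inter> space M | S. S \<in> sets borel} \<subseteq> sets B"
  proof -
    have "W h -` S \<inter> space M \<in> sets B" if "S \<in> sets borel" for S
    proof -
      have "(\<lambda>g. g h) \<in> measurable (Pi\<^sub>M {0..} (\<lambda>_. borel :: real measure)) borel"
        using \<open>0 \<le> h\<close> by (intro measurable_component_singleton) auto
      from in_vimage_algebra[OF measurable_sets[OF this that], of "\<lambda>\<omega>. \<lambda>t\<in>{0..}. W t \<omega>" "space M"] \<open>0 \<le> h\<close>
      show ?thesis
        by (simp add: B_def vimage_def space_PiM)
    qed
    then have "{W h -` S \<inter> space M | S. S \<in> sets borel} \<subseteq> sets B" by blast
    from sets.sigma_sets_subset[OF this] show ?thesis by (simp add: B_def)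
  qed
  show ?thesis
    unfolding indep_var_eq
  proof (intro conjI)
    show "random_variable borel (\<lambda>\<omega>. f (Q1 0 \<omega>, Q2 0 \<omega>))"
      using measurable_compose[OF Q_measurable(3) f] by simp
    show "indep_set (sigma_sets (space M) {(\<lambda>\<omega>. f (Q1 0 \<omega>, Q2 0 \<omega>)) -` S \<inter> space M | S. S \<in> sets borel})
        (sigma_sets (space M) {W h -` S \<inter> space M | S. S \<in> sets borel})"
      using AB 1 2 unfolding indep_sets2_eq by blast
  qed (use W_measurable[OF \<open>0 \<le> h\<close>] in auto)
qed

text \<open>Squares, so that square roots are explicit; the shift by 2 makes the first step 1/4, the
  largest one \<open>driven_path\<close> allows.\<close>

definition step :: "nat \<Rightarrow> real" where "step n = (1 / real (Suc (Suc n)))\<^sup>2"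

lemma step: "0 < step n" "step n \<le> 1 / 4" "sqrt (step n) = 1 / real (Suc (Suc n))"
proof -
  have "1 / real (Suc (Suc n)) \<le> 1 / 2" by (simp add: field_simps)
  then have "(1 / real (Suc (Suc n)))\<^sup>2 \<le> (1 / 2)\<^sup>2" by (intro power_mono) auto
  then show "step n \<le> 1 / 4" by (simp add: step_def power2_eq_square)
qed (auto simp: step_def)

lemma step_tendsto: "step \<longlonglongrightarrow> 0" "(\<lambda>n. sqrt (step n)) \<longlonglongrightarrow> 0"
proof -
  show *: "(\<lambda>n. sqrt (step n)) \<longlonglongrightarrow> 0"
    unfolding step by (rule LIMSEQ_Suc[OF LIMSEQ_Suc[OF lim_1_over_n]])
  have "(\<lambda>n. (sqrt (step n))\<^sup>2) \<longlonglongrightarrow> 0\<^sup>2" by (intro tendsto_intros *)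
  then show "step \<longlonglongrightarrow> 0" using step(1) by (simp add: less_imp_le)
qed

definition \<zeta> :: "nat \<Rightarrow> 'a \<Rightarrow> real" where
  "\<zeta> n = (SOME \<zeta>. \<zeta> \<in> borel_measurable M \<and> (\<forall>\<omega>. 0 \<le> \<zeta> \<omega>) \<and> integrable M (\<lambda>\<omega>. \<zeta> \<omega> ^ 4) \<and>
    expectation (\<lambda>\<omega>. \<zeta> \<omega> ^ 4) \<le> 130000 * (step n)\<^sup>2 \<and>
    (AE \<omega> in M. \<forall>s. 0 \<le> s \<longrightarrow> s \<le> step n \<longrightarrow> \<bar>W s \<omega>\<bar> \<le> \<zeta> \<omega>))"

lemma
  shows noise_measurable [measurable]: "\<zeta> n \<in> borel_measurable M"
    and noise_nonneg: "0 \<le> \<zeta> n \<omega>" and noise_integrable: "integrable M (\<lambda>\<omega>. \<zeta> n \<omega> ^ 4)"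
    and noise_moment: "expectation (\<lambda>\<omega>. \<zeta> n \<omega> ^ 4) \<le> 130000 * (step n)\<^sup>2"
    and noise_bound: "AE \<omega> in M. \<forall>s. 0 \<le> s \<longrightarrow> s \<le> step n \<longrightarrow> \<bar>W s \<omega>\<bar> \<le> \<zeta> n \<omega>"
proof -
  have "\<zeta> n \<in> borel_measurable M \<and> (\<forall>\<omega>. 0 \<le> \<zeta> n \<omega>) \<and> integrable M (\<lambda>\<omega>. \<zeta> n \<omega> ^ 4) \<and>
    expectation (\<lambda>\<omega>. \<zeta> n \<omega> ^ 4) \<le> 130000 * (step n)\<^sup>2 \<and>
    (AE \<omega> in M. \<forall>s. 0 \<le> s \<longrightarrow> s \<le> step n \<longrightarrow> \<bar>W s \<omega>\<bar> \<le> \<zeta> n \<omega>)"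
    unfolding \<zeta>_def by (rule someI_ex[OF brownian_sup_bound[OF brownian step(1)[of n]]])
  then show "\<zeta> n \<in> borel_measurable M" "0 \<le> \<zeta> n \<omega>" "integrable M (\<lambda>\<omega>. \<zeta> n \<omega> ^ 4)"
    "expectation (\<lambda>\<omega>. \<zeta> n \<omega> ^ 4) \<le> 130000 * (step n)\<^sup>2"
    "AE \<omega> in M. \<forall>s. 0 \<le> s \<longrightarrow> s \<le> step n \<longrightarrow> \<bar>W s \<omega>\<bar> \<le> \<zeta> n \<omega>"
    by auto
qed

lemma noise_tail: "0 < a \<Longrightarrow> prob {\<omega> \<in> space M. a \<le> \<zeta> n \<omega>} \<le> 130000 * (step n)\<^sup>2 / a ^ 4"
  by (rule prob_fourth_moment[OF noise_measurable noise_nonneg noise_integrable noise_moment])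

lemma driven: "AE \<omega> in M. driven_path \<beta> (\<lambda>t. W t \<omega>) (\<lambda>t. Q1 t \<omega>) (\<lambda>t. Q2 t \<omega>) (\<lambda>t. L t \<omega>) (step n) (\<zeta> n \<omega>)"
  using paths noise_bound[of n] by eventually_elim (use beta step[of n] in \<open>unfold_locales, auto\<close>)

text \<open>
  An atom at \<open>0\<close> would be spread over the scale \<open>sqrt h\<close> within time \<open>h\<close>, whereas the mass
  returning to that scale from the rest of the state space is negligible.
\<close>

lemma no_atom: "prob {\<omega> \<in> space M. Q1 0 \<omega> = 0} = 0"
proof -
  define p0 where "p0 = prob {\<omega> \<in> space M. Q1 0 \<omega> = 0}"
  define c0 where "c0 = measure (density lborel std_normal_density) {..-2}"
  have [measurable]: "Q1 t \<in> borel_measurable M" "Q2 t \<in> borel_measurable M" "W t \<in> borel_measurable M" if "0 \<le> t" for t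
    using Q_measurable[OF that] W_measurable[OF that] by auto
  \<comment> \<open>The number \<open>a\<close> separates near from far on the scale sqrt h. The
    time step tends to 0 for fixed \<open>a\<close>, and only afterwards \<open>a\<close> tends to
    infinity.\<close>
  have bound: "p0 * c0 \<le> 1400000 / a ^ 4" if "1 \<le> a" for a :: real
  proof -
    define r where "r = (\<lambda>n. sqrt (step n))"
    have r: "0 < r n" "r n ^ 2 = step n" for n
      using step(1)[of n] by (auto simp: r_def)
    \<comment> \<open>Exceptional starts: near the boundary without being on it, or so large that
      drift and integral over one step might exceed sqrt h; 2N + 10 + 3\<beta> bounds B + \<beta>
      once \<zeta> is at most 1. Every fixed state eventually leaves these sets, so their
      probabilities vanish.\<close>
    define A where "A = (\<lambda>n. {\<omega> \<in> space M. 0 < - Q1 0 \<omega> \<and> - Q1 0 \<omega> < (a + 2) * r n \<or>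
       1 < r n * (2 * (Q2 0 \<omega> - Q1 0 \<omega>) + 10 + 3 * \<beta>)})"
    define G where "G = (\<lambda>n. {\<omega> \<in> space M. 2 / 3 * a * r n \<le> \<zeta> n \<omega>})"
    have [measurable]: "A n \<in> events" "G n \<in> events" for n
      unfolding A_def G_def by measurable
    have r0: "r \<longlonglongrightarrow> 0" unfolding r_def by (rule step_tendsto)
    have "(\<lambda>n. prob (A n)) \<longlonglongrightarrow> 0"
    proof (rule prob_tendsto_0)
      show "AE \<omega> in M. eventually (\<lambda>n. \<omega> \<notin> A n) sequentially"
      proof (rule AE_I2)
        fix \<omega>
        have "(\<lambda>n. r n * (2 * (Q2 0 \<omega> - Q1 0 \<omega>) + 10 + 3 * \<beta>)) \<longlonglongrightarrow> 0"
          by (rule tendsto_mult_left_zero[OF r0])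
        then have "eventually (\<lambda>n. r n * (2 * (Q2 0 \<omega> - Q1 0 \<omega>) + 10 + 3 * \<beta>) < 1) sequentially"
          by (rule order_tendstoD) simp
        moreover have "eventually (\<lambda>n. \<not> (0 < - Q1 0 \<omega> \<and> - Q1 0 \<omega> < (a + 2) * r n)) sequentially"
        proof (cases "0 < - Q1 0 \<omega>")
          case True
          have "(\<lambda>n. (a + 2) * r n) \<longlonglongrightarrow> 0"
            by (rule tendsto_mult_right_zero[OF r0])
          then have "eventually (\<lambda>n. (a + 2) * r n < - Q1 0 \<omega>) sequentially"
            using True by (rule order_tendstoD)
          then show ?thesis by eventually_elim auto
        qed auto
        ultimately show "eventually (\<lambda>n. \<omega> \<notin> A n) sequentially"
          by eventually_elim (auto simp: A_def)
      qed
    qed simp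
    then have lim: "(\<lambda>n. 2 * prob (A n) + 1400000 / a ^ 4) \<longlonglongrightarrow> 2 * 0 + 1400000 / a ^ 4"
      by (rule tendsto_add[OF tendsto_mult_left tendsto_const])
    have "eventually (\<lambda>n. p0 * c0 \<le> 2 * prob (A n) + 1400000 / a ^ 4) sequentially"
    proof -
      have "(\<lambda>n. a * r n) \<longlonglongrightarrow> 0" by (rule tendsto_mult_right_zero[OF r0])
      then have "eventually (\<lambda>n. a * r n < 1) sequentially" by (rule order_tendstoD) simp
      then show ?thesis
      proof eventually_elim
        case (elim n)
        define h where "h = step n"
        have h: "0 < h" "0 \<le> h" using step[of n] by (auto simp: h_def)
        note rn = r[of n, folded h_def]
        define E where "E = {\<omega> \<in> space M. Q1 0 \<omega> = 0} \<inter> {\<omega> \<in> space M. W h \<omega> \<le> - 2 * r n}"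
        \<comment> \<open>Crossings of the level sqrt h. By stationarity the two directions have
          equal probability, which turns a lower bound on the outflow from the atom into one on the
          inflow.\<close>
        define Up where "Up = {\<omega> \<in> space M. r n \<le> - Q1 h \<omega> \<and> \<not> r n \<le> - Q1 0 \<omega>}"
        define Down where "Down = {\<omega> \<in> space M. r n \<le> - Q1 0 \<omega> \<and> \<not> r n \<le> - Q1 h \<omega>}"
        define Stay where "Stay = {\<omega> \<in> space M. r n \<le> - Q1 0 \<omega> \<and> r n \<le> - Q1 h \<omega>}"
        have [measurable]: "E \<in> events" "Up \<in> events" "Down \<in> events" "Stay \<in> events"
          unfolding E_def Up_def Down_def Stay_def using h by measurable
        have pred: "Measurable.pred borel (\<lambda>x :: real \<times> real. r n \<le> - fst x)"
          unfolding pred_def by (auto intro!: borel_closed closed_Collect_le continuous_intros)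
        have "prob {\<omega> \<in> space M. r n \<le> - Q1 h \<omega>} = prob {\<omega> \<in> space M. r n \<le> - Q1 0 \<omega>}"
          using prob_law[OF pred, of h] prob_law[OF pred, of 0] h by simp
        moreover have "prob {\<omega> \<in> space M. r n \<le> - Q1 h \<omega>} = prob (Up \<union> Stay)"
          "prob {\<omega> \<in> space M. r n \<le> - Q1 0 \<omega>} = prob (Down \<union> Stay)"
          by (intro arg_cong[of _ _ prob]; auto simp: Up_def Down_def Stay_def)+
        moreover have "prob (Up \<union> Stay) = prob Up + prob Stay" "prob (Down \<union> Stay) = prob Down + prob Stay"
        proof -
          have "Up \<inter> Stay = {}" "Down \<inter> Stay = {}"
            by (auto simp: Up_def Down_def Stay_def)
          then show "prob (Up \<union> Stay) = prob Up + prob Stay" "prob (Down \<union> Stay) = prob Down + prob Stay"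
            by (simp_all add: finite_measure_Union)
        qed
        ultimately have UD: "prob Up = prob Down" by simp
        have "indep_var borel (\<lambda>\<omega>. fst (Q1 0 \<omega>, Q2 0 \<omega>)) borel (W h)"
          using h by (intro indep borel_measurable_continuous_onI continuous_intros) auto
        from indep_varD[OF this, of "{0}" "{..- 2 * r n}"]
        have "prob ((\<lambda>\<omega>. (Q1 0 \<omega>, W h \<omega>)) -` ({0} \<times> {..- 2 * r n}) \<inter> space M) =
          prob ((\<lambda>\<omega>. fst (Q1 0 \<omega>, Q2 0 \<omega>)) -` {0} \<inter> space M) * prob (W h -` {..- 2 * r n} \<inter> space M)"
          by simp
        moreover have "(\<lambda>\<omega>. (Q1 0 \<omega>, W h \<omega>)) -` ({0} \<times> {..- 2 * r n}) \<inter> space M = E"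
          by (auto simp: E_def)
        moreover have "W h -` {..- 2 * r n} \<inter> space M = {\<omega> \<in> space M. W h \<omega> \<le> - 2 * sqrt h}"
          by (auto simp: r_def h_def)
        moreover have "(\<lambda>\<omega>. fst (Q1 0 \<omega>, Q2 0 \<omega>)) -` {0} \<inter> space M = {\<omega> \<in> space M. Q1 0 \<omega> = 0}" by auto
        ultimately have E: "prob E = p0 * c0"
          using brownian_lower_tail[OF brownian h(1)] by (simp add: p0_def c0_def)
        have ae: "AE \<omega> in M. (\<omega> \<in> E \<longrightarrow> \<omega> \<in> Up \<union> (A n \<union> G n)) \<and> (\<omega> \<in> Down \<longrightarrow> \<omega> \<in> A n \<union> G n)"
          using driven[of n] AE_space
        proof eventually_elim
          case (elim \<omega>)
          interpret P: driven_path \<beta> "\<lambda>t. W t \<omega>" "\<lambda>t. Q1 t \<omega>" "\<lambda>t. Q2 t \<omega>" "\<lambda>t. L t \<omega>" h "\<zeta> n \<omega>"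
            using elim(1) by (simp add: h_def)
          have small: "h * (P.B + \<beta>) \<le> r n" if "\<omega> \<notin> A n" "\<omega> \<notin> G n"
          proof -
            have "\<zeta> n \<omega> \<le> 1"
              using that elim(2) \<open>a * r n < 1\<close> by (auto simp: G_def)
            then have "r n * (P.B + \<beta>) \<le> r n * (2 * (Q2 0 \<omega> - Q1 0 \<omega>) + 10 + 3 * \<beta>)"
              using rn by (intro mult_left_mono) (auto simp: P.B_def P.N_def)
            also have "\<dots> \<le> 1" using that elim(2) by (auto simp: A_def)
            finally have "r n * (r n * (P.B + \<beta>)) \<le> r n * 1"
              using rn by (intro mult_left_mono) auto
            then show ?thesis using rn by (simp add: power2_eq_square mult.assoc flip: rn(2))
          qed
          have free: "- Q1 h \<omega> \<ge> - Q1 0 \<omega> - sqrt 2 * W h \<omega> - r n" if "\<omega> \<notin> A n" "\<omega> \<notin> G n"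
            using P.free_part P.nonneg(3)[OF h(2)] small[OF that] by linarith
          \<comment> \<open>From the boundary the noise pushes the path at least 2 r away, and drift
            takes back at most r.\<close>
          have "\<omega> \<in> Up" if "\<omega> \<in> E" "\<omega> \<notin> A n" "\<omega> \<notin> G n"
          proof -
            have "sqrt 2 * W h \<omega> \<le> 1 * W h \<omega>"
              using that rn by (intro mult_right_mono_neg) (auto simp: E_def)
            moreover have "W h \<omega> \<le> - 2 * r n" "Q1 0 \<omega> = 0"
              using that(1) by (auto simp: E_def)
            ultimately have "r n \<le> - Q1 h \<omega>"
              using free[OF that(2,3)] by linarith
            then show ?thesis
              using elim(2) rn(1) \<open>Q1 0 \<omega> = 0\<close> by (simp add: Up_def)
          qed
          \<comment> \<open>Off \<open>A n\<close>, a start at distance at least r is at distance at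
            least (a + 2) r. Noise removes less than a r and drift at most r, so the path cannot end
            below r.\<close>
          moreover have False if "\<omega> \<in> Down" "\<omega> \<notin> A n" "\<omega> \<notin> G n"
          proof -
            have "- Q1 0 \<omega> \<ge> (a + 2) * r n"
              using that rn(1) by (auto simp: Down_def A_def)
            moreover have "sqrt 2 * W h \<omega> \<le> 3 / 2 * \<zeta> n \<omega>"
              using P.sqrt2_w[OF h(2) order_refl] by linarith
            moreover have "\<zeta> n \<omega> < 2 / 3 * a * r n"
              using that elim(2) by (auto simp: G_def)
            ultimately show False
              using free[OF that(2,3)] that(1) by (auto simp: Down_def distrib_right)
          qed
          ultimately show ?case by auto
        qed
        have AG: "prob (A n \<union> G n) \<le> prob (A n) + 700000 / a ^ 4"
        proof -
          \<comment> \<open>The powers of the time step cancel, leaving 130000 * 81 / 16 = 658125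
            over a^4.\<close>
          have "prob (G n) \<le> 130000 * h\<^sup>2 / (2 / 3 * a * r n) ^ 4"
            unfolding G_def h_def using \<open>1 \<le> a\<close> r[of n] by (intro noise_tail) auto
          also have "(2 / 3 * a * r n) ^ 4 = 16 / 81 * a ^ 4 * (r n ^ 2)\<^sup>2"
            by (simp add: power_mult_distrib power_divide)
          also have "130000 * h\<^sup>2 / (16 / 81 * a ^ 4 * (r n ^ 2)\<^sup>2) = 658125 / a ^ 4"
            unfolding rn(2) using h \<open>1 \<le> a\<close> by (simp add: field_simps)
          also have "\<dots> \<le> 700000 / a ^ 4"
            using \<open>1 \<le> a\<close> by (intro divide_right_mono) auto
          finally show ?thesis
            using measure_Un_le[of "A n" M "G n"] by simp
        qed
        have "prob E \<le> prob (Up \<union> (A n \<union> G n))"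
          using ae by (intro finite_measure_mono_AE) auto
        also have "\<dots> \<le> prob Up + prob (A n \<union> G n)"
          by (rule measure_Un_le) auto
        finally have "prob E \<le> prob Up + prob (A n \<union> G n)" .
        moreover have "prob Down \<le> prob (A n \<union> G n)"
          using ae by (intro finite_measure_mono_AE) auto
        ultimately show ?case
          using E UD AG by simp
      qed
    qed
    from tendsto_lowerbound[OF lim this] show ?thesis by simp
  qed
  have "(\<lambda>n. 1400000 * (1 / real n) ^ 4) \<longlonglongrightarrow> 1400000 * 0 ^ 4"
    by (rule tendsto_mult_left[OF tendsto_power[OF lim_1_over_n]])
  moreover have "eventually (\<lambda>n. p0 * c0 \<le> 1400000 * (1 / real n) ^ 4) sequentially"
    using eventually_ge_at_top[of 1] by eventually_elim (use bound in \<open>simp add: power_one_over field_simps\<close>)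
  ultimately have "p0 * c0 \<le> 1400000 * 0 ^ 4"
    by (rule tendsto_lowerbound) simp
  moreover have "0 < c0" unfolding c0_def by (rule std_normal_lower_tail_pos)
  moreover have "0 \<le> p0" by (simp add: p0_def)
  ultimately have "p0 = 0" by (simp add: mult_le_0_iff)
  then show ?thesis by (simp add: p0_def)
qed

end

text \<open>Here z stands for \<zeta> and r for sqrt h. The error is rewritten in z^4, the moment
  that is available, with E z^4 = O(r^4). The critical term z^2 J is split by the Young inequality
  with parameter \<kappa>: one part has expectation O(\<kappa> h), the other is of order h /
  \<kappa> times the probability of the event behind J.\<close>

lemma step_error_bound:
  fixes z r \<kappa> J :: real
  assumes z: "0 \<le> z" and r: "0 < r" "r \<le> 1 / 2" and l: "0 < \<kappa>" and J: "0 \<le> J" "J \<le> 1"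
  shows "r\<^sup>2 * (z + r\<^sup>2) + (z + r\<^sup>2) ^ 3 + ((z + r\<^sup>2)\<^sup>2 + r\<^sup>2) * J
    \<le> 10 * r ^ 3 + (5 / r + \<kappa> / r\<^sup>2) * z ^ 4 + (1 / \<kappa> + 2) * r\<^sup>2 * J"
proof -
  define k where "k = z / r"
  have k: "0 \<le> k" "z = k * r" using z r by (auto simp: k_def)
  have k1: "k \<le> 1 + k ^ 4" "k ^ 3 \<le> 1 + k ^ 4"
    using power_le_one_plus_power[OF k(1), of 1 4] power_le_one_plus_power[OF k(1), of 3 4] by auto
  have r4: "r ^ 4 \<le> r ^ 3 / 2" "r ^ 6 \<le> r ^ 3 / 8" "r ^ 4 \<le> r\<^sup>2 / 4"
  proof -
    show "r ^ 4 \<le> r ^ 3 / 2"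
      using mult_left_mono[OF r(2), of "r ^ 3"] r by (simp add: power_numeral_reduce mult_ac)
    have "r ^ 3 \<le> (1 / 2) ^ 3" "r\<^sup>2 \<le> (1 / 2)\<^sup>2" using r by (auto intro!: power_mono)
    then have "r ^ 3 \<le> 1 / 8" "r\<^sup>2 \<le> 1 / 4" by (auto simp: power_divide)
    then show "r ^ 6 \<le> r ^ 3 / 8" "r ^ 4 \<le> r\<^sup>2 / 4"
      using mult_left_mono[of "r ^ 3" "1 / 8" "r ^ 3"] mult_left_mono[of "r\<^sup>2" "1 / 4" "r\<^sup>2"] r
      by (auto simp: power_add[symmetric])
  qed
  have 1: "r\<^sup>2 * (z + r\<^sup>2) \<le> (1 + k ^ 4) * r ^ 3 + r ^ 3 / 2"
  proof -
    have "r\<^sup>2 * (z + r\<^sup>2) = k * r ^ 3 + r ^ 4"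
      by (simp add: k(2) power_numeral_reduce algebra_simps)
    moreover have "k * r ^ 3 \<le> (1 + k ^ 4) * r ^ 3"
      using k1 r by (intro mult_right_mono) auto
    ultimately show ?thesis using r4 by linarith
  qed
  have 2: "(z + r\<^sup>2) ^ 3 \<le> 4 * ((1 + k ^ 4) * r ^ 3) + r ^ 3 / 2"
  proof -
    have "(x + y) ^ 3 \<le> 4 * (x ^ 3 + y ^ 3)" if "0 \<le> x" "0 \<le> y" for x y :: real
    proof -
      have "4 * (x ^ 3 + y ^ 3) - (x + y) ^ 3 = 3 * (x + y) * (x - y)\<^sup>2"
        by (simp add: power2_eq_square power3_eq_cube algebra_simps)
      moreover have "0 \<le> 3 * (x + y) * (x - y)\<^sup>2" using that by simp
      ultimately show ?thesis by linarith
    qed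
    from this[of z "r\<^sup>2"] z have "(z + r\<^sup>2) ^ 3 \<le> 4 * (k ^ 3 * r ^ 3 + r ^ 6)"
      by (simp add: k(2) power_mult_distrib flip: power_mult)
    moreover have "k ^ 3 * r ^ 3 \<le> (1 + k ^ 4) * r ^ 3"
      using k1 r by (intro mult_right_mono) auto
    ultimately show ?thesis using r4 by (simp add: algebra_simps)
  qed
  have 3: "((z + r\<^sup>2)\<^sup>2 + r\<^sup>2) * J \<le> \<kappa> * k ^ 4 * r\<^sup>2 + (1 / \<kappa> + 2) * r\<^sup>2 * J"
  proof -
    have "(z + r\<^sup>2)\<^sup>2 \<le> 2 * k\<^sup>2 * r\<^sup>2 + r\<^sup>2"
    proof -
      have "(z + r\<^sup>2)\<^sup>2 \<le> 2 * z\<^sup>2 + 2 * r ^ 4"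
        using sum_squares_bound[of z "r\<^sup>2"] by (simp add: power2_sum flip: power_mult)
      moreover have "z\<^sup>2 = k\<^sup>2 * r\<^sup>2" by (simp add: k(2) power_mult_distrib)
      ultimately show ?thesis using r4(3) zero_le_power2[of r] by linarith
    qed
    moreover have "2 * k\<^sup>2 * r\<^sup>2 \<le> (\<kappa> * k ^ 4 + 1 / \<kappa>) * r\<^sup>2"
    proof (rule mult_right_mono)
      have "0 \<le> (\<kappa> * k\<^sup>2 - 1)\<^sup>2 / \<kappa>" using l by simp
      also have "\<dots> = \<kappa> * k ^ 4 + 1 / \<kappa> - 2 * k\<^sup>2"
        using l by (simp add: power2_diff field_simps power2_eq_square power4_eq_xxxx)
      finally show "2 * k\<^sup>2 \<le> \<kappa> * k ^ 4 + 1 / \<kappa>" by simp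
    qed simp
    ultimately have "(z + r\<^sup>2)\<^sup>2 + r\<^sup>2 \<le> \<kappa> * k ^ 4 * r\<^sup>2 + (1 / \<kappa> + 2) * r\<^sup>2"
      by (simp add: algebra_simps)
    then have "((z + r\<^sup>2)\<^sup>2 + r\<^sup>2) * J \<le> (\<kappa> * k ^ 4 * r\<^sup>2 + (1 / \<kappa> + 2) * r\<^sup>2) * J"
      using J by (intro mult_right_mono)
    also have "\<dots> = (\<kappa> * k ^ 4 * r\<^sup>2) * J + (1 / \<kappa> + 2) * r\<^sup>2 * J"
      by (simp add: algebra_simps)
    also have "(\<kappa> * k ^ 4 * r\<^sup>2) * J \<le> \<kappa> * k ^ 4 * r\<^sup>2"
      using J l by (intro mult_left_le) auto
    finally show ?thesis by simp
  qed
  have "(5 / r + \<kappa> / r\<^sup>2) * z ^ 4 = 5 * (k ^ 4 * r ^ 3) + \<kappa> * k ^ 4 * r\<^sup>2"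
    using r by (simp add: k(2) power_mult_distrib field_simps power2_eq_square power3_eq_cube power4_eq_xxxx)
  moreover have "(1 + k ^ 4) * r ^ 3 = r ^ 3 + k ^ 4 * r ^ 3" by (simp add: distrib_right)
  moreover have "0 \<le> r ^ 3" using r by simp
  ultimately show ?thesis using 1 2 3 by linarith
qed

context stationary_diffusion
begin

text \<open>Since the boundary is not charged, a strip of some fixed width \<eta> has small
  probability. A start outside the strip can lie in the event only if \<zeta> is at least \<eta> /
  (2c) or the step is that large; the former has probability O(h^2) and the latter is eventually
  excluded.\<close>

lemma hit_prob_tendsto_0:
  assumes "0 < c"
  shows "(\<lambda>n. prob {\<omega> \<in> space M. - Q1 0 \<omega> \<le> c * (\<zeta> n \<omega> + step n)}) \<longlonglongrightarrow> 0"
proof (rule order_tendstoI)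
  fix e :: real assume "0 < e"
  have [measurable]: "Q1 0 \<in> borel_measurable M" by (rule Q_measurable) simp
  have "(\<lambda>k. prob {\<omega> \<in> space M. - Q1 0 \<omega> \<le> 1 / real (Suc k)}) \<longlonglongrightarrow> 0"
  proof (rule prob_tendsto_0)
    have "AE \<omega> in M. Q1 0 \<omega> \<noteq> 0"
      using no_atom by (subst AE_iff_measurable[OF _ refl]) (auto simp: emeasure_eq_measure)
    with state_space[OF order_refl] show "AE \<omega> in M. eventually (\<lambda>k. \<omega> \<notin> {\<omega> \<in> space M. - Q1 0 \<omega> \<le> 1 / real (Suc k)}) sequentially"
    proof (eventually_elim)
      case (elim \<omega>)
      have "eventually (\<lambda>k. 1 / real (Suc k) < - Q1 0 \<omega>) sequentially"
        using elim by (intro order_tendstoD(2)[OF LIMSEQ_Suc[OF lim_1_over_n]]) auto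
      then show ?case by eventually_elim auto
    qed
  qed simp
  then have "eventually (\<lambda>k. prob {\<omega> \<in> space M. - Q1 0 \<omega> \<le> 1 / real (Suc k)} < e / 2) sequentially"
    using \<open>0 < e\<close> by (intro order_tendstoD) auto
  then obtain k where k: "prob {\<omega> \<in> space M. - Q1 0 \<omega> \<le> 1 / real (Suc k)} < e / 2"
    by (auto simp: eventually_sequentially)
  define \<eta> where "\<eta> = 1 / real (Suc k)"
  have "0 < \<eta>" by (simp add: \<eta>_def)
  define a where "a = \<eta> / (2 * c)"
  have "0 < a" using \<open>0 < \<eta>\<close> \<open>0 < c\<close> by (simp add: a_def)
  have "(\<lambda>n. 130000 / a ^ 4 * (step n)\<^sup>2) \<longlonglongrightarrow> 130000 / a ^ 4 * 0\<^sup>2"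
    by (rule tendsto_mult_left[OF tendsto_power[OF step_tendsto(1)]])
  then have "eventually (\<lambda>n. 130000 / a ^ 4 * (step n)\<^sup>2 < e / 2) sequentially"
    using \<open>0 < e\<close> by (intro order_tendstoD) auto
  moreover have "eventually (\<lambda>n. step n < a) sequentially"
    using \<open>0 < a\<close> step_tendsto(1) by (intro order_tendstoD)
  ultimately show "eventually (\<lambda>n. prob {\<omega> \<in> space M. - Q1 0 \<omega> \<le> c * (\<zeta> n \<omega> + step n)} < e) sequentially"
  proof eventually_elim
    case (elim n)
    have "prob {\<omega> \<in> space M. - Q1 0 \<omega> \<le> c * (\<zeta> n \<omega> + step n)}
      \<le> prob ({\<omega> \<in> space M. - Q1 0 \<omega> \<le> \<eta>} \<union> {\<omega> \<in> space M. a \<le> \<zeta> n \<omega>})"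
    proof (rule finite_measure_mono)
      show "{\<omega> \<in> space M. - Q1 0 \<omega> \<le> c * (\<zeta> n \<omega> + step n)} \<subseteq> {\<omega> \<in> space M. - Q1 0 \<omega> \<le> \<eta>} \<union> {\<omega> \<in> space M. a \<le> \<zeta> n \<omega>}"
      proof safe
        fix \<omega> assume *: "- Q1 0 \<omega> \<le> c * (\<zeta> n \<omega> + step n)" "\<not> a \<le> \<zeta> n \<omega>"
        then have "c * (\<zeta> n \<omega> + step n) \<le> c * (2 * a)"
          using elim \<open>0 < c\<close> by (intro mult_left_mono) auto
        also have "c * (2 * a) = \<eta>" using \<open>0 < c\<close> by (simp add: a_def)
        finally show "- Q1 0 \<omega> \<le> \<eta>" using * by simp
      qed
    qed simp
    also have "\<dots> \<le> prob {\<omega> \<in> space M. - Q1 0 \<omega> \<le> \<eta>} + prob {\<omega> \<in> space M. a \<le> \<zeta> n \<omega>}"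
      by (rule measure_Un_le) auto
    also have "\<dots> < e / 2 + e / 2"
      using k noise_tail[OF \<open>0 < a\<close>, of n] elim(1) by (intro add_strict_mono) (auto simp: \<eta>_def)
    finally show ?case by simp
  qed
qed (auto intro!: always_eventually less_le_trans[OF _ measure_nonneg])

end

section \<open>The stationary generator inequality\<close>

context test_function
begin

lemma measurable_F:
  "(\<lambda>x. F (fst x + snd x) (snd x)) \<in> borel_measurable borel"
  "(\<lambda>x. Fs (fst x + snd x) (snd x)) \<in> borel_measurable borel"
  "(\<lambda>x. Fss (fst x + snd x) (snd x)) \<in> borel_measurable borel"
  "(\<lambda>x. Fy (fst x + snd x) (snd x)) \<in> borel_measurable borel"
  by (fact lip[THEN loc_lip_measurable])+

lemma measurable_gen: "gen \<beta> Fs Fss Fy \<in> borel_measurable borel"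
proof -
  have [measurable]: "fst \<in> borel_measurable (borel :: (real \<times> real) measure)" "snd \<in> borel_measurable (borel :: (real \<times> real) measure)"
    by (auto intro!: borel_measurable_continuous_onI continuous_intros)
  note [measurable] = measurable_F
  show ?thesis
    unfolding gen_def case_prod_beta by measurable
qed

end

context driven_path
begin

text \<open>Removes the restriction \<zeta> \<le> 1. If \<zeta> exceeds 1, then \<zeta>^4 dominates
  1, \<zeta> and \<zeta>^2, so crude bounds times \<zeta>^4 suffice; truncation at \<open>K\<close>
  and the lower bound \<open>c\<close> control the increment. The extra cost has expectation
  O(h^2).\<close>

lemma one_step_upper:
  assumes "test_function F Fs Fss Fy"
    and R: "N \<le> R" and R': "R' = R + 2 * local_const \<beta> R" and "0 \<le> \<kappa>"
    and \<kappa>: "\<And>s y. \<bar>s\<bar> \<le> R' \<Longrightarrow> \<bar>y\<bar> \<le> R' \<Longrightarrow> \<bar>Fs s y\<bar> \<le> \<kappa> \<and> \<bar>Fss s y\<bar> \<le> \<kappa> \<and> \<bar>Fy s y\<bar> \<le> \<kappa>"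
    "\<And>s s' y. \<bar>s\<bar> \<le> R' \<Longrightarrow> \<bar>s'\<bar> \<le> R' \<Longrightarrow> \<bar>y\<bar> \<le> R' \<Longrightarrow> \<bar>Fss s y - Fss s' y\<bar> \<le> \<kappa> * \<bar>s - s'\<bar>"
    "\<And>s y s' y'. \<bar>s\<bar> \<le> R' \<Longrightarrow> \<bar>y\<bar> \<le> R' \<Longrightarrow> \<bar>s'\<bar> \<le> R' \<Longrightarrow> \<bar>y'\<bar> \<le> R' \<Longrightarrow>
       \<bar>Fy s y - Fy s' y'\<bar> \<le> \<kappa> * (\<bar>s - s'\<bar> + \<bar>y - y'\<bar>)"
    and lower: "c \<le> F (q1 0 + q2 0) (q2 0)"
  shows "min (F (q1 h + q2 h) (q2 h)) K - F (q1 0 + q2 0) (q2 0)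
    \<le> Fs (q1 0 + q2 0) (q2 0) * (sqrt 2 * w h) + Fss (q1 0 + q2 0) (q2 0) * ((w h)\<^sup>2 - h)
      + h * gen \<beta> Fs Fss Fy (q1 0, q2 0)
      + 20 * \<kappa> * local_const \<beta> R ^ 3 * (h * \<delta> + \<delta> ^ 3 + (\<delta>\<^sup>2 + h) * of_bool (- q1 0 \<le> local_const \<beta> R * \<delta>))
      + (\<bar>K - c\<bar> + \<kappa> * (6 + 2 * R + \<beta>)) * \<zeta> ^ 4"
proof -
  define S Y where "S = q1 0 + q2 0" and "Y = q2 0"
  have R0: "0 \<le> R" using N_nonneg R by simp
  have c0: "0 \<le> local_const \<beta> R" using R0 beta by (simp add: local_const_def)
  have "0 \<le> \<delta>" using zeta_nonneg h by (simp add: \<delta>_def)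
  then have e: "0 \<le> 20 * \<kappa> * local_const \<beta> R ^ 3 * (h * \<delta> + \<delta> ^ 3 + (\<delta>\<^sup>2 + h) * of_bool (- q1 0 \<le> local_const \<beta> R * \<delta>))"
    using c0 h \<open>0 \<le> \<kappa>\<close> by auto
  have e2: "0 \<le> (\<bar>K - c\<bar> + \<kappa> * (6 + 2 * R + \<beta>)) * \<zeta> ^ 4"
    using R0 beta \<open>0 \<le> \<kappa>\<close> by auto
  show ?thesis
  proof (cases "\<zeta> \<le> 1")
    case True
    from one_step_taylor[OF assms(1) R True R' \<open>0 \<le> \<kappa>\<close> \<kappa>] e2 show ?thesis by linarith
  next
    case False
    have q: "\<bar>S\<bar> \<le> R" "0 \<le> Y" "Y \<le> R" "0 \<le> - q1 0" "- q1 0 \<le> R"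
      using nonneg(1,2)[of 0] R by (auto simp: N_def S_def Y_def)
    then have "\<bar>S\<bar> \<le> R'" "\<bar>Y\<bar> \<le> R'" using c0 by (auto simp: R')
    note b = \<kappa>(1)[OF this]
    have pow: "1 \<le> \<zeta> ^ 4" "\<zeta> \<le> \<zeta> ^ 4" "\<zeta>\<^sup>2 \<le> \<zeta> ^ 4"
      using False power_increasing[of 0 4 \<zeta>] power_increasing[of 1 4 \<zeta>] power_increasing[of 2 4 \<zeta>] by auto
    have "\<bar>Fs S Y * (sqrt 2 * w h)\<bar> \<le> \<kappa> * (2 * \<zeta> ^ 4)"
      unfolding abs_mult[of "Fs S Y"] using b sqrt2_w[OF h(1) order_refl] pow \<open>0 \<le> \<kappa>\<close>
      by (intro mult_mono) auto
    moreover have "\<bar>Fss S Y * ((w h)\<^sup>2 - h)\<bar> \<le> \<kappa> * (2 * \<zeta> ^ 4)"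
    proof -
      have "\<bar>w h\<bar>\<^sup>2 \<le> \<zeta>\<^sup>2" using w[OF h(1) order_refl] by (intro power_mono) auto
      then have "\<bar>(w h)\<^sup>2 - h\<bar> \<le> 2 * \<zeta> ^ 4"
        using pow h zero_le_power2[of "w h"] unfolding power2_abs by (simp only: abs_le_iff) linarith
      then show ?thesis
        unfolding abs_mult[of "Fss S Y"] using b \<open>0 \<le> \<kappa>\<close> by (intro mult_mono) auto
    qed
    moreover have "\<bar>h * gen \<beta> Fs Fss Fy (q1 0, q2 0)\<bar> \<le> \<kappa> * ((1 + 2 * R + \<beta>) * \<zeta> ^ 4)"
    proof -
      have "\<bar>gen \<beta> Fs Fss Fy (q1 0, q2 0)\<bar> \<le> \<kappa> * (1 + 2 * R + \<beta>)"
        using b q beta by (intro gen_bound) (auto simp: S_def Y_def)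
      then have "\<bar>h\<bar> * \<bar>gen \<beta> Fs Fss Fy (q1 0, q2 0)\<bar> \<le> \<zeta> ^ 4 * (\<kappa> * (1 + 2 * R + \<beta>))"
        using h pow by (intro mult_mono) auto
      then show ?thesis by (simp add: abs_mult mult_ac)
    qed
    moreover have "min (F (q1 h + q2 h) (q2 h)) K - F S Y \<le> \<bar>K - c\<bar> * \<zeta> ^ 4"
      using lower mult_left_mono[OF pow(1), of "\<bar>K - c\<bar>"] by (auto simp: S_def Y_def min_def)
    moreover have "\<kappa> * (2 * \<zeta> ^ 4) + \<kappa> * (2 * \<zeta> ^ 4) + \<kappa> * ((1 + 2 * R + \<beta>) * \<zeta> ^ 4) \<le> \<kappa> * (6 + 2 * R + \<beta>) * \<zeta> ^ 4"
    proof -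
      have "\<kappa> * (6 + 2 * R + \<beta>) * \<zeta> ^ 4 - (\<kappa> * (2 * \<zeta> ^ 4) + \<kappa> * (2 * \<zeta> ^ 4) + \<kappa> * ((1 + 2 * R + \<beta>) * \<zeta> ^ 4)) = \<kappa> * \<zeta> ^ 4"
        by (simp add: algebra_simps)
      moreover have "0 \<le> \<kappa> * \<zeta> ^ 4" using \<open>0 \<le> \<kappa>\<close> by simp
      ultimately show ?thesis by linarith
    qed
    ultimately show ?thesis
      using e unfolding S_def Y_def distrib_right by linarith
  qed
qed

end

context stationary_diffusion
begin

lemma noise_orthogonal:
  fixes f :: "real \<times> real \<Rightarrow> real"
  assumes f: "f \<in> borel_measurable borel" and bd: "AE \<omega> in M. \<bar>f (Q1 0 \<omega>, Q2 0 \<omega>)\<bar> \<le> k" and "0 < h"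
  shows "integrable M (\<lambda>\<omega>. f (Q1 0 \<omega>, Q2 0 \<omega>) * W h \<omega>)" "expectation (\<lambda>\<omega>. f (Q1 0 \<omega>, Q2 0 \<omega>) * W h \<omega>) = 0"
    "integrable M (\<lambda>\<omega>. f (Q1 0 \<omega>, Q2 0 \<omega>) * ((W h \<omega>)\<^sup>2 - h))"
    "expectation (\<lambda>\<omega>. f (Q1 0 \<omega>, Q2 0 \<omega>) * ((W h \<omega>)\<^sup>2 - h)) = 0"
proof -
  have int: "integrable M (\<lambda>\<omega>. f (Q1 0 \<omega>, Q2 0 \<omega>))"
    using bd measurable_compose[OF Q_measurable(3) f, of 0] by (intro integrable_const_bound[of _ k]) auto
  note mom = brownian_moments[OF brownian \<open>0 < h\<close>]
  have i1: "indep_var borel (\<lambda>\<omega>. f (Q1 0 \<omega>, Q2 0 \<omega>)) borel (W h)"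
    using f \<open>0 < h\<close> by (intro indep) auto
  have "indep_var borel ((\<lambda>x. x) \<circ> (\<lambda>\<omega>. f (Q1 0 \<omega>, Q2 0 \<omega>))) borel ((\<lambda>x. x\<^sup>2 - h) \<circ> W h)"
    by (rule indep_var_compose[OF i1]) auto
  then have i2: "indep_var borel (\<lambda>\<omega>. f (Q1 0 \<omega>, Q2 0 \<omega>)) borel (\<lambda>\<omega>. (W h \<omega>)\<^sup>2 - h)"
    by (simp add: comp_def)
  show "integrable M (\<lambda>\<omega>. f (Q1 0 \<omega>, Q2 0 \<omega>) * W h \<omega>)" "integrable M (\<lambda>\<omega>. f (Q1 0 \<omega>, Q2 0 \<omega>) * ((W h \<omega>)\<^sup>2 - h))"
    using indep_var_integrable[OF i1 int mom(1)] indep_var_integrable[OF i2 int mom(3)] .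
  show "expectation (\<lambda>\<omega>. f (Q1 0 \<omega>, Q2 0 \<omega>) * W h \<omega>) = 0" "expectation (\<lambda>\<omega>. f (Q1 0 \<omega>, Q2 0 \<omega>) * ((W h \<omega>)\<^sup>2 - h)) = 0"
    using indep_var_lebesgue_integral[OF i1 int mom(1)] indep_var_lebesgue_integral[OF i2 int mom(3)] mom by simp_all
qed

text \<open>
  Truncating at level \<open>K\<close> makes the one-step increment of \<open>F\<close> integrable, and only initial states
  in the bounded set \<open>F \<le> K\<close> contribute positively, so no a priori moments are needed.
\<close>

lemma generator_inequality:
  assumes "test_function F Fs Fss Fy"
    and lower: "\<And>q1 q2. q1 \<le> 0 \<Longrightarrow> 0 < q2 \<Longrightarrow> c \<le> F (q1 + q2) q2"
    and R0: "0 \<le> R" and sub: "\<And>q1 q2. q1 \<le> 0 \<Longrightarrow> 0 < q2 \<Longrightarrow> F (q1 + q2) q2 \<le> K \<Longrightarrow> q2 - q1 \<le> R"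
  shows "integrable p (\<lambda>x. of_bool (F (fst x + snd x) (snd x) \<le> K) * gen \<beta> Fs Fss Fy x)"
    and "0 \<le> (\<integral>x. of_bool (F (fst x + snd x) (snd x) \<le> K) * gen \<beta> Fs Fss Fy x \<partial>p)"
proof -
  interpret test_function F Fs Fss Fy by fact
  note [measurable] = measurable_F measurable_gen
  define X where "X = (\<lambda>t \<omega>. (Q1 t \<omega>, Q2 t \<omega>))"
  define V where "V = (\<lambda>x :: real \<times> real. F (fst x + snd x) (snd x))"
  define I where "I = (\<lambda>x. of_bool (V x \<le> K) :: real)"
  define A1 where "A1 = (\<lambda>x :: real \<times> real. I x * Fs (fst x + snd x) (snd x))"
  define A2 where "A2 = (\<lambda>x :: real \<times> real. I x * Fss (fst x + snd x) (snd x))"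
  define A3 where "A3 = (\<lambda>x. I x * gen \<beta> Fs Fss Fy x)"
  have X [measurable]: "X t \<in> borel_measurable M" if "0 \<le> t" for t
    unfolding X_def using Q_measurable(3)[OF that] .
  have [measurable]: "X 0 \<in> borel_measurable M" "Q1 0 \<in> borel_measurable M"
    using Q_measurable[of 0] by (auto simp: X_def)
  have [measurable]: "V \<in> borel_measurable borel" unfolding V_def by measurable
  have [measurable]: "I \<in> borel_measurable borel" unfolding I_def by measurable
  have [measurable]: "A1 \<in> borel_measurable borel" "A2 \<in> borel_measurable borel" "A3 \<in> borel_measurable borel"
    unfolding A1_def A2_def A3_def by measurable
  define C where "C = local_const \<beta> R"
  have C: "0 < C" using R0 beta by (simp add: C_def local_const_def)
  define R' where "R' = R + 2 * C"
  obtain k1 where k1: "0 \<le> k1"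
      "\<And>s y s' y'. \<bar>s\<bar> \<le> R' \<Longrightarrow> \<bar>y\<bar> \<le> R' \<Longrightarrow> \<bar>s'\<bar> \<le> R' \<Longrightarrow> \<bar>y'\<bar> \<le> R' \<Longrightarrow> \<bar>Fs s y - Fs s' y'\<bar> \<le> k1 * (\<bar>s - s'\<bar> + \<bar>y - y'\<bar>)"
      "\<And>s y. \<bar>s\<bar> \<le> R' \<Longrightarrow> \<bar>y\<bar> \<le> R' \<Longrightarrow> \<bar>Fs s y\<bar> \<le> k1"
    using loc_lipE[OF lip(2), of R'] by metis
  obtain k2 where k2: "0 \<le> k2"
      "\<And>s y s' y'. \<bar>s\<bar> \<le> R' \<Longrightarrow> \<bar>y\<bar> \<le> R' \<Longrightarrow> \<bar>s'\<bar> \<le> R' \<Longrightarrow> \<bar>y'\<bar> \<le> R' \<Longrightarrow> \<bar>Fss s y - Fss s' y'\<bar> \<le> k2 * (\<bar>s - s'\<bar> + \<bar>y - y'\<bar>)"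
      "\<And>s y. \<bar>s\<bar> \<le> R' \<Longrightarrow> \<bar>y\<bar> \<le> R' \<Longrightarrow> \<bar>Fss s y\<bar> \<le> k2"
    using loc_lipE[OF lip(3), of R'] by metis
  obtain k3 where k3: "0 \<le> k3"
      "\<And>s y s' y'. \<bar>s\<bar> \<le> R' \<Longrightarrow> \<bar>y\<bar> \<le> R' \<Longrightarrow> \<bar>s'\<bar> \<le> R' \<Longrightarrow> \<bar>y'\<bar> \<le> R' \<Longrightarrow> \<bar>Fy s y - Fy s' y'\<bar> \<le> k3 * (\<bar>s - s'\<bar> + \<bar>y - y'\<bar>)"
      "\<And>s y. \<bar>s\<bar> \<le> R' \<Longrightarrow> \<bar>y\<bar> \<le> R' \<Longrightarrow> \<bar>Fy s y\<bar> \<le> k3"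
    using loc_lipE[OF lip(4), of R'] by metis
  note k = k1(1) k2(1) k3(1) and b1 = k1(3) and b2 = k2(3) and b3 = k3(3) and l2 = k2(2) and l3 = k3(2)
  define \<kappa> where "\<kappa> = k1 + k2 + k3"
  have \<kappa>: "0 \<le> \<kappa>" "k1 \<le> \<kappa>" "k2 \<le> \<kappa>" "k3 \<le> \<kappa>" using k by (auto simp: \<kappa>_def)
  define E D where "E = 20 * \<kappa> * C ^ 3" and "D = \<bar>K - c\<bar> + \<kappa> * (6 + 2 * R + \<beta>)"
  have ED: "0 \<le> E" "0 \<le> D" using \<kappa> C R0 beta by (auto simp: E_def D_def)
  define J where "J = (\<lambda>n \<omega>. of_bool (- Q1 0 \<omega> \<le> C * (\<zeta> n \<omega> + step n)) :: real)"
  define Q where "Q = (\<lambda>n. prob {\<omega> \<in> space M. - Q1 0 \<omega> \<le> C * (\<zeta> n \<omega> + step n)})"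
  have J_meas [measurable]: "J n \<in> borel_measurable M" for n unfolding J_def by measurable
  have J_int: "integrable M (J n)" "expectation (J n) = Q n" for n
  proof -
    have eq: "J n \<omega> = indicator {\<omega> \<in> space M. - Q1 0 \<omega> \<le> C * (\<zeta> n \<omega> + step n)} \<omega>" if "\<omega> \<in> space M" for \<omega>
      using that by (simp add: J_def indicator_def)
    show "integrable M (J n)"
      by (intro integrable_const_bound[of _ 1]) (auto simp: J_def)
    have "expectation (J n) = expectation (indicator {\<omega> \<in> space M. - Q1 0 \<omega> \<le> C * (\<zeta> n \<omega> + step n)})"
      by (intro Bochner_Integration.integral_cong refl eq)
    moreover have "{\<omega> \<in> space M. - Q1 0 \<omega> \<le> C * (\<zeta> n \<omega> + step n)} \<inter> space M = {\<omega> \<in> space M. - Q1 0 \<omega> \<le> C * (\<zeta> n \<omega> + step n)}"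
      by auto
    ultimately show "expectation (J n) = Q n"
      unfolding Q_def by (metis Bochner_Integration.integral_indicator)
  qed
  have ss: "AE \<omega> in M. I (X 0 \<omega>) = 1 \<longrightarrow> \<bar>Q1 0 \<omega> + Q2 0 \<omega>\<bar> \<le> R' \<and> \<bar>Q2 0 \<omega>\<bar> \<le> R' \<and> Q2 0 \<omega> - Q1 0 \<omega> \<le> R"
    using state_space[OF order_refl]
  proof eventually_elim
    case (elim \<omega>)
    then show ?case
      using sub[of "Q1 0 \<omega>" "Q2 0 \<omega>"] C by (auto simp: I_def V_def X_def R'_def split: if_splits)
  qed
  have I01: "I x = 0 \<or> I x = 1" for x by (simp add: I_def)
  have Abd: "AE \<omega> in M. \<bar>A1 (X 0 \<omega>)\<bar> \<le> \<kappa> \<and> \<bar>A2 (X 0 \<omega>)\<bar> \<le> \<kappa> \<and> \<bar>A3 (X 0 \<omega>)\<bar> \<le> \<kappa> * (1 + 2 * R + \<beta>)"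
    using ss state_space[OF order_refl]
  proof eventually_elim
    case 3: (elim \<omega>)
    have "\<bar>A1 (X 0 \<omega>)\<bar> \<le> \<kappa>"
      using 3 I01[of "X 0 \<omega>"] b1[of "Q1 0 \<omega> + Q2 0 \<omega>" "Q2 0 \<omega>"] \<kappa> by (auto simp: A1_def X_def)
    moreover have a2: "\<bar>A2 (X 0 \<omega>)\<bar> \<le> \<kappa>"
      using 3 I01[of "X 0 \<omega>"] b2[of "Q1 0 \<omega> + Q2 0 \<omega>" "Q2 0 \<omega>"] \<kappa> by (auto simp: A2_def X_def)
    moreover have "\<bar>A3 (X 0 \<omega>)\<bar> \<le> \<kappa> * (1 + 2 * R + \<beta>)"
    proof (cases "I (X 0 \<omega>) = 1")
      case True
      then have "\<bar>gen \<beta> Fs Fss Fy (Q1 0 \<omega>, Q2 0 \<omega>)\<bar> \<le> \<kappa> * (1 + 2 * R + \<beta>)"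
        using 3 b1[of "Q1 0 \<omega> + Q2 0 \<omega>" "Q2 0 \<omega>"] b2[of "Q1 0 \<omega> + Q2 0 \<omega>" "Q2 0 \<omega>"]
          b3[of "Q1 0 \<omega> + Q2 0 \<omega>" "Q2 0 \<omega>"] \<kappa> beta by (intro gen_bound) auto
      then show ?thesis using True by (simp add: A3_def X_def)
    next
      case False
      then show ?thesis using I01[of "X 0 \<omega>"] \<kappa> R0 beta by (simp add: A3_def)
    qed
    ultimately show ?case using a2 by simp
  qed
  have A3_int: "integrable M (\<lambda>\<omega>. A3 (X 0 \<omega>))"
    using Abd by (intro integrable_const_bound[of _ "\<kappa> * (1 + 2 * R + \<beta>)"]) auto
  define G where "G = expectation (\<lambda>\<omega>. A3 (X 0 \<omega>))"
  \<comment> \<open>The parameter \<open>l\<close> is the Young weight of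
    \<open>step_error_bound\<close>. Stationarity makes the expected increment 0, the one-step bound
    estimates it from above, and the result is divided by h.\<close>
  have main: "0 \<le> G + E * (10 * sqrt (step n) + 130000 * (5 * sqrt (step n) + l) + (1 / l + 2) * Q n) + 130000 * D * step n"
    if "0 < l" for l n
  proof -
    define h r where "h = step n" and "r = sqrt h"
    have h: "0 < h" "h \<le> 1 / 4" "0 \<le> h"
      using step(1,2)[of n] by (auto simp: h_def)
    have r: "0 < r" "r\<^sup>2 = h"
      using h by (auto simp: r_def)
    moreover have "r \<le> 1 / 2"
      unfolding r_def by (rule real_le_lsqrt) (use h in \<open>auto simp: power2_eq_square\<close>)
    ultimately have r: "0 < r" "r \<le> 1 / 2" "r\<^sup>2 = h" by auto
    note [measurable] = X[OF h(3)]
    \<comment> \<open>Almost surely between min c K and K, hence integrable at every time, so that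
      equality of laws gives equality of expectations.\<close>
    define mK where "mK = (\<lambda>x. min (V x) K)"
    have [measurable]: "mK \<in> borel_measurable borel" unfolding mK_def by measurable
    have Vlow: "AE \<omega> in M. c \<le> V (X t \<omega>)" if "0 \<le> t" for t
      using state_space[OF that] by eventually_elim (use lower in \<open>auto simp: V_def X_def\<close>)
    have mK_int: "integrable M (\<lambda>\<omega>. mK (X t \<omega>))" if "0 \<le> t" for t
    proof (rule integrable_const_bound[of _ "\<bar>c\<bar> + \<bar>K\<bar>"])
      show "AE \<omega> in M. norm (mK (X t \<omega>)) \<le> \<bar>c\<bar> + \<bar>K\<bar>"
        using Vlow[OF that] by eventually_elim (auto simp: mK_def min_def)
    qed (use X[OF that] in measurable)
    have same: "expectation (\<lambda>\<omega>. mK (X h \<omega>)) = expectation (\<lambda>\<omega>. mK (X 0 \<omega>))"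
      unfolding X_def using expectation_law[of mK h] expectation_law[of mK 0] h by simp
    define Up where "Up = (\<lambda>\<omega>. sqrt 2 * (A1 (X 0 \<omega>) * W h \<omega>) + A2 (X 0 \<omega>) * ((W h \<omega>)\<^sup>2 - h) + h * A3 (X 0 \<omega>)
      + E * (10 * r ^ 3 + (5 / r + l / h) * \<zeta> n \<omega> ^ 4 + (1 / l + 2) * h * J n \<omega>) + D * \<zeta> n \<omega> ^ 4)"
    note o1 = noise_orthogonal[of A1 \<kappa> h] and o2 = noise_orthogonal[of A2 \<kappa> h]
    have ints: "integrable M (\<lambda>\<omega>. A1 (X 0 \<omega>) * W h \<omega>)" "expectation (\<lambda>\<omega>. A1 (X 0 \<omega>) * W h \<omega>) = 0"
      "integrable M (\<lambda>\<omega>. A2 (X 0 \<omega>) * ((W h \<omega>)\<^sup>2 - h))" "expectation (\<lambda>\<omega>. A2 (X 0 \<omega>) * ((W h \<omega>)\<^sup>2 - h)) = 0"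
      unfolding X_def using o1(1,2) o2(3,4) Abd h by (auto simp: X_def)
    note intg = ints(1,3) A3_int noise_integrable[of n] J_int(1)[of n]
    have Up_int: "integrable M Up" unfolding Up_def using intg by auto
    have Up_exp: "expectation Up = h * G + E * (10 * r ^ 3 + (5 / r + l / h) * expectation (\<lambda>\<omega>. \<zeta> n \<omega> ^ 4) + (1 / l + 2) * h * Q n)
       + D * expectation (\<lambda>\<omega>. \<zeta> n \<omega> ^ 4)"
      unfolding Up_def using intg ints(2,4) J_int(2)[of n] by (simp add: G_def prob_space)
    have "AE \<omega> in M. mK (X h \<omega>) - mK (X 0 \<omega>) \<le> Up \<omega>"
      using driven[of n] ss Vlow[OF order_refl]
    proof eventually_elim
      case (elim \<omega>)
      interpret P: driven_path \<beta> "\<lambda>t. W t \<omega>" "\<lambda>t. Q1 t \<omega>" "\<lambda>t. Q2 t \<omega>" "\<lambda>t. L t \<omega>" h "\<zeta> n \<omega>"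
        using elim(1) by (simp add: h_def)
      have z: "0 \<le> \<zeta> n \<omega>" by (rule noise_nonneg)
      have J01: "0 \<le> J n \<omega>" "J n \<omega> \<le> 1" by (auto simp: J_def)
      have sb: "h * P.\<delta> + P.\<delta> ^ 3 + (P.\<delta>\<^sup>2 + h) * J n \<omega>
        \<le> 10 * r ^ 3 + (5 / r + l / h) * \<zeta> n \<omega> ^ 4 + (1 / l + 2) * h * J n \<omega>"
        using step_error_bound[OF z r(1,2) \<open>0 < l\<close> J01] unfolding r(3) P.\<delta>_def .
      have pos: "0 \<le> E * (10 * r ^ 3 + (5 / r + l / h) * \<zeta> n \<omega> ^ 4 + (1 / l + 2) * h * J n \<omega>)" "0 \<le> D * \<zeta> n \<omega> ^ 4"
        using ED r h \<open>0 < l\<close> J01 by auto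
      show ?case
      proof (cases "I (X 0 \<omega>) = 1")
        \<comment> \<open>A start above the truncation level has the largest possible truncated
          value, so its increment is at most 0, while \<open>Up\<close> consists only of nonnegative
          error terms there.\<close>
        case False
        then have "I (X 0 \<omega>) = 0" using I01 by blast
        then have "Up \<omega> \<ge> 0" using pos by (simp add: Up_def A1_def A2_def A3_def)
        moreover have "mK (X h \<omega>) \<le> mK (X 0 \<omega>)"
          using False by (auto simp: mK_def I_def split: if_splits)
        ultimately show ?thesis by simp
      next
        case True
        then have "mK (X h \<omega>) - mK (X 0 \<omega>) = min (F (Q1 h \<omega> + Q2 h \<omega>) (Q2 h \<omega>)) K - F (Q1 0 \<omega> + Q2 0 \<omega>) (Q2 0 \<omega>)"
          by (auto simp: mK_def I_def V_def X_def split: if_splits)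
        also have "\<dots> \<le> Fs (Q1 0 \<omega> + Q2 0 \<omega>) (Q2 0 \<omega>) * (sqrt 2 * W h \<omega>) + Fss (Q1 0 \<omega> + Q2 0 \<omega>) (Q2 0 \<omega>) * ((W h \<omega>)\<^sup>2 - h)
          + h * gen \<beta> Fs Fss Fy (Q1 0 \<omega>, Q2 0 \<omega>)
          + 20 * \<kappa> * local_const \<beta> R ^ 3 * (h * P.\<delta> + P.\<delta> ^ 3 + (P.\<delta>\<^sup>2 + h) * of_bool (- Q1 0 \<omega> \<le> local_const \<beta> R * P.\<delta>))
          + (\<bar>K - c\<bar> + \<kappa> * (6 + 2 * R + \<beta>)) * \<zeta> n \<omega> ^ 4"
        proof (rule P.one_step_upper[OF assms(1)])
          show "P.N \<le> R" using elim(2) True by (auto simp: P.N_def)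
          show "R' = R + 2 * local_const \<beta> R" by (simp add: R'_def C_def)
          show "0 \<le> \<kappa>" by fact
          show "\<bar>Fs s y\<bar> \<le> \<kappa> \<and> \<bar>Fss s y\<bar> \<le> \<kappa> \<and> \<bar>Fy s y\<bar> \<le> \<kappa>" if "\<bar>s\<bar> \<le> R'" "\<bar>y\<bar> \<le> R'" for s y
            using b1[OF that] b2[OF that] b3[OF that] \<kappa> by linarith
          show "\<bar>Fss s y - Fss s' y\<bar> \<le> \<kappa> * \<bar>s - s'\<bar>" if "\<bar>s\<bar> \<le> R'" "\<bar>s'\<bar> \<le> R'" "\<bar>y\<bar> \<le> R'" for s s' y
            using l2[OF that(1,3,2,3)] mult_right_mono[OF \<kappa>(3), of "\<bar>s - s'\<bar>"] by simp
          show "\<bar>Fy s y - Fy s' y'\<bar> \<le> \<kappa> * (\<bar>s - s'\<bar> + \<bar>y - y'\<bar>)"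
            if "\<bar>s\<bar> \<le> R'" "\<bar>y\<bar> \<le> R'" "\<bar>s'\<bar> \<le> R'" "\<bar>y'\<bar> \<le> R'" for s y s' y'
            using l3[OF that] mult_right_mono[OF \<kappa>(4), of "\<bar>s - s'\<bar> + \<bar>y - y'\<bar>"] by simp
          show "c \<le> F (Q1 0 \<omega> + Q2 0 \<omega>) (Q2 0 \<omega>)"
            using elim(3) by (simp add: V_def X_def)
        qed
        also have "\<dots> = sqrt 2 * (A1 (X 0 \<omega>) * W h \<omega>) + A2 (X 0 \<omega>) * ((W h \<omega>)\<^sup>2 - h) + h * A3 (X 0 \<omega>)
          + E * (h * P.\<delta> + P.\<delta> ^ 3 + (P.\<delta>\<^sup>2 + h) * J n \<omega>) + D * \<zeta> n \<omega> ^ 4"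
        proof -
          have "J n \<omega> = of_bool (- Q1 0 \<omega> \<le> local_const \<beta> R * P.\<delta>)"
            unfolding J_def C_def P.\<delta>_def unfolding h_def ..
          then show ?thesis
            using True by (simp add: A1_def A2_def A3_def X_def E_def D_def C_def)
        qed
        also have "\<dots> \<le> Up \<omega>"
          using mult_left_mono[OF sb ED(1)] unfolding Up_def by linarith
        finally show ?thesis .
      qed
    qed
    then have "expectation (\<lambda>\<omega>. mK (X h \<omega>) - mK (X 0 \<omega>)) \<le> expectation Up"
      using mK_int[OF order_refl] mK_int[OF h(3)] by (intro integral_mono_AE Up_int) auto
    then have "0 \<le> expectation Up"
      using same mK_int[OF order_refl] mK_int[OF h(3)] by simp
    also have "\<dots> \<le> h * G + E * (10 * r ^ 3 + (5 / r + l / h) * (130000 * h\<^sup>2) + (1 / l + 2) * h * Q n) + D * (130000 * h\<^sup>2)"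
      unfolding Up_exp using ED r h \<open>0 < l\<close> noise_moment[of n, folded h_def]
      by (intro add_mono mult_left_mono order_refl) auto
    also have "\<dots> = h * (G + E * (10 * r + 130000 * (5 * r + l) + (1 / l + 2) * Q n) + 130000 * D * h)"
      unfolding r(3)[symmetric] using r(1) by (simp add: field_simps power2_eq_square power3_eq_cube)
    finally show ?thesis
      using h by (simp add: zero_le_mult_iff r_def h_def)
  qed
  \<comment> \<open>For fixed \<open>l\<close> the near-boundary probability \<open>Q n\<close> and
    all powers of the step vanish as n grows; only a multiple of \<open>l\<close> survives, and
    \<open>l\<close> is arbitrary.\<close>
  have bound: "0 \<le> G + E * 130000 * l" if "0 < l" for l
  proof -
    have "(\<lambda>n. G + E * (10 * sqrt (step n) + 130000 * (5 * sqrt (step n) + l) + (1 / l + 2) * Q n) + 130000 * D * step n)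
      \<longlonglongrightarrow> G + E * (10 * 0 + 130000 * (5 * 0 + l) + (1 / l + 2) * 0) + 130000 * D * 0"
      unfolding Q_def by (intro tendsto_add tendsto_mult tendsto_const step_tendsto hit_prob_tendsto_0 C)
    from tendsto_lowerbound[OF this always_eventually[OF allI[OF main[OF that]]]] show ?thesis
      by (simp add: mult.assoc)
  qed
  have "0 \<le> G"
  proof (rule ccontr)
    assume "\<not> 0 \<le> G"
    define m where "m = E * 130000 + 1"
    have "0 < m" using ED by (simp add: m_def)
    define l where "l = - G / (2 * m)"
    have "0 < l" using \<open>\<not> 0 \<le> G\<close> \<open>0 < m\<close> by (simp add: l_def divide_less_0_iff)
    moreover have "E * 130000 * l \<le> m * l"
      using \<open>0 < l\<close> by (intro mult_right_mono) (auto simp: m_def)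
    moreover have "m * l = - G / 2" using \<open>0 < m\<close> by (simp add: l_def)
    ultimately show False using bound[of l] \<open>\<not> 0 \<le> G\<close> by linarith
  qed
  moreover have "G = (\<integral>x. A3 x \<partial>p)"
    unfolding G_def X_def by (rule expectation_law) auto
  ultimately show "0 \<le> (\<integral>x. of_bool (F (fst x + snd x) (snd x) \<le> K) * gen \<beta> Fs Fss Fy x \<partial>p)"
    by (simp add: A3_def I_def V_def)
  have "integrable (distr M borel (X 0)) A3"
    using A3_int by (subst integrable_distr_eq) auto
  then show "integrable p (\<lambda>x. of_bool (F (fst x + snd x) (snd x) \<le> K) * gen \<beta> Fs Fss Fy x)"
    using law[OF order_refl] by (simp add: X_def A3_def[abs_def] I_def V_def)
qed

end

section \<open>Moments\<close>

lemma test_function_combine: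
  assumes "test_function F Fs Fss Fy" "test_function G Gs Gss Gy"
  shows "test_function (\<lambda>s y. a * F s y + b * G s y) (\<lambda>s y. a * Fs s y + b * Gs s y)
    (\<lambda>s y. a * Fss s y + b * Gss s y) (\<lambda>s y. a * Fy s y + b * Gy s y)"
proof -
  interpret F: test_function F Fs Fss Fy by fact
  interpret G: test_function G Gs Gss Gy by fact
  show ?thesis
  proof
    show "((\<lambda>s. a * F s y + b * G s y) has_real_derivative a * Fs s y + b * Gs s y) (at s)" for s y
      by (intro DERIV_add DERIV_cmult F.Fs G.Fs)
    show "((\<lambda>s. a * Fs s y + b * Gs s y) has_real_derivative a * Fss s y + b * Gss s y) (at s)" for s y
      by (intro DERIV_add DERIV_cmult F.Fss G.Fss)
    show "((\<lambda>y. a * F s y + b * G s y) has_real_derivative a * Fy s y + b * Gy s y) (at y)" for s y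
      by (intro DERIV_add DERIV_cmult F.Fy G.Fy)
  qed (intro loc_lip_add loc_lip_mult loc_lip_const F.lip G.lip | simp add: F.diagonal G.diagonal)+
qed

lemma gen_combine:
  "gen \<beta> (\<lambda>s y. a * Fs s y + b * Gs s y) (\<lambda>s y. a * Fss s y + b * Gss s y) (\<lambda>s y. a * Fy s y + b * Gy s y) x
    = a * gen \<beta> Fs Fss Fy x + b * gen \<beta> Gs Gss Gy x"
  by (cases x) (simp add: gen_def algebra_simps)

text \<open>
  The coefficients are chosen so that the terms \<open>u * y^3\<close> and \<open>u^3 * y\<close>, with \<open>u = y - s\<close>, cancel
  in the generator.
\<close>

definition quartic :: "real \<Rightarrow> real \<Rightarrow> real" where
  "quartic s y = s ^ 4 + 2 * ((y - s)\<^sup>2 * y\<^sup>2) + 3 * (y - s) ^ 4"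

definition quartic_s :: "real \<Rightarrow> real \<Rightarrow> real" where
  "quartic_s s y = 4 * s ^ 3 - 4 * ((y - s) * y\<^sup>2) - 12 * (y - s) ^ 3"

definition quartic_ss :: "real \<Rightarrow> real \<Rightarrow> real" where
  "quartic_ss s y = 12 * s\<^sup>2 + 4 * y\<^sup>2 + 36 * (y - s)\<^sup>2"

definition quartic_y :: "real \<Rightarrow> real \<Rightarrow> real" where
  "quartic_y s y = 4 * ((y - s) * y\<^sup>2) + 4 * ((y - s)\<^sup>2 * y) + 12 * (y - s) ^ 3"

text \<open>The quantity dissipated by \<open>quartic\<close>. In \<open>q2\<close> alone only a
  cubic term appears: along the boundary the drift of the sum is just -\<beta>, so its fourth power
  loses one degree.\<close>

definition weight :: "real \<times> real \<Rightarrow> real" where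
  "weight = (\<lambda>(q1, q2). q2 ^ 3 + q1\<^sup>2 * q2\<^sup>2 + q1 ^ 4)"

lemma quartic_test_function: "test_function quartic quartic_s quartic_ss quartic_y"
proof
  show "((\<lambda>s. quartic s y) has_real_derivative quartic_s s y) (at s)" for s y
    unfolding quartic_def quartic_s_def by (auto intro!: derivative_eq_intros simp: algebra_simps)
  show "((\<lambda>s. quartic_s s y) has_real_derivative quartic_ss s y) (at s)" for s y
    unfolding quartic_s_def quartic_ss_def by (auto intro!: derivative_eq_intros simp: algebra_simps)
  show "((\<lambda>y. quartic s y) has_real_derivative quartic_y s y) (at y)" for s y
    unfolding quartic_def quartic_y_def by (auto intro!: derivative_eq_intros simp: algebra_simps power2_eq_square)
  show "loc_lip quartic" unfolding quartic_def[abs_def] by (intro loc_lip_add loc_lip_mult loc_lip_power loc_lip_diff loc_lip_const loc_lip_fst loc_lip_snd)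
  show "loc_lip quartic_s" unfolding quartic_s_def[abs_def] by (intro loc_lip_add loc_lip_mult loc_lip_power loc_lip_diff loc_lip_const loc_lip_fst loc_lip_snd)
  show "loc_lip quartic_ss" unfolding quartic_ss_def[abs_def] by (intro loc_lip_add loc_lip_mult loc_lip_power loc_lip_diff loc_lip_const loc_lip_fst loc_lip_snd)
  show "loc_lip quartic_y" unfolding quartic_y_def[abs_def] by (intro loc_lip_add loc_lip_mult loc_lip_power loc_lip_diff loc_lip_const loc_lip_fst loc_lip_snd)
  show "quartic_y s s = 0" for s by (simp add: quartic_y_def)
qed

lemma quartic_lower: "0 < y \<Longrightarrow> s ^ 4 + 3 * (y - s) ^ 4 \<le> quartic s y"
  by (simp add: quartic_def)

text \<open>Part of each dissipative term absorbs the lower-order terms. The constant depends on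
  \<beta> without uniformity; it serves integrability alone.\<close>

lemma quartic_gen_le:
  assumes "0 < \<beta>"
  obtains C where "0 \<le> C" "\<And>q1 q2. q1 \<le> 0 \<Longrightarrow> 0 < q2 \<Longrightarrow>
    gen \<beta> quartic_s quartic_ss quartic_y (q1, q2) \<le> C - min (2 * \<beta>) 4 * weight (q1, q2)"
proof -
  \<comment> \<open>The total coefficients of y^2 and u^2 once the mixed terms with \<beta> have
    been split: 12 + 4 + 4\<beta>^2 and 12 + 36 + 8\<beta>^2. The y^2 term is then absorbed by the
    cubic one beyond y = a / (2\<beta>), the u^2 term by completing a square.\<close>
  define a b where "a = 16 + 4 * \<beta>\<^sup>2" and "b = 48 + 8 * \<beta>\<^sup>2"
  have ab: "0 < a" "0 < b" using assms by (auto simp: a_def b_def add_pos_nonneg)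
  show ?thesis
  proof (rule that[of "a * (a / (2 * \<beta>))\<^sup>2 + b\<^sup>2 / 16"])
    show "0 \<le> a * (a / (2 * \<beta>))\<^sup>2 + b\<^sup>2 / 16" using ab by auto
    fix q1 q2 :: real assume q: "q1 \<le> 0" "0 < q2"
    define u y where "u = - q1" and "y = q2"
    have uy: "0 \<le> u" "0 < y" using q by (auto simp: u_def y_def)
    have eq: "gen \<beta> quartic_s quartic_ss quartic_y (q1, q2) = - 4 * \<beta> * y ^ 3 - 20 * (u\<^sup>2 * y\<^sup>2) - 16 * u ^ 4
      + 16 * \<beta> * u * y\<^sup>2 + 16 * \<beta> * u ^ 3 - 12 * \<beta> * y * u\<^sup>2 + 12 * (y - u)\<^sup>2 + 4 * y\<^sup>2 + 36 * u\<^sup>2"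
    proof -
      have q1: "q1 = - u" and q2: "q2 = y" by (auto simp: u_def y_def)
      show ?thesis
        unfolding q1 q2 gen_def quartic_s_def quartic_ss_def quartic_y_def
        by (simp add: algebra_simps power2_eq_square power3_eq_cube power4_eq_xxxx)
    qed
    have "16 * \<beta> * u * y\<^sup>2 \<le> 16 * (u\<^sup>2 * y\<^sup>2) + 4 * \<beta>\<^sup>2 * y\<^sup>2"
    proof -
      have "0 \<le> 4 * ((2 * u - \<beta>)\<^sup>2 * y\<^sup>2)" by simp
      also have "\<dots> = 16 * (u\<^sup>2 * y\<^sup>2) + 4 * \<beta>\<^sup>2 * y\<^sup>2 - 16 * \<beta> * u * y\<^sup>2"
        by (simp add: power2_eq_square algebra_simps)
      finally show ?thesis by simp
    qed
    moreover have "16 * \<beta> * u ^ 3 \<le> 8 * u ^ 4 + 8 * \<beta>\<^sup>2 * u\<^sup>2"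
    proof -
      have "0 \<le> 8 * ((u - \<beta>)\<^sup>2 * u\<^sup>2)" by simp
      also have "\<dots> = 8 * u ^ 4 + 8 * \<beta>\<^sup>2 * u\<^sup>2 - 16 * \<beta> * u ^ 3"
        by (simp add: power2_eq_square power3_eq_cube power4_eq_xxxx algebra_simps)
      finally show ?thesis by simp
    qed
    moreover have "12 * (y - u)\<^sup>2 \<le> 12 * y\<^sup>2 + 12 * u\<^sup>2"
      using mult_nonneg_nonneg[OF uy(1) less_imp_le[OF uy(2)]] by (simp add: power2_diff mult.commute)
    moreover have "0 \<le> 12 * \<beta> * y * u\<^sup>2" using uy assms by auto
    moreover have "a * y\<^sup>2 \<le> 2 * \<beta> * y ^ 3 + a * (a / (2 * \<beta>))\<^sup>2"
    proof (cases "y \<le> a / (2 * \<beta>)")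
      case True
      then have "y\<^sup>2 \<le> (a / (2 * \<beta>))\<^sup>2" using uy by (intro power_mono) auto
      then have "a * y\<^sup>2 \<le> a * (a / (2 * \<beta>))\<^sup>2" using ab by (intro mult_left_mono) auto
      moreover have "0 \<le> 2 * \<beta> * y ^ 3" using uy assms by auto
      ultimately show ?thesis by linarith
    next
      case False
      then have "a \<le> 2 * \<beta> * y" using assms by (simp add: field_simps)
      then have "a * y\<^sup>2 \<le> 2 * \<beta> * y * y\<^sup>2" by (intro mult_right_mono) auto
      moreover have "2 * \<beta> * y * y\<^sup>2 = 2 * \<beta> * y ^ 3" by (simp add: power2_eq_square power3_eq_cube)
      moreover have "0 \<le> a * (a / (2 * \<beta>))\<^sup>2" using ab by auto
      ultimately show ?thesis by linarith
    qed
    moreover have "b * u\<^sup>2 \<le> 4 * u ^ 4 + b\<^sup>2 / 16"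
    proof -
      have "0 \<le> (2 * u\<^sup>2 - b / 4)\<^sup>2" by simp
      also have "\<dots> = 4 * u ^ 4 + b\<^sup>2 / 16 - b * u\<^sup>2"
        by (simp add: power2_eq_square power4_eq_xxxx algebra_simps)
      finally show ?thesis by simp
    qed
    moreover have "a * y\<^sup>2 = 16 * y\<^sup>2 + 4 * \<beta>\<^sup>2 * y\<^sup>2" "b * u\<^sup>2 = 48 * u\<^sup>2 + 8 * \<beta>\<^sup>2 * u\<^sup>2"
      by (simp_all add: a_def b_def distrib_right)
    ultimately have "gen \<beta> quartic_s quartic_ss quartic_y (q1, q2)
      \<le> a * (a / (2 * \<beta>))\<^sup>2 + b\<^sup>2 / 16 - (2 * \<beta> * y ^ 3 + 4 * (u\<^sup>2 * y\<^sup>2) + 4 * u ^ 4)"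
      unfolding eq by linarith
    moreover have "min (2 * \<beta>) 4 * weight (q1, q2) \<le> 2 * \<beta> * y ^ 3 + 4 * (u\<^sup>2 * y\<^sup>2) + 4 * u ^ 4"
    proof -
      have "min (2 * \<beta>) 4 * y ^ 3 \<le> 2 * \<beta> * y ^ 3" "min (2 * \<beta>) 4 * (u\<^sup>2 * y\<^sup>2) \<le> 4 * (u\<^sup>2 * y\<^sup>2)" "min (2 * \<beta>) 4 * u ^ 4 \<le> 4 * u ^ 4"
        using uy by (intro mult_right_mono; simp)+
      then show ?thesis
        by (simp add: weight_def u_def y_def distrib_left)
    qed
    ultimately show "gen \<beta> quartic_s quartic_ss quartic_y (q1, q2) \<le> a * (a / (2 * \<beta>))\<^sup>2 + b\<^sup>2 / 16 - min (2 * \<beta>) 4 * weight (q1, q2)"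
      by linarith
  qed
qed

lemma extent_le:
  fixes q1 q2 :: real
  assumes "(q1 + q2) ^ 4 \<le> m" "q1 ^ 4 \<le> m"
  shows "q2 - q1 \<le> 3 * (1 + m)"
proof -
  have "\<bar>q1 + q2\<bar> \<le> 1 + m" "\<bar>q1\<bar> \<le> 1 + m"
    using assms abs_le_one_plus_power4[of "q1 + q2"] abs_le_one_plus_power4[of q1] by auto
  then show ?thesis by (simp add: abs_le_iff)
qed

lemma weight_nonneg: "0 < q2 \<Longrightarrow> 0 \<le> weight (q1, q2)"
  by (simp add: weight_def)

text \<open>The monomials that occur in the generators of all later test functions; integrability of
  \<open>weight\<close> thus makes them all integrable.\<close>

lemma monomial_bounds:
  fixes q1 q2 :: real
  assumes "q1 \<le> 0" "0 < q2"
  defines "u \<equiv> - q1" and "y \<equiv> q2" and "w \<equiv> 1 + weight (q1, q2)"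
  shows "1 \<le> w" "y \<le> w" "y\<^sup>2 \<le> w" "u \<le> w" "u\<^sup>2 \<le> w" "u ^ 3 \<le> w" "u * y \<le> w" "u\<^sup>2 * y \<le> 2 * w"
proof -
  have uy: "0 \<le> u" "0 \<le> y" using assms by (auto simp: u_def y_def)
  have w: "w = 1 + y ^ 3 + u\<^sup>2 * y\<^sup>2 + u ^ 4"
    by (simp add: w_def weight_def u_def y_def)
  have pos: "0 \<le> y ^ 3" "0 \<le> u\<^sup>2 * y\<^sup>2" "0 \<le> u ^ 4" using uy by auto
  note pow = power_le_one_plus_power
  show "1 \<le> w" using pos by (simp add: w)
  have "y \<le> 1 + y ^ 3" "y\<^sup>2 \<le> 1 + y ^ 3" "u \<le> 1 + u ^ 4" and u2: "u\<^sup>2 \<le> 1 + u ^ 4" and "u ^ 3 \<le> 1 + u ^ 4"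
    "u * y \<le> 1 + u\<^sup>2 * y\<^sup>2"
    using pow[of y 1 3] pow[of y 2 3] pow[of u 1 4] pow[of u 2 4] pow[of u 3 4] pow[of "u * y" 1 2] uy
    by (auto simp: power_mult_distrib)
  then show "y \<le> w" "y\<^sup>2 \<le> w" "u \<le> w" "u\<^sup>2 \<le> w" "u ^ 3 \<le> w" "u * y \<le> w"
    using pos unfolding w by linarith+
  have "u\<^sup>2 * y \<le> u\<^sup>2 * (1 + y\<^sup>2)"
    using pow[of y 1 2] uy by (intro mult_left_mono) auto
  then show "u\<^sup>2 * y \<le> 2 * w"
    using u2 pos unfolding w distrib_left by linarith
qed

context stationary_diffusion
begin

lemma sets_p [measurable_cong]: "sets p = sets borel"
  using law[OF order_refl] by (metis sets_distr)

lemma prob_space_p: "prob_space p"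
  using law[OF order_refl] prob_space_distr[of "\<lambda>\<omega>. (Q1 0 \<omega>, Q2 0 \<omega>)" borel] Q_measurable(3)[of 0] by simp

lemma AE_p: "AE x in p. fst x \<le> 0 \<and> 0 < snd x"
proof -
  have "AE x in distr M borel (\<lambda>\<omega>. (Q1 0 \<omega>, Q2 0 \<omega>)). fst x \<le> 0 \<and> 0 < snd x"
  proof (subst AE_distr_iff)
    show "(\<lambda>\<omega>. (Q1 0 \<omega>, Q2 0 \<omega>)) \<in> borel_measurable M" by (rule Q_measurable) simp
    show "{x \<in> space borel. fst x \<le> 0 \<and> 0 < snd x} \<in> sets (borel :: (real \<times> real) measure)"
      unfolding space_borel Collect_conj_eq Collect_mem_eq
      by (intro sets.Int borel_open[OF open_UNIV] borel_closed[OF closed_Collect_le] borel_open[OF open_Collect_less] continuous_intros)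
    show "AE \<omega> in M. fst (Q1 0 \<omega>, Q2 0 \<omega>) \<le> 0 \<and> 0 < snd (Q1 0 \<omega>, Q2 0 \<omega>)"
      using state_space[OF order_refl] by simp
  qed
  then show ?thesis unfolding law[OF order_refl] .
qed

lemma measurable_p:
  fixes f :: "real \<times> real \<Rightarrow> real"
  shows "f \<in> borel_measurable borel \<Longrightarrow> f \<in> borel_measurable p"
  using measurable_cong_sets[OF sets_p refl, of "borel :: real measure"] by simp

text \<open>On each sublevel set of \<open>quartic\<close> the truncated generator inequality bounds
  the expectation of \<open>weight\<close> by \<open>C / m\<close>, independently of the level; the
  Fatou lemma removes the truncation.\<close>

lemma weight_integrable: "integrable p weight"
proof -
  interpret P: prob_space p by (rule prob_space_p)
  interpret T: test_function quartic quartic_s quartic_ss quartic_y by (rule quartic_test_function)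
  obtain C where C: "0 \<le> C" "\<And>q1 q2. q1 \<le> 0 \<Longrightarrow> 0 < q2 \<Longrightarrow>
    gen \<beta> quartic_s quartic_ss quartic_y (q1, q2) \<le> C - min (2 * \<beta>) 4 * weight (q1, q2)"
    using quartic_gen_le[OF beta] by metis
  define m where "m = min (2 * \<beta>) 4"
  have m: "0 < m" using beta by (simp add: m_def)
  define I where "I = (\<lambda>n x. of_bool (quartic (fst x + snd x) (snd x) \<le> real n) :: real)"
  have wm: "weight \<in> borel_measurable borel"
    unfolding weight_def case_prod_beta by (intro borel_measurable_continuous_onI continuous_intros)
  have [measurable]: "weight \<in> borel_measurable p" by (rule measurable_p[OF wm])
  have Vm: "(\<lambda>x. quartic (fst x + snd x) (snd x)) \<in> borel_measurable p"
    by (rule measurable_p[OF T.measurable_F(1)])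
  then have [measurable]: "I n \<in> borel_measurable p" for n unfolding I_def by measurable
  have bound: "(\<integral>\<^sup>+x. ennreal (I n x * weight x) \<partial>p) \<le> ennreal (C / m)" for n
  proof -
    have sub: "q2 - q1 \<le> 3 * (1 + real n)" if "q1 \<le> 0" "0 < q2" "quartic (q1 + q2) q2 \<le> real n" for q1 q2
    proof -
      have le: "(q1 + q2) ^ 4 + 3 * q1 ^ 4 \<le> real n"
        using quartic_lower[OF that(2), of "q1 + q2"] that(3) by simp
      have "0 \<le> q1 ^ 4" "0 \<le> (q1 + q2) ^ 4" by simp_all
      then show ?thesis using le by (intro extent_le; linarith)
    qed
    have lower: "0 \<le> quartic (q1 + q2) q2" if "q1 \<le> 0" "0 < q2" for q1 q2
      unfolding quartic_def by (intro add_nonneg_nonneg mult_nonneg_nonneg) auto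
    have I_eq: "of_bool (quartic (fst x + snd x) (snd x) \<le> real n) = I n x" for x
      by (simp add: I_def)
    have R0: "0 \<le> 3 * (1 + real n)" by simp
    note gi = generator_inequality[where K = "real n", OF quartic_test_function lower R0 sub, unfolded I_eq]
    have ae: "AE x in p. I n x * gen \<beta> quartic_s quartic_ss quartic_y x \<le> C - m * (I n x * weight x)
        \<and> 0 \<le> I n x * weight x \<and> I n x * weight x \<le> (C - I n x * gen \<beta> quartic_s quartic_ss quartic_y x) / m"
      using AE_p
    proof eventually_elim
      case (elim x)
      have "I n x = 0 \<or> I n x = 1" by (simp add: I_def)
      then have "I n x * gen \<beta> quartic_s quartic_ss quartic_y x \<le> C - m * (I n x * weight x)"
        using C(2)[of "fst x" "snd x"] elim C(1) by (auto simp: m_def)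
      moreover have "0 \<le> I n x * weight x"
        using weight_nonneg[of "snd x" "fst x"] elim by (simp add: I_def)
      ultimately show ?case using m by (simp add: field_simps)
    qed
    have int: "integrable p (\<lambda>x. I n x * weight x)"
    proof (rule Bochner_Integration.integrable_bound)
      show "integrable p (\<lambda>x. (C - I n x * gen \<beta> quartic_s quartic_ss quartic_y x) / m)"
        using gi(1) by simp
      show "AE x in p. norm (I n x * weight x) \<le> norm ((C - I n x * gen \<beta> quartic_s quartic_ss quartic_y x) / m)"
        using ae by eventually_elim (simp only: real_norm_def, linarith)
    qed simp
    have "(\<integral>x. I n x * gen \<beta> quartic_s quartic_ss quartic_y x \<partial>p) \<le> (\<integral>x. C - m * (I n x * weight x) \<partial>p)"
      using ae int gi(1) by (intro integral_mono_AE) auto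
    then have "m * (\<integral>x. I n x * weight x \<partial>p) \<le> C"
      using gi(2) int by (simp add: P.prob_space)
    then have "(\<integral>x. I n x * weight x \<partial>p) \<le> C / m"
      using m by (simp add: field_simps)
    then show ?thesis
      using int ae by (subst nn_integral_eq_integral) (auto intro: ennreal_leI elim: eventually_mono)
  qed
  have "(\<integral>\<^sup>+x. ennreal (weight x) \<partial>p) \<le> (\<integral>\<^sup>+x. liminf (\<lambda>n. ennreal (I n x * weight x)) \<partial>p)"
  proof (rule nn_integral_mono)
    fix x
    have "eventually (\<lambda>n. quartic (fst x + snd x) (snd x) \<le> real n) sequentially"
      by (rule eventually_sequentiallyI[of "nat \<lceil>quartic (fst x + snd x) (snd x)\<rceil>"]) linarith
    then have "eventually (\<lambda>n. ennreal (I n x * weight x) = ennreal (weight x)) sequentially"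
      by eventually_elim (simp add: I_def)
    then have "(\<lambda>n. ennreal (I n x * weight x)) \<longlonglongrightarrow> ennreal (weight x)"
      by (rule tendsto_eventually)
    then show "ennreal (weight x) \<le> liminf (\<lambda>n. ennreal (I n x * weight x))"
      by (simp add: lim_imp_Liminf)
  qed
  also have "\<dots> \<le> liminf (\<lambda>n. \<integral>\<^sup>+x. ennreal (I n x * weight x) \<partial>p)"
    by (rule nn_integral_liminf) simp
  also have "\<dots> \<le> ennreal (C / m)"
    using bound by (intro Liminf_le) auto
  also have "\<dots> < \<infinity>" by simp
  finally have fin: "(\<integral>\<^sup>+x. ennreal (weight x) \<partial>p) < \<infinity>" .
  have "AE x in p. 0 \<le> weight x"
    using AE_p by eventually_elim (metis prod.collapse weight_nonneg)
  with fin show ?thesis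
    by (intro integrableI_nonneg) auto
qed

lemma integrable_weight_bound:
  fixes f :: "real \<times> real \<Rightarrow> real"
  assumes "f \<in> borel_measurable borel" "\<And>q1 q2. q1 \<le> 0 \<Longrightarrow> 0 < q2 \<Longrightarrow> \<bar>f (q1, q2)\<bar> \<le> C * (1 + weight (q1, q2))"
  shows "integrable p f"
proof (rule Bochner_Integration.integrable_bound)
  interpret P: prob_space p by (rule prob_space_p)
  show "integrable p (\<lambda>x. C * (1 + weight x))" using weight_integrable by simp
  show "AE x in p. norm (f x) \<le> norm (C * (1 + weight x))"
    using AE_p
  proof eventually_elim
    case (elim x)
    then show ?case using assms(2)[of "fst x" "snd x"] by (simp add: abs_le_iff)
  qed
qed (rule measurable_p[OF assms(1)])

text \<open>\<open>F\<close> itself need not have bounded sublevel sets, but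
  \<open>e * quartic\<close> plus or minus \<open>F\<close> does, because the growth of
  \<open>F\<close> is of lower order than s^4 + u^4. The truncated inequality applies to both
  combinations; dominated convergence removes the truncation, and e tending to 0 leaves both signs
  of the integral nonnegative.\<close>

lemma generator_zero:
  assumes "test_function F Fs Fss Fy"
    and growth: "\<And>q1 q2. q1 \<le> 0 \<Longrightarrow> 0 < q2 \<Longrightarrow> \<bar>F (q1 + q2) q2\<bar> \<le> C * (1 + (q1 + q2)\<^sup>2 + (- q1) ^ 3)"
    and gen: "\<And>q1 q2. q1 \<le> 0 \<Longrightarrow> 0 < q2 \<Longrightarrow> \<bar>gen \<beta> Fs Fss Fy (q1, q2)\<bar> \<le> C * (1 + weight (q1, q2))"
  shows "integrable p (gen \<beta> Fs Fss Fy)" "(\<integral>x. gen \<beta> Fs Fss Fy x \<partial>p) = 0"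
proof -
  interpret P: prob_space p by (rule prob_space_p)
  interpret F: test_function F Fs Fss Fy by fact
  interpret T: test_function quartic quartic_s quartic_ss quartic_y by (rule quartic_test_function)
  show int: "integrable p (gen \<beta> Fs Fss Fy)"
    by (rule integrable_weight_bound[OF F.measurable_gen gen])
  obtain C0 where C0: "0 \<le> C0" "\<And>q1 q2. q1 \<le> 0 \<Longrightarrow> 0 < q2 \<Longrightarrow>
    gen \<beta> quartic_s quartic_ss quartic_y (q1, q2) \<le> C0 - min (2 * \<beta>) 4 * weight (q1, q2)"
    using quartic_gen_le[OF beta] by metis
  have C: "0 \<le> C" using growth[of 0 1] by simp
  have sign: "0 \<le> e * C0 + \<sigma> * (\<integral>x. gen \<beta> Fs Fss Fy x \<partial>p)" if e: "0 < e" and \<sigma>: "\<bar>\<sigma>\<bar> = 1" for e \<sigma> :: real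
  proof -
    define V where "V = (\<lambda>s y. e * quartic s y + \<sigma> * F s y)"
    \<comment> \<open>The price of absorbing the growth of \<open>F\<close>: C for the constant, a
      completed square for s^2, and for u^3 its value at the threshold u = C / e, beyond which e u^4
      takes over.\<close>
    define A where "A = C + C\<^sup>2 / (2 * e) + C * (C / e) ^ 3"
    have A: "0 \<le> A" using C e by (simp add: A_def)
    note tf = test_function_combine[OF quartic_test_function assms(1), of e \<sigma>, folded V_def]
    interpret V: test_function V "\<lambda>s y. e * quartic_s s y + \<sigma> * Fs s y" "\<lambda>s y. e * quartic_ss s y + \<sigma> * Fss s y"
      "\<lambda>s y. e * quartic_y s y + \<sigma> * Fy s y" by (rule tf)
    have coercive: "e / 2 * (q1 + q2) ^ 4 + 2 * e * q1 ^ 4 - A \<le> V (q1 + q2) q2" if q: "q1 \<le> 0" "0 < q2" for q1 q2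
    proof -
      define s u where "s = q1 + q2" and "u = - q1"
      have u: "0 \<le> u" using q by (simp add: u_def)
      have "\<bar>\<sigma> * F s q2\<bar> \<le> C * (1 + s\<^sup>2 + u ^ 3)"
        using growth[OF q] \<sigma> by (simp add: abs_mult s_def u_def)
      also have "\<dots> = C + C * s\<^sup>2 + C * u ^ 3" by (simp add: algebra_simps)
      finally have "- (C + C * s\<^sup>2 + C * u ^ 3) \<le> \<sigma> * F s q2" by linarith
      moreover have "C * s\<^sup>2 \<le> e / 2 * s ^ 4 + C\<^sup>2 / (2 * e)"
      proof -
        have "0 \<le> (e * s\<^sup>2 - C)\<^sup>2 / (2 * e)" using e by simp
        also have "\<dots> = e / 2 * s ^ 4 + C\<^sup>2 / (2 * e) - C * s\<^sup>2"
          using e by (simp add: power2_eq_square power4_eq_xxxx field_simps)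
        finally show ?thesis by simp
      qed
      moreover have "C * u ^ 3 \<le> e * u ^ 4 + C * (C / e) ^ 3"
      proof (cases "u \<le> C / e")
        case True
        then have "C * u ^ 3 \<le> C * (C / e) ^ 3" using u C by (intro mult_left_mono power_mono) auto
        moreover have "0 \<le> e * u ^ 4" using e by simp
        ultimately show ?thesis by linarith
      next
        case False
        then have "C * u ^ 3 \<le> (e * u) * u ^ 3"
          using e u by (intro mult_right_mono) (auto simp: field_simps)
        moreover have "(e * u) * u ^ 3 = e * u ^ 4" by (simp add: power_numeral_reduce)
        moreover have "0 \<le> C * (C / e) ^ 3" using C e by simp
        ultimately show ?thesis by linarith
      qed
      moreover have "e * (s ^ 4 + 3 * u ^ 4) \<le> e * quartic s q2"
        using quartic_lower[OF q(2), of s] e by (intro mult_left_mono) (auto simp: s_def u_def)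
      moreover have "e * (s ^ 4 + 3 * u ^ 4) = e / 2 * s ^ 4 + e / 2 * s ^ 4 + 3 * (e * u ^ 4)" by (simp add: field_simps)
      ultimately have "e / 2 * s ^ 4 + 2 * e * u ^ 4 - A \<le> V s q2"
        unfolding V_def A_def by linarith
      then show ?thesis by (simp add: s_def u_def)
    qed
    have lower: "- A \<le> V (q1 + q2) q2" if "q1 \<le> 0" "0 < q2" for q1 q2
    proof -
      have "0 \<le> e / 2 * (q1 + q2) ^ 4 + 2 * e * q1 ^ 4" using e by simp
      then show ?thesis using coercive[OF that] by linarith
    qed
    define I where "I = (\<lambda>n x. of_bool (V (fst x + snd x) (snd x) \<le> real n) :: real)"
    have sub: "q2 - q1 \<le> 3 * (1 + 2 * (real n + A) / e)" if "q1 \<le> 0" "0 < q2" "V (q1 + q2) q2 \<le> real n" for q1 q2 n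
    proof -
      have nn: "0 \<le> e / 2 * (q1 + q2) ^ 4" "0 \<le> e / 2 * q1 ^ 4" using e by auto
      moreover have "e / 2 * (q1 + q2) ^ 4 + 2 * e * q1 ^ 4 \<le> real n + A"
        using coercive[OF that(1,2)] that(3) by linarith
      moreover have "2 * e * q1 ^ 4 = 4 * (e / 2 * q1 ^ 4)" by simp
      ultimately have "e / 2 * (q1 + q2) ^ 4 \<le> real n + A" "e / 2 * q1 ^ 4 \<le> real n + A" by linarith+
      then have "(q1 + q2) ^ 4 \<le> 2 * (real n + A) / e" "q1 ^ 4 \<le> 2 * (real n + A) / e"
        using e by (auto simp: field_simps)
      then show ?thesis by (rule extent_le)
    qed
    have R0: "0 \<le> 3 * (1 + 2 * (real n + A) / e)" for n using A e by auto
    have I_eq: "of_bool (V (fst x + snd x) (snd x) \<le> real n) = I n x" for n x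
      by (simp add: I_def)
    have gi: "integrable p (\<lambda>x. I n x * (e * gen \<beta> quartic_s quartic_ss quartic_y x + \<sigma> * gen \<beta> Fs Fss Fy x))"
      "0 \<le> (\<integral>x. I n x * (e * gen \<beta> quartic_s quartic_ss quartic_y x + \<sigma> * gen \<beta> Fs Fss Fy x) \<partial>p)" for n
      by (rule generator_inequality[where K = "real n", OF tf lower R0[of n] sub[of _ _ n], unfolded I_eq gen_combine]; assumption)+
    have [measurable]: "I n \<in> borel_measurable p" for n
      unfolding I_def using measurable_p[OF V.measurable_F(1)] by measurable
    have I_int: "integrable p (\<lambda>x. \<sigma> * (I n x * gen \<beta> Fs Fss Fy x))" for n
    proof (rule Bochner_Integration.integrable_bound[OF int])
      show "AE x in p. norm (\<sigma> * (I n x * gen \<beta> Fs Fss Fy x)) \<le> norm (gen \<beta> Fs Fss Fy x)"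
        using \<sigma> by (auto simp: I_def abs_mult)
    qed (use int in measurable)
    have le: "0 \<le> e * C0 + \<sigma> * (\<integral>x. I n x * gen \<beta> Fs Fss Fy x \<partial>p)" for n
    proof -
      \<comment> \<open>The quartic part is only estimated from above, by \<open>e * C0\<close>; the
        part with \<open>F\<close> is kept exactly, since it has to survive with either
        sign.\<close>
      have "(\<integral>x. I n x * (e * gen \<beta> quartic_s quartic_ss quartic_y x + \<sigma> * gen \<beta> Fs Fss Fy x) \<partial>p)
        \<le> (\<integral>x. e * C0 + \<sigma> * (I n x * gen \<beta> Fs Fss Fy x) \<partial>p)"
      proof (rule integral_mono_AE[OF gi(1)])
        show "integrable p (\<lambda>x. e * C0 + \<sigma> * (I n x * gen \<beta> Fs Fss Fy x))" using I_int by simp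
        show "AE x in p. I n x * (e * gen \<beta> quartic_s quartic_ss quartic_y x + \<sigma> * gen \<beta> Fs Fss Fy x)
          \<le> e * C0 + \<sigma> * (I n x * gen \<beta> Fs Fss Fy x)"
          using AE_p
        proof eventually_elim
          case (elim x)
          have "gen \<beta> quartic_s quartic_ss quartic_y (fst x, snd x) \<le> C0"
            using C0(2)[of "fst x" "snd x"] elim weight_nonneg[of "snd x" "fst x"] beta
            by (smt (verit) mult_nonneg_nonneg)
          then have "e * gen \<beta> quartic_s quartic_ss quartic_y x \<le> e * C0"
            using e by simp
          moreover have "0 \<le> e * C0" using e C0 by simp
          moreover have "I n x = 0 \<or> I n x = 1" by (simp add: I_def)
          ultimately show ?case by auto
        qed
      qed
      with gi(2)[of n] have "0 \<le> (\<integral>x. e * C0 + \<sigma> * (I n x * gen \<beta> Fs Fss Fy x) \<partial>p)" by linarith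
      then show ?thesis using I_int by (simp add: P.prob_space)
    qed
    have "(\<lambda>n. \<integral>x. I n x * gen \<beta> Fs Fss Fy x \<partial>p) \<longlonglongrightarrow> (\<integral>x. gen \<beta> Fs Fss Fy x \<partial>p)"
    proof (rule integral_dominated_convergence[where w = "\<lambda>x. \<bar>gen \<beta> Fs Fss Fy x\<bar>"])
      show "AE x in p. (\<lambda>n. I n x * gen \<beta> Fs Fss Fy x) \<longlonglongrightarrow> gen \<beta> Fs Fss Fy x"
      proof (rule AE_I2)
        fix x
        have "eventually (\<lambda>n. V (fst x + snd x) (snd x) \<le> real n) sequentially"
          by (rule eventually_sequentiallyI[of "nat \<lceil>V (fst x + snd x) (snd x)\<rceil>"]) linarith
        then have "eventually (\<lambda>n. I n x * gen \<beta> Fs Fss Fy x = gen \<beta> Fs Fss Fy x) sequentially"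
          by eventually_elim (simp add: I_def)
        then show "(\<lambda>n. I n x * gen \<beta> Fs Fss Fy x) \<longlonglongrightarrow> gen \<beta> Fs Fss Fy x"
          by (rule tendsto_eventually)
      qed
      have [measurable]: "gen \<beta> Fs Fss Fy \<in> borel_measurable p" using int by simp
      show "(\<lambda>x. I n x * gen \<beta> Fs Fss Fy x) \<in> borel_measurable p" for n by measurable
      show "AE x in p. norm (I n x * gen \<beta> Fs Fss Fy x) \<le> \<bar>gen \<beta> Fs Fss Fy x\<bar>" for n
        by (simp add: I_def)
    qed (use int in simp_all)
    then have "(\<lambda>n. e * C0 + \<sigma> * (\<integral>x. I n x * gen \<beta> Fs Fss Fy x \<partial>p)) \<longlonglongrightarrow> e * C0 + \<sigma> * (\<integral>x. gen \<beta> Fs Fss Fy x \<partial>p)"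
      by (intro tendsto_intros)
    from tendsto_lowerbound[OF this always_eventually[OF allI[OF le]]] show ?thesis by simp
  qed
  define G where "G = (\<integral>x. gen \<beta> Fs Fss Fy x \<partial>p)"
  have "\<bar>G\<bar> \<le> e" if "0 < e" for e
  proof -
    have e': "0 < e / (C0 + 1)" using that C0 by simp
    have "e / (C0 + 1) * C0 \<le> e" using that C0 by (simp add: field_simps)
    then show ?thesis
      using sign[OF e', of 1] sign[OF e', of "- 1"] unfolding G_def[symmetric] by (simp add: abs_le_iff)
  qed
  then have "\<bar>G\<bar> \<le> 0" by (rule field_le_epsilon) simp
  then show "(\<integral>x. gen \<beta> Fs Fss Fy x \<partial>p) = 0" by (simp add: G_def)
qed

end

section \<open>Test functions for the moment bounds and the Stein identity\<close>

lemma linear_test_function: "test_function (\<lambda>s y. s) (\<lambda>s y. 1) (\<lambda>s y. 0) (\<lambda>s y. 0)"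
  by unfold_locales (auto intro!: derivative_eq_intros)

text \<open>The third power of u = y - s, whose generator is 6u - 3u^3 + 3\<beta> u^2 - 3 u^2 y. It
  trades the exactly known mean of u for bounds on u^3 and u^2 y; the boundary derivative vanishes
  to second order.\<close>

lemma cubic_test_function:
  "test_function (\<lambda>s y. (y - s) ^ 3) (\<lambda>s y. - 3 * (y - s)\<^sup>2) (\<lambda>s y. 6 * (y - s)) (\<lambda>s y. 3 * (y - s)\<^sup>2)"
proof
  show "((\<lambda>s. (y - s) ^ 3) has_real_derivative - 3 * (y - s)\<^sup>2) (at s)" for s y :: real
    by (auto intro!: derivative_eq_intros)
  show "((\<lambda>s. - 3 * (y - s)\<^sup>2) has_real_derivative 6 * (y - s)) (at s)" for s y :: real
    by (auto intro!: derivative_eq_intros)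
  show "((\<lambda>y. (y - s) ^ 3) has_real_derivative 3 * (y - s)\<^sup>2) (at y)" for s y :: real
    by (auto intro!: derivative_eq_intros)
qed (intro loc_lip_add loc_lip_mult loc_lip_power loc_lip_diff loc_lip_const loc_lip_fst loc_lip_snd | simp)+

text \<open>An antiderivative in s of k^2 s cos (k s + a); the factor k^2 avoids division by k. The
  phase \<open>a\<close> lets one real computation cover cosine and sine, hence both parts of a
  complex exponential.\<close>

lemma trig_sum_test_function:
  "test_function (\<lambda>s y. k * s * sin (k * s + a) + cos (k * s + a)) (\<lambda>s y. k\<^sup>2 * s * cos (k * s + a))
    (\<lambda>s y. k\<^sup>2 * cos (k * s + a) - k ^ 3 * s * sin (k * s + a)) (\<lambda>s y. 0)"
proof
  show "((\<lambda>s. k * s * sin (k * s + a) + cos (k * s + a)) has_real_derivative k\<^sup>2 * s * cos (k * s + a)) (at s)" for s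
    by (auto intro!: derivative_eq_intros simp: algebra_simps power2_eq_square)
  show "((\<lambda>s. k\<^sup>2 * s * cos (k * s + a)) has_real_derivative k\<^sup>2 * cos (k * s + a) - k ^ 3 * s * sin (k * s + a)) (at s)" for s
    by (auto intro!: derivative_eq_intros simp: algebra_simps power2_eq_square power3_eq_cube)
  show "((\<lambda>y. k * s * sin (k * s + a) + cos (k * s + a)) has_real_derivative 0) (at y)" for s y :: real
    by (rule DERIV_const)
qed (intro loc_lip_add loc_lip_mult loc_lip_sin loc_lip_cos loc_lip_diff loc_lip_const loc_lip_fst loc_lip_snd | simp)+

text \<open>The corrector: its second derivative in s produces 2 cos (k y + a), and its first
  derivatives produce -2 u y cos (k y + a) up to small terms, so half its generator compares 1 with
  u y.\<close>

lemma trig_square_test_function: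
  "test_function (\<lambda>s y. (y - s)\<^sup>2 * cos (k * y + a)) (\<lambda>s y. - 2 * (y - s) * cos (k * y + a))
    (\<lambda>s y. 2 * cos (k * y + a)) (\<lambda>s y. 2 * (y - s) * cos (k * y + a) - k * (y - s)\<^sup>2 * sin (k * y + a))"
proof
  show "((\<lambda>s. (y - s)\<^sup>2 * cos (k * y + a)) has_real_derivative - 2 * (y - s) * cos (k * y + a)) (at s)" for s y
    by (auto intro!: derivative_eq_intros simp: algebra_simps)
  show "((\<lambda>s. - 2 * (y - s) * cos (k * y + a)) has_real_derivative 2 * cos (k * y + a)) (at s)" for s y
    by (auto intro!: derivative_eq_intros simp: algebra_simps)
  show "((\<lambda>y. (y - s)\<^sup>2 * cos (k * y + a)) has_real_derivative 2 * (y - s) * cos (k * y + a) - k * (y - s)\<^sup>2 * sin (k * y + a)) (at y)" for s y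
    by (auto intro!: derivative_eq_intros simp: algebra_simps)
qed (intro loc_lip_add loc_lip_mult loc_lip_power loc_lip_sin loc_lip_cos loc_lip_diff loc_lip_const loc_lip_fst loc_lip_snd | simp)+

context stationary_diffusion
begin

lemma moments_integrable:
  "integrable p (\<lambda>x. - fst x)" "integrable p (\<lambda>x. (fst x)\<^sup>2)" "integrable p (\<lambda>x. (- fst x) ^ 3)"
  "integrable p (\<lambda>x. (fst x)\<^sup>2 * snd x)" "integrable p (\<lambda>x. fst x + snd x)" "integrable p (\<lambda>x. (fst x + snd x)\<^sup>2)"
proof -
  have meas: "f \<in> borel_measurable borel" if "continuous_on UNIV f" for f :: "real \<times> real \<Rightarrow> real"
    using that by (rule borel_measurable_continuous_onI)
  note mb = monomial_bounds
  show "integrable p (\<lambda>x. - fst x)" "integrable p (\<lambda>x. (fst x)\<^sup>2)" "integrable p (\<lambda>x. (- fst x) ^ 3)"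
    using mb(4,5,6) by (auto intro!: integrable_weight_bound[where C = 1] meas continuous_intros)
  show "integrable p (\<lambda>x. (fst x)\<^sup>2 * snd x)"
    using mb(8) by (auto intro!: integrable_weight_bound[where C = 2] meas continuous_intros)
  show "integrable p (\<lambda>x. fst x + snd x)"
  proof (rule integrable_weight_bound[where C = 2])
    show "(\<lambda>x. fst x + snd x) \<in> borel_measurable (borel :: (real \<times> real) measure)"
      by (intro meas continuous_intros)
    fix q1 q2 :: real assume "q1 \<le> 0" "0 < q2"
    then show "\<bar>fst (q1, q2) + snd (q1, q2)\<bar> \<le> 2 * (1 + weight (q1, q2))"
      using mb(2,4)[of q1 q2] by auto
  qed
  show "integrable p (\<lambda>x. (fst x + snd x)\<^sup>2)"
  proof (rule integrable_weight_bound[where C = 2])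
    show "(\<lambda>x. (fst x + snd x)\<^sup>2) \<in> borel_measurable (borel :: (real \<times> real) measure)"
      by (intro meas continuous_intros)
    fix q1 q2 :: real assume q: "q1 \<le> 0" "0 < q2"
    then have "(q1 + q2)\<^sup>2 \<le> q1\<^sup>2 + q2\<^sup>2"
      by (simp add: power2_sum mult_nonpos_nonneg)
    then show "\<bar>(fst (q1, q2) + snd (q1, q2))\<^sup>2\<bar> \<le> 2 * (1 + weight (q1, q2))"
      using mb(3,5)[OF q] by auto
  qed
qed

text \<open>The linear function gives the mean exactly. The cubic one gives m3 + m21 = 2\<beta> +
  \<beta> m2. With \<beta> \<le> 1 and the interpolation 2 m2 \<le> m1 + m3 the right-hand side is
  at most 2\<beta> + (\<beta> + m3) / 2, so m3 is absorbed on the left and everything is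
  O(\<beta>).\<close>

lemma moments:
  assumes "\<beta> \<le> 1"
  shows "(\<integral>x. - fst x \<partial>p) = \<beta>" "(\<integral>x. (fst x)\<^sup>2 \<partial>p) \<le> 3 * \<beta>" "(\<integral>x. (fst x)\<^sup>2 * snd x \<partial>p) \<le> 5 * \<beta>"
proof -
  interpret P: prob_space p by (rule prob_space_p)
  note int = moments_integrable
  define m1 m2 m3 m21 where "m1 = (\<integral>x. - fst x \<partial>p)" and "m2 = (\<integral>x. (fst x)\<^sup>2 \<partial>p)"
    and "m3 = (\<integral>x. (- fst x) ^ 3 \<partial>p)" and "m21 = (\<integral>x. (fst x)\<^sup>2 * snd x \<partial>p)"
  have "(\<integral>x. gen \<beta> (\<lambda>s y. 1) (\<lambda>s y. 0) (\<lambda>s y. 0) x \<partial>p) = 0"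
  proof (rule generator_zero(2)[OF linear_test_function])
    fix q1 q2 :: real assume q: "q1 \<le> 0" "0 < q2"
    have "0 \<le> (- q1) ^ 3" using q by (intro zero_le_power) simp
    from add_increasing2[OF this abs_le_one_plus_square[of "q1 + q2"]]
    have "\<bar>q1 + q2\<bar> \<le> 1 * (1 + (q1 + q2)\<^sup>2 + (- q1) ^ 3)" by simp
    also have "\<dots> \<le> (1 + \<beta>) * (1 + (q1 + q2)\<^sup>2 + (- q1) ^ 3)"
      using beta \<open>0 \<le> (- q1) ^ 3\<close> by (intro mult_right_mono add_nonneg_nonneg) auto
    finally show "\<bar>q1 + q2\<bar> \<le> (1 + \<beta>) * (1 + (q1 + q2)\<^sup>2 + (- q1) ^ 3)" .
    define w where "w = 1 + weight (q1, q2)"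
    note mb = monomial_bounds[OF q, folded w_def]
    have "\<beta> * 1 \<le> \<beta> * w"
      using mb(1) beta by (intro mult_left_mono) auto
    then have "\<bar>- q1 - \<beta>\<bar> \<le> 1 * w + \<beta> * w"
      using mb(1,4) q beta unfolding abs_le_iff by linarith
    moreover have "gen \<beta> (\<lambda>s y. 1) (\<lambda>s y. 0) (\<lambda>s y. 0) (q1, q2) = - q1 - \<beta>"
      by (simp add: gen_def)
    ultimately show "\<bar>gen \<beta> (\<lambda>s y. 1) (\<lambda>s y. 0) (\<lambda>s y. 0) (q1, q2)\<bar> \<le> (1 + \<beta>) * (1 + weight (q1, q2))"
      by (simp only: distrib_right[of 1 \<beta>] w_def)
  qed
  moreover have "gen \<beta> (\<lambda>s y. 1) (\<lambda>s y. 0) (\<lambda>s y. 0) x = - fst x - \<beta>" for x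
    by (simp add: gen_def case_prod_beta)
  ultimately have m1: "m1 = \<beta>"
    using int(1) by (simp add: m1_def P.prob_space)
  have "(\<integral>x. gen \<beta> (\<lambda>s y. - 3 * (y - s)\<^sup>2) (\<lambda>s y. 6 * (y - s)) (\<lambda>s y. 3 * (y - s)\<^sup>2) x \<partial>p) = 0"
  proof (rule generator_zero(2)[OF cubic_test_function])
    fix q1 q2 :: real assume q: "q1 \<le> 0" "0 < q2"
    define u w where "u = - q1" and "w = 1 + weight (q1, q2)"
    note mb = monomial_bounds[OF q, folded u_def w_def]
    have u: "0 \<le> u" using q by (simp add: u_def)
    have "u ^ 3 \<le> 1 * (1 + (q1 + q2)\<^sup>2 + u ^ 3)" by simp
    also have "\<dots> \<le> (15 + 3 * \<beta>) * (1 + (q1 + q2)\<^sup>2 + u ^ 3)"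
      using u beta by (intro mult_right_mono) auto
    finally show "\<bar>(q2 - (q1 + q2)) ^ 3\<bar> \<le> (15 + 3 * \<beta>) * (1 + (q1 + q2)\<^sup>2 + (- q1) ^ 3)"
      using u by (simp add: u_def)
    have "gen \<beta> (\<lambda>s y. - 3 * (y - s)\<^sup>2) (\<lambda>s y. 6 * (y - s)) (\<lambda>s y. 3 * (y - s)\<^sup>2) (q1, q2)
      = 6 * u - 3 * u ^ 3 + 3 * (\<beta> * u\<^sup>2) - 3 * (u\<^sup>2 * q2)"
      by (simp add: gen_def u_def algebra_simps power2_eq_square power3_eq_cube)
    moreover have "\<beta> * u\<^sup>2 \<le> \<beta> * w" using mb beta by (intro mult_left_mono) auto
    moreover have "0 \<le> u ^ 3" "0 \<le> \<beta> * u\<^sup>2" "0 \<le> u\<^sup>2 * q2" using u q beta by auto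
    ultimately show "\<bar>gen \<beta> (\<lambda>s y. - 3 * (y - s)\<^sup>2) (\<lambda>s y. 6 * (y - s)) (\<lambda>s y. 3 * (y - s)\<^sup>2) (q1, q2)\<bar>
      \<le> (15 + 3 * \<beta>) * (1 + weight (q1, q2))"
      using mb u unfolding w_def[symmetric] distrib_right abs_le_iff by linarith
  qed
  moreover have "gen \<beta> (\<lambda>s y. - 3 * (y - s)\<^sup>2) (\<lambda>s y. 6 * (y - s)) (\<lambda>s y. 3 * (y - s)\<^sup>2) x
      = 6 * (- fst x) - 3 * (- fst x) ^ 3 + 3 * \<beta> * (fst x)\<^sup>2 - 3 * ((fst x)\<^sup>2 * snd x)" for x
    by (simp add: gen_def case_prod_beta algebra_simps power2_eq_square power3_eq_cube)
  moreover have "(\<integral>x. 6 * (- fst x) - 3 * (- fst x) ^ 3 + 3 * \<beta> * (fst x)\<^sup>2 - 3 * ((fst x)\<^sup>2 * snd x) \<partial>p)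
      = 6 * m1 - 3 * m3 + 3 * \<beta> * m2 - 3 * m21"
  proof -
    note hb = int(1-4)[THEN has_bochner_integral_integrable, folded m1_def m2_def m3_def m21_def]
    have "has_bochner_integral p (\<lambda>x. 6 * (- fst x) - 3 * (- fst x) ^ 3 + 3 * \<beta> * (fst x)\<^sup>2 - 3 * ((fst x)\<^sup>2 * snd x))
        (6 * m1 - 3 * m3 + 3 * \<beta> * m2 - 3 * m21)"
      by (intro has_bochner_integral_add has_bochner_integral_diff has_bochner_integral_mult_right hb)
    then show ?thesis by (rule has_bochner_integral_integral_eq)
  qed
  ultimately have m3: "m3 + m21 = 2 * \<beta> + \<beta> * m2" using m1 by simp
  have "0 \<le> m2" by (simp add: m2_def)
  moreover have "0 \<le> m3"
    unfolding m3_def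
  proof (rule integral_nonneg_AE)
    show "AE x in p. 0 \<le> (- fst x) ^ 3"
      using AE_p by eventually_elim (rule zero_le_power, simp)
  qed
  moreover have "0 \<le> m21"
    unfolding m21_def
  proof (rule integral_nonneg_AE)
    show "AE x in p. 0 \<le> (fst x)\<^sup>2 * snd x"
      using AE_p by eventually_elim simp
  qed
  ultimately have pos: "0 \<le> m2" "0 \<le> m3" "0 \<le> m21" .
  \<comment> \<open>Pointwise this is u (u - 1)^2 \<ge> 0.\<close>
  have "m2 \<le> (\<integral>x. (- fst x + (- fst x) ^ 3) / 2 \<partial>p)"
    unfolding m2_def
  proof (rule integral_mono_AE)
    show "AE x in p. (fst x)\<^sup>2 \<le> (- fst x + (- fst x) ^ 3) / 2"
      using AE_p
    proof eventually_elim
      case (elim x)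
      have "0 \<le> (- fst x) * (- fst x - 1)\<^sup>2" using elim by (intro mult_nonneg_nonneg) auto
      also have "\<dots> = - fst x + (- fst x) ^ 3 - 2 * (fst x)\<^sup>2"
        by (simp add: power2_eq_square power3_eq_cube algebra_simps)
      finally show ?case by simp
    qed
  qed (use int in auto)
  also have "\<dots> = (m1 + m3) / 2" using int(1,3) by (simp add: m1_def m3_def)
  finally have "2 * m2 \<le> m1 + m3" by simp
  moreover have "\<beta> * m2 \<le> m2" using assms pos by (simp add: mult_left_le_one_le beta less_imp_le)
  ultimately show "(\<integral>x. - fst x \<partial>p) = \<beta>" "(\<integral>x. (fst x)\<^sup>2 \<partial>p) \<le> 3 * \<beta>" "(\<integral>x. (fst x)\<^sup>2 * snd x \<partial>p) \<le> 5 * \<beta>"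
    using m1 m3 pos unfolding m1_def[symmetric] m2_def[symmetric] m21_def[symmetric] by linarith+
qed

end

section \<open>The approximate Stein identity\<close>

context stationary_diffusion
begin

text \<open>\<open>e\<close> is the Gamma(2) Stein operator X m' + (2 - X) m at X = \<beta> s for m
  x = cos (\<theta> x + a). The generator of the sum test function supplies m + X m' - X m plus u s
  m; since u s = u y - u^2, the corrector turns u s m into m up to terms controlled by
  \<open>moments\<close>.\<close>

lemma stein_trig:
  fixes a \<theta> :: real
  assumes b1: "\<beta> \<le> 1" and "\<theta> \<noteq> 0"
  defines "k \<equiv> \<theta> * \<beta>"
  defines "e \<equiv> (\<lambda>x. 2 * cos (k * (fst x + snd x) + a) - k * (fst x + snd x) * sin (k * (fst x + snd x) + a)
    - \<beta> * (fst x + snd x) * cos (k * (fst x + snd x) + a))"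
  shows "\<bar>\<integral>x. e x \<partial>p\<bar> \<le> \<beta> * (9 * \<bar>\<theta>\<bar> + 7)"
proof -
  interpret P: prob_space p by (rule prob_space_p)
  have "k \<noteq> 0" using assms beta by (simp add: k_def)
  define A where "A = gen \<beta> (\<lambda>s y. k\<^sup>2 * s * cos (k * s + a)) (\<lambda>s y. k\<^sup>2 * cos (k * s + a) - k ^ 3 * s * sin (k * s + a)) (\<lambda>s y. 0)"
  define B where "B = gen \<beta> (\<lambda>s y. - 2 * (y - s) * cos (k * y + a)) (\<lambda>s y. 2 * cos (k * y + a))
    (\<lambda>s y. 2 * (y - s) * cos (k * y + a) - k * (y - s)\<^sup>2 * sin (k * y + a))"
  have mult_le: "\<bar>x * y\<bar> \<le> c" if "\<bar>x\<bar> \<le> c" "\<bar>y\<bar> \<le> 1" for x y c :: real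
    using mult_mono[OF that] that by (simp add: abs_mult)
  have tri: "\<bar>x + y\<bar> \<le> b + c" "\<bar>x - y\<bar> \<le> b + c" if "\<bar>x\<bar> \<le> b" "\<bar>y\<bar> \<le> c" for x y b c :: real
    using that by auto
  have A_eq: "A (q1, q2) = k\<^sup>2 * cos (k * (q1 + q2) + a) - k ^ 3 * (q1 + q2) * sin (k * (q1 + q2) + a)
    + k\<^sup>2 * ((- q1 - \<beta>) * (q1 + q2)) * cos (k * (q1 + q2) + a)" for q1 q2
    by (simp add: A_def gen_def)
  have A: "integrable p A" "(\<integral>x. A x \<partial>p) = 0"
  proof -
    define C where "C = 1 + \<bar>k\<bar> + k\<^sup>2 + 2 * \<bar>k ^ 3\<bar> + k\<^sup>2 * (2 + 2 * \<beta>)"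
    have "0 \<le> \<bar>k\<bar>" "0 \<le> k\<^sup>2" "0 \<le> 2 * \<bar>k ^ 3\<bar>" "0 \<le> k\<^sup>2 * (2 + 2 * \<beta>)" using beta by auto
    then have C: "1 + \<bar>k\<bar> \<le> C" "k\<^sup>2 + 2 * \<bar>k ^ 3\<bar> + k\<^sup>2 * (2 + 2 * \<beta>) \<le> C" unfolding C_def by linarith+
    have g: "\<bar>k * (q1 + q2) * sin (k * (q1 + q2) + a) + cos (k * (q1 + q2) + a)\<bar> \<le> C * (1 + (q1 + q2)\<^sup>2 + (- q1) ^ 3)"
      if "q1 \<le> 0" "0 < q2" for q1 q2
    proof -
      define t where "t = q1 + q2"
      have 1: "\<bar>k * t * sin (k * t + a)\<bar> \<le> \<bar>k\<bar> * (1 + t\<^sup>2)"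
        by (rule mult_le) (auto simp: abs_mult intro: mult_left_mono abs_le_one_plus_square)
      have 2: "\<bar>cos (k * t + a)\<bar> \<le> 1 + t\<^sup>2"
        using abs_cos_le_one[of "k * t + a"] zero_le_power2[of t] by linarith
      note tri(1)[OF 1 2]
      also have "\<bar>k\<bar> * (1 + t\<^sup>2) + (1 + t\<^sup>2) = (1 + \<bar>k\<bar>) * (1 + t\<^sup>2)"
        by (simp add: algebra_simps)
      also have "\<dots> \<le> C * (1 + t\<^sup>2 + (- q1) ^ 3)"
      proof (rule mult_mono)
        have "0 \<le> (- q1) ^ 3" using that by (intro zero_le_power) simp
        then show "1 + t\<^sup>2 \<le> 1 + t\<^sup>2 + (- q1) ^ 3" by (simp only: le_add_same_cancel1)
        show "0 \<le> C" using C(1) by linarith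
        show "1 + \<bar>k\<bar> \<le> C" by fact
      qed simp
      finally show ?thesis by (simp add: t_def)
    qed
    have h: "\<bar>A (q1, q2)\<bar> \<le> C * (1 + weight (q1, q2))" if q: "q1 \<le> 0" "0 < q2" for q1 q2
    proof -
      define w t where "w = 1 + weight (q1, q2)" and "t = q1 + q2"
      note mb = monomial_bounds[OF q, folded w_def]
      have t: "\<bar>t\<bar> \<le> 2 * w" using mb(2,4) q by (auto simp: t_def)
      have 1: "\<bar>k\<^sup>2 * cos (k * t + a)\<bar> \<le> k\<^sup>2 * w"
        by (rule mult_le) (use mb(1) in \<open>auto simp: mult_le_cancel_left1\<close>)
      have 2: "\<bar>k ^ 3 * t * sin (k * t + a)\<bar> \<le> 2 * \<bar>k ^ 3\<bar> * w"
      proof (rule mult_le)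
        show "\<bar>k ^ 3 * t\<bar> \<le> 2 * \<bar>k ^ 3\<bar> * w"
          using mult_left_mono[OF t, of "\<bar>k ^ 3\<bar>"] by (simp add: abs_mult mult_ac)
      qed simp
      have 3: "\<bar>k\<^sup>2 * ((- q1 - \<beta>) * t) * cos (k * t + a)\<bar> \<le> k\<^sup>2 * (2 + 2 * \<beta>) * w"
      proof (rule mult_le)
        have "\<bar>(- q1) * t\<bar> \<le> 2 * w"
        proof -
          have "(- q1) * t = (- q1) * q2 - q1\<^sup>2" by (simp add: t_def power2_eq_square algebra_simps)
          then show ?thesis
            using mb(5,7) q zero_le_power2[of q1] mult_nonneg_nonneg[of "- q1" q2]
            unfolding abs_le_iff power2_minus by linarith
        qed
        moreover have "\<bar>\<beta> * t\<bar> \<le> 2 * (\<beta> * w)"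
          using mult_left_mono[OF t, of \<beta>] beta by (simp add: abs_mult)
        moreover have "(- q1 - \<beta>) * t = (- q1) * t - \<beta> * t" by (simp add: algebra_simps)
        ultimately have "\<bar>(- q1 - \<beta>) * t\<bar> \<le> 2 * w + 2 * (\<beta> * w)"
          using tri(2) by metis
        also have "\<dots> = (2 + 2 * \<beta>) * w" by (simp add: algebra_simps)
        finally have "\<bar>(- q1 - \<beta>) * t\<bar> \<le> (2 + 2 * \<beta>) * w" .
        then have "k\<^sup>2 * \<bar>(- q1 - \<beta>) * t\<bar> \<le> k\<^sup>2 * ((2 + 2 * \<beta>) * w)"
          by (rule mult_left_mono) simp
        then show "\<bar>k\<^sup>2 * ((- q1 - \<beta>) * t)\<bar> \<le> k\<^sup>2 * (2 + 2 * \<beta>) * w"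
          by (simp add: abs_mult mult.assoc)
      qed simp
      have "\<bar>A (q1, q2)\<bar> \<le> (k\<^sup>2 + 2 * \<bar>k ^ 3\<bar> + k\<^sup>2 * (2 + 2 * \<beta>)) * w"
        unfolding A_eq t_def[symmetric] distrib_right[of _ _ w] by (intro tri 1 2 3[unfolded distrib_right])
      also have "\<dots> \<le> C * w"
        using C mb(1) by (intro mult_right_mono) auto
      finally show ?thesis by (simp add: w_def)
    qed
    show "integrable p A" "(\<integral>x. A x \<partial>p) = 0"
      using generator_zero[OF trig_sum_test_function g h[unfolded A_def]] unfolding A_def by blast+
  qed
  have B_eq: "B (q1, q2) = 2 * cos (k * q2 + a) + (2 * (- \<beta> * q1 - q1\<^sup>2 + q1 * q2)) * cos (k * q2 + a)
    + (k * (q1\<^sup>2 * q2)) * sin (k * q2 + a)" for q1 q2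
    by (simp add: B_def gen_def algebra_simps power2_eq_square)
  have B: "integrable p B" "(\<integral>x. B x \<partial>p) = 0"
  proof -
    define C where "C = 6 + 2 * \<beta> + 2 * \<bar>k\<bar>"
    have C: "1 \<le> C" using beta by (simp add: C_def)
    have g: "\<bar>(q2 - (q1 + q2))\<^sup>2 * cos (k * q2 + a)\<bar> \<le> C * (1 + (q1 + q2)\<^sup>2 + (- q1) ^ 3)" if "q1 \<le> 0" "0 < q2" for q1 q2
    proof -
      define u where "u = - q1"
      have u: "0 \<le> u" using that by (simp add: u_def)
      have "u\<^sup>2 \<le> 1 + u ^ 3" using u by (rule power_le_one_plus_power) simp
      then have "\<bar>u\<^sup>2 * cos (k * q2 + a)\<bar> \<le> 1 + u ^ 3"
        by - (rule mult_le, auto)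
      also have "\<dots> \<le> 1 * (1 + (q1 + q2)\<^sup>2 + u ^ 3)" by simp
      also have "\<dots> \<le> C * (1 + (q1 + q2)\<^sup>2 + u ^ 3)"
        using C u by (intro mult_right_mono add_nonneg_nonneg) auto
      finally show ?thesis by (simp add: u_def)
    qed
    have h: "\<bar>B (q1, q2)\<bar> \<le> C * (1 + weight (q1, q2))" if q: "q1 \<le> 0" "0 < q2" for q1 q2
    proof -
      define w where "w = 1 + weight (q1, q2)"
      note mb = monomial_bounds[OF q, folded w_def]
      have 1: "\<bar>2 * cos (k * q2 + a)\<bar> \<le> 2 * w"
        using abs_cos_le_one[of "k * q2 + a"] mb(1) unfolding abs_mult by linarith
      have 2: "\<bar>(2 * (- \<beta> * q1 - q1\<^sup>2 + q1 * q2)) * cos (k * q2 + a)\<bar> \<le> (4 + 2 * \<beta>) * w"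
      proof (rule mult_le)
        define x1 x2 x3 where "x1 = \<beta> * (- q1)" and "x2 = q1\<^sup>2" and "x3 = (- q1) * q2"
        have "0 \<le> x1" unfolding x1_def using beta q by (intro mult_nonneg_nonneg) auto
        moreover have "x1 \<le> \<beta> * w" unfolding x1_def using mb(4) beta by (intro mult_left_mono) auto
        moreover have "0 \<le> x3" unfolding x3_def using q by (intro mult_nonneg_nonneg) auto
        moreover have "0 \<le> x2" "x2 \<le> w" "x3 \<le> w" using mb(5,7) by (auto simp: x2_def x3_def)
        ultimately have "\<bar>2 * (x1 - x2 - x3)\<bar> \<le> 4 * w + 2 * (\<beta> * w)" by auto
        then show "\<bar>2 * (- \<beta> * q1 - q1\<^sup>2 + q1 * q2)\<bar> \<le> (4 + 2 * \<beta>) * w"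
          by (simp add: x1_def x2_def x3_def distrib_right mult.assoc)
      qed simp
      have 3: "\<bar>(k * (q1\<^sup>2 * q2)) * sin (k * q2 + a)\<bar> \<le> 2 * \<bar>k\<bar> * w"
      proof (rule mult_le)
        have "\<bar>k\<bar> * (q1\<^sup>2 * q2) \<le> \<bar>k\<bar> * (2 * w)" using mb(8) by (intro mult_left_mono) auto
        then show "\<bar>k * (q1\<^sup>2 * q2)\<bar> \<le> 2 * \<bar>k\<bar> * w" using q by (simp add: abs_mult)
      qed simp
      have "\<bar>B (q1, q2)\<bar> \<le> 2 * w + (4 + 2 * \<beta>) * w + 2 * \<bar>k\<bar> * w"
        unfolding B_eq by (intro tri 1 2 3)
      also have "\<dots> = C * w" by (simp add: C_def algebra_simps)
      finally show ?thesis by (simp add: w_def)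
    qed
    show "integrable p B" "(\<integral>x. B x \<partial>p) = 0"
      using generator_zero[OF trig_square_test_function g h[unfolded B_def]] unfolding B_def by blast+
  qed
  \<comment> \<open>\<open>A\<close> and \<open>B\<close> integrate to 0, so \<open>e\<close> and
    the remainder \<open>r\<close> have the same integral. The divisors undo the factor k^2 of the
    first test function and the 2 produced by the square.\<close>
  define r where "r = (\<lambda>x. e x - A x / k\<^sup>2 - B x / 2)"
  define R where "R = (\<lambda>x. \<bar>k\<bar> * (- fst x) + (3 / 2 * \<bar>k\<bar>) * ((fst x)\<^sup>2 * snd x) + 2 * (fst x)\<^sup>2 + \<beta> * (- fst x))"
  have r_le: "AE x in p. \<bar>r x\<bar> \<le> R x"
    using AE_p
  proof eventually_elim
    case (elim x)
    define u y s cs cy where "u = - fst x" and "y = snd x" and "s = fst x + snd x"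
      and "cs = cos (k * s + a)" and "cy = cos (k * y + a)"
    have uy: "0 \<le> u" "0 < y" "s = y - u" using elim by (auto simp: u_def y_def s_def)
    have "A x = k\<^sup>2 * (cs - k * s * sin (k * s + a) + (u - \<beta>) * s * cs)"
      using A_eq[of "fst x" "snd x"]
      by (simp add: u_def s_def cs_def algebra_simps power2_eq_square power3_eq_cube)
    then have "A x / k\<^sup>2 = cs - k * s * sin (k * s + a) + (u - \<beta>) * s * cs"
      using \<open>k \<noteq> 0\<close> by simp
    moreover have "B x / 2 = cy + (\<beta> * u - u\<^sup>2 - u * y) * cy + k * (u\<^sup>2 * y) * sin (k * y + a) / 2"
      using B_eq[of "fst x" "snd x"]
      by (simp add: u_def y_def cy_def algebra_simps)
    moreover have "e x = 2 * cs - k * s * sin (k * s + a) - \<beta> * s * cs"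
      by (simp add: e_def s_def cs_def)
    \<comment> \<open>The term u y is multiplied by cs in one generator and by cy in the other. The
      mismatch cs - cy is at most |k| u, which turns u y into |k| u^2 y, of expectation
      O(\<beta>).\<close>
    ultimately have r_eq: "r x = (cs - cy) * (1 - u * y) + u\<^sup>2 * cs + (u\<^sup>2 - \<beta> * u) * cy - k * (u\<^sup>2 * y) / 2 * sin (k * y + a)"
      unfolding r_def uy(3) by (simp add: algebra_simps power2_eq_square)
    have 1: "\<bar>(cs - cy) * (1 - u * y)\<bar> \<le> (\<bar>k\<bar> * u) * (1 + u * y)"
    proof -
      have "\<bar>cs - cy\<bar> \<le> \<bar>(k * s + a) - (k * y + a)\<bar>" unfolding cs_def cy_def by (rule abs_cos_diff_le)
      also have "(k * s + a) - (k * y + a) = k * (- u)" by (simp add: uy(3) algebra_simps)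
      finally have "\<bar>cs - cy\<bar> \<le> \<bar>k\<bar> * u" using uy by (simp add: abs_mult)
      moreover have "\<bar>1 - u * y\<bar> \<le> 1 + u * y" using uy mult_nonneg_nonneg[of u y] by (auto simp: abs_le_iff)
      ultimately show ?thesis unfolding abs_mult using uy by (intro mult_mono) auto
    qed
    have 2: "\<bar>u\<^sup>2 * cs\<bar> \<le> u\<^sup>2" by (rule mult_le) (auto simp: cs_def)
    have 3: "\<bar>(u\<^sup>2 - \<beta> * u) * cy\<bar> \<le> u\<^sup>2 + \<beta> * u"
    proof (rule mult_le)
      show "\<bar>u\<^sup>2 - \<beta> * u\<bar> \<le> u\<^sup>2 + \<beta> * u" using uy beta by (auto simp: abs_le_iff)
    qed (simp add: cy_def)
    have 4: "\<bar>k * (u\<^sup>2 * y) / 2 * sin (k * y + a)\<bar> \<le> \<bar>k\<bar> * (u\<^sup>2 * y) / 2"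
    proof (rule mult_le)
      show "\<bar>k * (u\<^sup>2 * y) / 2\<bar> \<le> \<bar>k\<bar> * (u\<^sup>2 * y) / 2"
        using uy by (simp add: abs_mult)
    qed simp
    have "\<bar>r x\<bar> \<le> (\<bar>k\<bar> * u) * (1 + u * y) + u\<^sup>2 + (u\<^sup>2 + \<beta> * u) + \<bar>k\<bar> * (u\<^sup>2 * y) / 2"
      unfolding r_eq by (intro tri 1 2 3 4)
    also have "\<dots> = R x"
      by (simp add: R_def u_def y_def algebra_simps power2_eq_square)
    finally show ?case .
  qed
  note int = moments_integrable
  have R_int: "integrable p R" unfolding R_def using int(1,2,4) by (intro Bochner_Integration.integrable_add integrable_mult_right)
  have e_meas: "e \<in> borel_measurable p"
    unfolding e_def by (intro measurable_p borel_measurable_continuous_onI continuous_intros)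
  have r_int: "integrable p r"
  proof (rule Bochner_Integration.integrable_bound[OF R_int])
    show "r \<in> borel_measurable p" unfolding r_def using e_meas A(1) B(1) by measurable
    show "AE x in p. norm (r x) \<le> norm (R x)" using r_le by eventually_elim simp
  qed
  have "has_bochner_integral p (\<lambda>x. r x + A x / k\<^sup>2 + B x / 2) ((\<integral>x. r x \<partial>p) + 0 / k\<^sup>2 + 0 / 2)"
    using r_int A B
    by (intro has_bochner_integral_add has_bochner_integral_divide_zero) (auto simp: has_bochner_integral_iff)
  then have "(\<integral>x. e x \<partial>p) = (\<integral>x. r x \<partial>p)"
    by (simp add: r_def has_bochner_integral_iff)
  then have "\<bar>\<integral>x. e x \<partial>p\<bar> \<le> (\<integral>x. \<bar>r x\<bar> \<partial>p)" by simp
  also have "\<dots> \<le> (\<integral>x. R x \<partial>p)"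
    using r_le r_int R_int by (intro integral_mono_AE) auto
  also have "\<dots> = \<bar>k\<bar> * (\<integral>x. - fst x \<partial>p) + (3 / 2 * \<bar>k\<bar>) * (\<integral>x. (fst x)\<^sup>2 * snd x \<partial>p) + 2 * (\<integral>x. (fst x)\<^sup>2 \<partial>p) + \<beta> * (\<integral>x. - fst x \<partial>p)"
    unfolding R_def using int(1,2,4)[THEN has_bochner_integral_integrable]
    by (intro has_bochner_integral_integral_eq has_bochner_integral_add has_bochner_integral_mult_right)
  also have "\<dots> \<le> \<bar>k\<bar> * \<beta> + (3 / 2 * \<bar>k\<bar>) * (5 * \<beta>) + 2 * (3 * \<beta>) + \<beta> * \<beta>"
    unfolding moments(1)[OF b1] using moments(2,3)[OF b1] beta by (intro add_mono mult_left_mono) auto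
  \<comment> \<open>17/2 collects 1 from the mean of u and 15/2 from u^2 y; 6 comes from
    u^2.\<close>
  also have "\<dots> = \<beta> * (17 / 2 * \<bar>k\<bar> + 6 + \<beta>)" by (simp add: algebra_simps)
  also have "\<dots> \<le> \<beta> * (9 * \<bar>\<theta>\<bar> + 7)"
  proof (intro mult_left_mono)
    have "\<bar>k\<bar> \<le> \<bar>\<theta>\<bar>" using b1 beta by (simp add: k_def abs_mult mult_left_le)
    then show "17 / 2 * \<bar>k\<bar> + 6 + \<beta> \<le> 9 * \<bar>\<theta>\<bar> + 7" using b1 abs_ge_zero[of \<theta>] by linarith
  qed (use beta in simp)
  finally show ?thesis .
qed

end

section \<open>Characteristic functions\<close>

lemma iexp_expansion: "cmod (iexp x - 1 - \<i> * x) \<le> x\<^sup>2 / 2"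
proof -
  have "(\<Sum>k\<le>1. (\<i> * complex_of_real x) ^ k / fact k) = 1 + \<i> * x" by simp
  then show ?thesis
    using iexp_approx1[of x 1] by (simp add: diff_diff_eq fact_numeral power2_eq_square numeral_2_eq_2)
qed

text \<open>The second moment makes the error of linearisation explicitly quadratic in the increment
  of t, so the derivative can be read off directly.\<close>

lemma has_vector_derivative_iexp_integral:
  fixes X :: "'a \<Rightarrow> real"
  assumes "prob_space M" and X: "integrable M X" and X2: "integrable M (\<lambda>x. (X x)\<^sup>2)"
  shows "((\<lambda>t. CLINT x|M. iexp (t * X x)) has_vector_derivative (CLINT x|M. \<i> * X x * iexp (t * X x))) (at t)"
proof -
  interpret prob_space M by fact
  have [measurable]: "X \<in> borel_measurable M" using X by auto
  have int: "integrable M (\<lambda>x. iexp (s * X x))" for s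
    by (rule integrable_const_bound[of _ 1]) auto
  have int': "integrable M (\<lambda>x. \<i> * X x * iexp (t * X x))"
    by (rule Bochner_Integration.integrable_bound[OF X]) (auto simp: norm_mult)
  define \<psi> where "\<psi> = (CLINT x|M. \<i> * X x * iexp (t * X x))"
  define m where "m = (\<integral>x. (X x)\<^sup>2 \<partial>M)"
  have m: "0 \<le> m" by (simp add: m_def)
  have bound: "cmod ((CLINT x|M. iexp (s * X x)) - (CLINT x|M. iexp (t * X x)) - (s - t) *\<^sub>R \<psi>) \<le> (s - t)\<^sup>2 * m / 2" for s
  proof -
    have "(CLINT x|M. iexp (s * X x)) - (CLINT x|M. iexp (t * X x)) - (s - t) *\<^sub>R \<psi>
      = (CLINT x|M. iexp (s * X x) - iexp (t * X x) - (s - t) *\<^sub>R (\<i> * X x * iexp (t * X x)))"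
      unfolding \<psi>_def using int int' by simp
    also have "cmod \<dots> \<le> (\<integral>x. (s - t)\<^sup>2 * (X x)\<^sup>2 / 2 \<partial>M)"
    proof (rule order_trans[OF integral_norm_bound integral_mono])
      show "integrable M (\<lambda>x. cmod (iexp (s * X x) - iexp (t * X x) - (s - t) *\<^sub>R (\<i> * X x * iexp (t * X x))))"
        using int int' by simp
      show "integrable M (\<lambda>x. (s - t)\<^sup>2 * (X x)\<^sup>2 / 2)" using X2 by simp
      fix x
      have "iexp (s * X x) - iexp (t * X x) - (s - t) *\<^sub>R (\<i> * X x * iexp (t * X x))
        = iexp (t * X x) * (iexp ((s - t) * X x) - 1 - \<i> * ((s - t) * X x))"
        by (simp add: algebra_simps scaleR_conv_of_real flip: exp_add)
      then show "cmod (iexp (s * X x) - iexp (t * X x) - (s - t) *\<^sub>R (\<i> * X x * iexp (t * X x))) \<le> (s - t)\<^sup>2 * (X x)\<^sup>2 / 2"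
        using iexp_expansion[of "(s - t) * X x"] by (simp add: norm_mult power_mult_distrib)
    qed
    also have "\<dots> = (s - t)\<^sup>2 * m / 2" using X2 by (simp add: m_def)
    finally show ?thesis .
  qed
  show ?thesis
    unfolding has_vector_derivative_def \<psi>_def[symmetric]
  proof (rule has_derivativeI_sandwich[where e = 1 and H = "\<lambda>s. \<bar>s - t\<bar> * m / 2"])
    show "bounded_linear (\<lambda>x. x *\<^sub>R \<psi>)" by (rule bounded_linear_scaleR_left)
    fix s assume "s \<noteq> t"
    have "cmod ((CLINT x|M. iexp (s * X x)) - (CLINT x|M. iexp (t * X x)) - (s - t) *\<^sub>R \<psi>) / norm (s - t)
      \<le> ((s - t)\<^sup>2 * m / 2) / norm (s - t)"
      by (intro divide_right_mono bound) simp
    also have "\<dots> = \<bar>s - t\<bar> * m / 2"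
      using \<open>s \<noteq> t\<close> by (simp add: power2_eq_square field_simps flip: power2_abs)
    finally show "cmod ((CLINT x|M. iexp (s * X x)) - (CLINT x|M. iexp (t * X x)) - (s - t) *\<^sub>R \<psi>) / norm (s - t)
      \<le> \<bar>s - t\<bar> * m / 2" .
  next
    have "((\<lambda>s. \<bar>s - t\<bar> * m / 2) \<longlongrightarrow> \<bar>t - t\<bar> * m / 2) (at t)" by (intro tendsto_intros) auto
    then show "((\<lambda>s. \<bar>s - t\<bar> * m / 2) \<longlongrightarrow> 0) (at t)" by simp
  qed simp
qed

context stationary_diffusion
begin

text \<open>For m x = exp (\<i> \<theta> x) the Stein operator becomes 2 m - (1 - \<i> \<theta>) X
  m. Its real and imaginary parts are the cosine identity with phases 0 and -pi/2, and adding the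
  two bounds gives the factor 2.\<close>

lemma char_stein:
  assumes b1: "\<beta> \<le> 1" and "\<theta> \<noteq> 0"
  defines "X \<equiv> (\<lambda>x. \<beta> * (fst x + snd x))"
  shows "cmod (2 * (CLINT x|p. iexp (\<theta> * X x)) - (1 - \<i> * \<theta>) * (CLINT x|p. X x * iexp (\<theta> * X x)))
    \<le> 2 * (\<beta> * (9 * \<bar>\<theta>\<bar> + 7))"
proof -
  interpret P: prob_space p by (rule prob_space_p)
  define E where "E = (\<lambda>a x. 2 * cos (\<theta> * \<beta> * (fst x + snd x) + a) - \<theta> * \<beta> * (fst x + snd x) * sin (\<theta> * \<beta> * (fst x + snd x) + a)
    - \<beta> * (fst x + snd x) * cos (\<theta> * \<beta> * (fst x + snd x) + a))"
  have X: "integrable p X" unfolding X_def using moments_integrable(5) by simp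
  have X_meas [measurable]: "X \<in> borel_measurable p" using X by auto
  have int1: "integrable p (\<lambda>x. iexp (\<theta> * X x))"
    by (rule P.integrable_const_bound[of _ 1]) auto
  have int2: "integrable p (\<lambda>x. X x * iexp (\<theta> * X x))"
    by (rule Bochner_Integration.integrable_bound[OF X]) (auto simp: norm_mult)
  define Z where "Z = (\<lambda>x. 2 * iexp (\<theta> * X x) - (1 - \<i> * \<theta>) * (X x * iexp (\<theta> * X x)))"
  have Z: "integrable p Z" unfolding Z_def using int1 int2 by simp
  have eq: "2 * (CLINT x|p. iexp (\<theta> * X x)) - (1 - \<i> * \<theta>) * (CLINT x|p. X x * iexp (\<theta> * X x)) = (CLINT x|p. Z x)"
    unfolding Z_def using int1 int2 by simp
  have e: "iexp y = Complex (cos y) (sin y)" for y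
    by (simp add: complex_eq_iff Re_exp Im_exp)
  have Re: "Re (Z x) = E 0 x" for x
    unfolding Z_def E_def X_def e by (simp add: algebra_simps)
  have shift: "cos (y + - (pi / 2)) = sin y" "sin (y + - (pi / 2)) = - cos y" for y :: real
    unfolding cos_add sin_add by simp_all
  have Im: "Im (Z x) = E (- (pi / 2)) x" for x
    unfolding Z_def E_def X_def e shift by (simp add: algebra_simps)
  have "\<bar>Re (CLINT x|p. Z x)\<bar> \<le> \<beta> * (9 * \<bar>\<theta>\<bar> + 7)"
    using stein_trig[OF b1 \<open>\<theta> \<noteq> 0\<close>, of 0] unfolding integral_Re[OF Z, symmetric] Re E_def .
  moreover have "\<bar>Im (CLINT x|p. Z x)\<bar> \<le> \<beta> * (9 * \<bar>\<theta>\<bar> + 7)"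
    using stein_trig[OF b1 \<open>\<theta> \<noteq> 0\<close>, of "- (pi / 2)"] unfolding integral_Im[OF Z, symmetric] Im E_def .
  ultimately show ?thesis
    unfolding eq using cmod_le[of "CLINT x|p. Z x"] by linarith
qed

text \<open>The integrating factor (1 - \<i> t)^2 turns the approximate equation into the statement
  that (1 - \<i> t)^2 \<phi> t is nearly constant, with value 1 at t = 0. Passing from the sum to
  \<open>q2\<close> alone costs only |\<theta>| \<beta> times the mean \<beta> of
  \<open>- q1\<close>.\<close>

lemma char_close:
  assumes b1: "\<beta> \<le> 1"
  shows "cmod (char (distr p borel (\<lambda>(q1, q2). \<beta> * q2)) \<theta> - 1 / (1 - \<i> * \<theta>)\<^sup>2)
    \<le> \<beta> * (\<bar>\<theta>\<bar> * (1 + \<bar>\<theta>\<bar>) * (2 * (9 * \<bar>\<theta>\<bar> + 7)) + \<bar>\<theta>\<bar>)"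
proof -
  interpret P: prob_space p by (rule prob_space_p)
  define X where "X = (\<lambda>x :: real \<times> real. \<beta> * (fst x + snd x))"
  define \<phi> where "\<phi> = (\<lambda>t. CLINT x|p. iexp (t * X x))"
  define \<psi> where "\<psi> = (\<lambda>t. CLINT x|p. X x * iexp (t * X x))"
  define K where "K = (1 + \<bar>\<theta>\<bar>) * (2 * (\<beta> * (9 * \<bar>\<theta>\<bar> + 7)))"
  have X: "integrable p X" "integrable p (\<lambda>x. (X x)\<^sup>2)"
    using moments_integrable(5,6) by (auto simp: X_def power_mult_distrib)
  have [measurable]: "X \<in> borel_measurable p" using X by auto
  have deriv: "(\<phi> has_vector_derivative \<i> * \<psi> t) (at t)" for t
  proof -
    have "(CLINT x|p. \<i> * X x * iexp (t * X x)) = \<i> * \<psi> t"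
      unfolding \<psi>_def by (simp add: mult.assoc)
    then show ?thesis
      using has_vector_derivative_iexp_integral[OF prob_space_p X, of t] by (simp add: \<phi>_def)
  qed
  \<comment> \<open>The segment from 0 to \<theta> is parametrised by r in [0,1], which treats both
    signs of \<theta> at once.\<close>
  define f where "f = (\<lambda>r. (1 - \<i> * complex_of_real (r * \<theta>))\<^sup>2 * \<phi> (r * \<theta>))"
  define f' where "f' = (\<lambda>r. - (\<i> * \<theta>) * ((1 - \<i> * complex_of_real (r * \<theta>)) * (2 * \<phi> (r * \<theta>) - (1 - \<i> * complex_of_real (r * \<theta>)) * \<psi> (r * \<theta>))))"
  have f: "(f has_vector_derivative f' r) (at r)" for r
  proof -
    have 1: "((\<lambda>r. \<phi> (r * \<theta>)) has_vector_derivative \<theta> *\<^sub>R (\<i> * \<psi> (r * \<theta>))) (at r)"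
    proof -
      have "((\<lambda>r. r * \<theta>) has_vector_derivative \<theta>) (at r)"
        unfolding has_real_derivative_iff_has_vector_derivative[symmetric] by (auto intro!: derivative_eq_intros)
      from vector_diff_chain_at[OF this deriv] show ?thesis by (simp add: comp_def)
    qed
    have 2: "((\<lambda>r. (1 - \<i> * complex_of_real (r * \<theta>))\<^sup>2) has_vector_derivative
        2 * (1 - \<i> * complex_of_real (r * \<theta>)) * (- \<i> * \<theta>)) (at r)"
    proof -
      have "((\<lambda>z. (1 - \<i> * (z * complex_of_real \<theta>))\<^sup>2) has_field_derivative
        2 * (1 - \<i> * (complex_of_real r * \<theta>)) * (- \<i> * \<theta>)) (at (complex_of_real r))"
        by (auto intro!: derivative_eq_intros)
      from has_vector_derivative_real_field[OF this] show ?thesis by simp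
    qed
    have "(f has_vector_derivative ((1 - \<i> * complex_of_real (r * \<theta>))\<^sup>2 * (\<theta> *\<^sub>R (\<i> * \<psi> (r * \<theta>)))
      + 2 * (1 - \<i> * complex_of_real (r * \<theta>)) * (- \<i> * \<theta>) * \<phi> (r * \<theta>))) (at r)"
      unfolding f_def by (rule has_vector_derivative_mult[OF 2 1])
    moreover have "(1 - \<i> * complex_of_real (r * \<theta>))\<^sup>2 * (\<theta> *\<^sub>R (\<i> * \<psi> (r * \<theta>)))
      + 2 * (1 - \<i> * complex_of_real (r * \<theta>)) * (- \<i> * \<theta>) * \<phi> (r * \<theta>) = f' r"
      unfolding f'_def by (simp add: scaleR_conv_of_real algebra_simps power2_eq_square)
    ultimately show ?thesis by simp
  qed
  have one_minus: "cmod (1 - \<i> * complex_of_real t) \<le> 1 + \<bar>t\<bar>" "1 \<le> cmod (1 - \<i> * complex_of_real t)" for t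
  proof -
    show "cmod (1 - \<i> * complex_of_real t) \<le> 1 + \<bar>t\<bar>"
      using norm_triangle_ineq4[of 1 "\<i> * complex_of_real t"] by (simp add: norm_mult)
    show "1 \<le> cmod (1 - \<i> * complex_of_real t)"
      using abs_Re_le_cmod[of "1 - \<i> * complex_of_real t"] by simp
  qed
  \<comment> \<open>\<open>char_stein\<close> requires a nonzero frequency; the interior of the
    segment suffices for the mean value inequality, and for \<theta> = 0 the derivative is
    0.\<close>
  have f'_le: "cmod (f' r) \<le> \<bar>\<theta>\<bar> * K" if "0 < r" "r < 1" for r
  proof (cases "\<theta> = 0")
    case False
    have rt: "\<bar>r * \<theta>\<bar> \<le> \<bar>\<theta>\<bar>" using that by (simp add: abs_mult mult_left_le_one_le)
    have "cmod (2 * \<phi> (r * \<theta>) - (1 - \<i> * complex_of_real (r * \<theta>)) * \<psi> (r * \<theta>)) \<le> 2 * (\<beta> * (9 * \<bar>r * \<theta>\<bar> + 7))"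
      unfolding \<phi>_def \<psi>_def X_def using False that by (intro char_stein b1) auto
    also have "\<dots> \<le> 2 * (\<beta> * (9 * \<bar>\<theta>\<bar> + 7))"
      using rt beta by (intro mult_left_mono add_right_mono) auto
    finally have "cmod (1 - \<i> * complex_of_real (r * \<theta>)) * cmod (2 * \<phi> (r * \<theta>) - (1 - \<i> * complex_of_real (r * \<theta>)) * \<psi> (r * \<theta>)) \<le> K"
      unfolding K_def using order_trans[OF one_minus(1)[of "r * \<theta>"]] rt by (intro mult_mono) auto
    then show ?thesis
      unfolding f'_def norm_mult by (intro mult_mono) (auto simp: norm_mult)
  qed (simp add: f'_def)
  have "norm (f 1 - f 0) \<le> (\<lambda>r. r * (\<bar>\<theta>\<bar> * K)) 1 - (\<lambda>r. r * (\<bar>\<theta>\<bar> * K)) 0"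
  proof (rule differentiable_bound_general[where f' = f' and \<phi>' = "\<lambda>r. \<bar>\<theta>\<bar> * K"])
    show "continuous_on {0..1} f"
      using f by (intro continuous_at_imp_continuous_on ballI) (blast intro: has_vector_derivative_continuous)
    show "((\<lambda>r. r * (\<bar>\<theta>\<bar> * K)) has_vector_derivative \<bar>\<theta>\<bar> * K) (at x)" for x
      unfolding has_real_derivative_iff_has_vector_derivative[symmetric] by (auto intro!: derivative_eq_intros)
  qed (use f f'_le in \<open>auto intro!: continuous_intros\<close>)
  moreover have "f 0 = 1" by (simp add: f_def \<phi>_def P.prob_space)
  ultimately have main: "cmod ((1 - \<i> * \<theta>)\<^sup>2 * \<phi> \<theta> - 1) \<le> \<bar>\<theta>\<bar> * K" by (simp add: f_def)
  have nz: "1 - \<i> * complex_of_real \<theta> \<noteq> 0" using one_minus(2)[of \<theta>] by auto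
  have "\<phi> \<theta> - 1 / (1 - \<i> * \<theta>)\<^sup>2 = ((1 - \<i> * \<theta>)\<^sup>2 * \<phi> \<theta> - 1) / (1 - \<i> * \<theta>)\<^sup>2"
    using nz by (simp add: field_simps)
  then have "cmod (\<phi> \<theta> - 1 / (1 - \<i> * \<theta>)\<^sup>2) = cmod ((1 - \<i> * \<theta>)\<^sup>2 * \<phi> \<theta> - 1) / cmod (1 - \<i> * \<theta>) ^ 2"
    by (simp add: norm_divide norm_power)
  \<comment> \<open>The modulus of 1 - \<i> \<theta> is at least 1, so dividing by its square does
    not enlarge the error.\<close>
  also have "\<dots> \<le> cmod ((1 - \<i> * \<theta>)\<^sup>2 * \<phi> \<theta> - 1)"
  proof -
    have "1 \<le> cmod (1 - \<i> * \<theta>) ^ 2" using one_minus(2)[of \<theta>] by (rule one_le_power)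
    then show ?thesis
      using divide_left_mono[of 1 "cmod (1 - \<i> * \<theta>) ^ 2" "cmod ((1 - \<i> * \<theta>)\<^sup>2 * \<phi> \<theta> - 1)"] by simp
  qed
  also have "\<dots> \<le> \<bar>\<theta>\<bar> * K" by (rule main)
  finally have 1: "cmod (\<phi> \<theta> - 1 / (1 - \<i> * \<theta>)\<^sup>2) \<le> \<bar>\<theta>\<bar> * K" .
  have snd_meas: "(\<lambda>x. \<beta> * snd x) \<in> borel_measurable (borel :: (real \<times> real) measure)"
    by (intro borel_measurable_continuous_onI continuous_intros)
  then have [measurable]: "(\<lambda>x. \<beta> * snd x) \<in> borel_measurable p" by (rule measurable_p)
  have char: "char (distr p borel (\<lambda>(q1, q2). \<beta> * q2)) \<theta> = (CLINT x|p. iexp (\<theta> * (\<beta> * snd x)))"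
    unfolding char_def case_prod_beta by (subst integral_distr) auto
  have i1: "integrable p (\<lambda>x. iexp (\<theta> * (\<beta> * snd x)))" "integrable p (\<lambda>x. iexp (\<theta> * X x))"
  proof -
    have "integrable p (\<lambda>x. iexp (\<theta> * Y x))" if [measurable]: "Y \<in> borel_measurable p" for Y
      by (rule P.integrable_const_bound[of _ 1]) auto
    from this[of "\<lambda>x. \<beta> * snd x"] this[of X]
    show "integrable p (\<lambda>x. iexp (\<theta> * (\<beta> * snd x)))" "integrable p (\<lambda>x. iexp (\<theta> * X x))"
      by simp_all
  qed
  have "cmod (char (distr p borel (\<lambda>(q1, q2). \<beta> * q2)) \<theta> - \<phi> \<theta>) = cmod (CLINT x|p. iexp (\<theta> * (\<beta> * snd x)) - iexp (\<theta> * X x))"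
    unfolding char \<phi>_def using i1 by simp
  also have "\<dots> \<le> (\<integral>x. cmod (iexp (\<theta> * (\<beta> * snd x)) - iexp (\<theta> * X x)) \<partial>p)"
    by (rule integral_norm_bound)
  also have "\<dots> \<le> (\<integral>x. \<bar>\<theta>\<bar> * \<beta> * (- fst x) \<partial>p)"
  proof (rule integral_mono_AE)
    show "integrable p (\<lambda>x. cmod (iexp (\<theta> * (\<beta> * snd x)) - iexp (\<theta> * X x)))"
      using i1 by (intro integrable_norm Bochner_Integration.integrable_diff)
    show "integrable p (\<lambda>x. \<bar>\<theta>\<bar> * \<beta> * (- fst x))" using moments_integrable(1) by (intro integrable_mult_right)
    show "AE x in p. cmod (iexp (\<theta> * (\<beta> * snd x)) - iexp (\<theta> * X x)) \<le> \<bar>\<theta>\<bar> * \<beta> * (- fst x)"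
      using AE_p
    proof eventually_elim
      case (elim x)
      define a d where "a = \<theta> * X x" and "d = - (\<theta> * \<beta> * fst x)"
      have eq: "iexp (\<theta> * (\<beta> * snd x)) = iexp a * iexp d"
        by (simp add: a_def d_def X_def algebra_simps flip: exp_add)
      have "cmod (iexp d - 1) \<le> \<bar>d\<bar>"
        using iexp_approx1[of d 0] by simp
      moreover have "iexp (\<theta> * (\<beta> * snd x)) - iexp a = iexp a * (iexp d - 1)"
        unfolding eq by (simp add: algebra_simps)
      ultimately have "cmod (iexp (\<theta> * (\<beta> * snd x)) - iexp a) \<le> \<bar>d\<bar>" by (simp add: norm_mult)
      also have "\<bar>d\<bar> = \<bar>\<theta>\<bar> * \<beta> * (- fst x)" using elim beta by (simp add: d_def abs_mult)
      finally show ?case by (simp add: a_def)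
    qed
  qed
  also have "\<dots> = \<bar>\<theta>\<bar> * \<beta> * \<beta>" using moments(1)[OF b1] by (subst integral_mult_right_zero) simp
  also have "\<dots> \<le> \<beta> * \<bar>\<theta>\<bar>" using mult_left_mono[OF b1, of "\<bar>\<theta>\<bar> * \<beta>"] beta by (simp add: mult_ac)
  finally have 2: "cmod (char (distr p borel (\<lambda>(q1, q2). \<beta> * q2)) \<theta> - \<phi> \<theta>) \<le> \<beta> * \<bar>\<theta>\<bar>" .
  have "\<beta> * (\<bar>\<theta>\<bar> * (1 + \<bar>\<theta>\<bar>) * (2 * (9 * \<bar>\<theta>\<bar> + 7)) + \<bar>\<theta>\<bar>) = \<bar>\<theta>\<bar> * K + \<beta> * \<bar>\<theta>\<bar>"
    by (simp add: K_def algebra_simps)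
  then show ?thesis
    using norm_triangle_mono[OF 2 1] by simp
qed

lemma real_distribution_scaled: "real_distribution (distr p borel (\<lambda>(q1, q2). \<beta> * q2))"
proof -
  interpret P: prob_space p by (rule prob_space_p)
  have "(\<lambda>x. \<beta> * snd x) \<in> borel_measurable p"
    by (intro measurable_p borel_measurable_continuous_onI continuous_intros)
  then show ?thesis
    unfolding case_prod_beta by (rule P.real_distribution_distr)
qed

end

text \<open>The shape argument of \<open>erlang_density\<close> is shifted by one:
  \<open>erlang_density k\<close> is the law of a sum of k + 1 exponentials, so the first argument 1
  means Gamma(2).\<close>

lemma gamma2_eq_erlang: "density lborel (\<lambda>x. ennreal (if 0 \<le> x then x * exp (- x) else 0)) = density lborel (erlang_density 1 1)"
  by (intro arg_cong[of _ _ "density lborel"] ext) (auto simp: erlang_density_def)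

lemma real_distribution_gamma2: "real_distribution (density lborel (\<lambda>x. ennreal (if 0 \<le> x then x * exp (- x) else 0)))"
  unfolding gamma2_eq_erlang real_distribution_def real_distribution_axioms_def
  by (simp add: prob_space_erlang_density)

text \<open>With a = 1 - \<i> t the transform is the integral of x exp (- a x) over the half-line,
  computed from an explicit antiderivative; its only boundary contribution is -1 / a^2 at 0.\<close>

lemma char_gamma2:
  "char (density lborel (\<lambda>x. ennreal (if 0 \<le> x then x * exp (- x) else 0))) t = 1 / (1 - \<i> * t)\<^sup>2"
proof -
  define g where "g = (\<lambda>x :: real. if 0 \<le> x then x * exp (- x) else 0)"
  define a where "a = 1 - \<i> * complex_of_real t"
  have a: "a \<noteq> 0" "Re a = 1" by (auto simp: a_def complex_eq_iff)
  have [measurable]: "g \<in> borel_measurable borel" unfolding g_def by measurable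
  have g: "0 \<le> g x" for x by (simp add: g_def)
  have "integrable lborel g"
  proof (rule integrableI_nonneg)
    have "emeasure (density lborel (\<lambda>x. ennreal (g x))) UNIV = 1"
      using real_distribution_gamma2 prob_space.emeasure_space_1[of "density lborel (\<lambda>x. ennreal (g x))"]
      by (auto simp: real_distribution_def g_def)
    then show "(\<integral>\<^sup>+x. ennreal (g x) \<partial>lborel) < \<infinity>"
      by (simp add: emeasure_density)
  qed (auto simp: g)
  \<comment> \<open>Antiderivative of x exp (- a x) by parts. As Re a = 1 and the modulus of a is at
    least 1, it is bounded by (x + 1) exp (- x) and vanishes at infinity.\<close>
  define F where "F = (\<lambda>x. - (complex_of_real x / a + 1 / a\<^sup>2) * exp (- a * complex_of_real x))"
  define f where "f = (\<lambda>x. complex_of_real x * exp (- a * complex_of_real x))"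
  have gf: "g x *\<^sub>R iexp (t * x) = indicator {0<..} x *\<^sub>R f x" for x
    by (auto simp: g_def f_def a_def indicator_def scaleR_conv_of_real exp_of_real[symmetric] algebra_simps simp flip: exp_add)
  have f_int: "integrable lborel (\<lambda>x. g x *\<^sub>R iexp (t * x))"
    by (rule Bochner_Integration.integrable_bound[OF \<open>integrable lborel g\<close>]) auto
  have ei: "einterval (0 :: ereal) \<infinity> = {0<..}"
    using einterval_eq_Ici[of 0] by (simp add: zero_ereal_def)
  have "char (density lborel (\<lambda>x. ennreal (g x))) t = (CLINT x|lborel. g x *\<^sub>R iexp (t * x))"
    unfolding char_def using g by (subst integral_density) auto
  also have "\<dots> = (LBINT x=ereal 0..\<infinity>. f x)"
    unfolding gf by (simp add: interval_lebesgue_integral_def set_lebesgue_integral_def ei)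
  also have "\<dots> = 0 - (- 1 / a\<^sup>2)"
  proof (rule interval_integral_FTC_integrable)
    show "(F has_vector_derivative f x) (at x)" for x
    proof -
      have "((\<lambda>z. - (z / a + 1 / a\<^sup>2) * exp (- a * z)) has_field_derivative complex_of_real x * exp (- a * complex_of_real x)) (at (complex_of_real x))"
        using a by (auto intro!: derivative_eq_intros simp: field_simps power2_eq_square)
      from has_vector_derivative_real_field[OF this] show ?thesis by (simp add: F_def f_def)
    qed
    show "isCont f x" for x unfolding f_def by (intro continuous_intros)
    show "set_integrable lborel (einterval (ereal 0) \<infinity>) f"
      using f_int unfolding gf set_integrable_def by (simp add: ei)
    have "isCont F 0" unfolding F_def using a by (intro continuous_intros) auto
    then have "(F \<longlongrightarrow> F 0) (at_right 0)"
      by (auto simp: isCont_def intro: filterlim_at_split[THEN iffD1, THEN conjunct2])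
    then show "((F \<circ> real_of_ereal) \<longlongrightarrow> - 1 / a\<^sup>2) (at_right (ereal 0))"
      by (simp add: ereal_tendsto_simps1 F_def)
    have "(F \<longlongrightarrow> 0) at_top"
    proof (rule Lim_null_comparison[where g = "\<lambda>x. (x + 1) * exp (- x)"])
      have "((\<lambda>x :: real. x ^ 1 / exp x + x ^ 0 / exp x) \<longlongrightarrow> 0 + 0) at_top"
        by (intro tendsto_add tendsto_power_div_exp_0)
      moreover have "x ^ 1 / exp x + x ^ 0 / exp x = (x + 1) * exp (- x)" for x :: real
        by (simp add: exp_minus divide_inverse distrib_right)
      ultimately show "((\<lambda>x :: real. (x + 1) * exp (- x)) \<longlongrightarrow> 0) at_top"
        by simp
      have "1 \<le> cmod a" using abs_Re_le_cmod[of a] a(2) by simp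
      show "eventually (\<lambda>x. cmod (F x) \<le> (x + 1) * exp (- x)) at_top"
        using eventually_ge_at_top[of 0]
      proof eventually_elim
        case (elim x)
        have "cmod (complex_of_real x / a + 1 / a\<^sup>2) \<le> x / 1 + 1 / 1"
        proof (rule order_trans[OF norm_triangle_ineq add_mono])
          show "cmod (complex_of_real x / a) \<le> x / 1"
            using elim \<open>1 \<le> cmod a\<close> unfolding norm_divide by (intro frac_le) auto
          show "cmod (1 / a\<^sup>2) \<le> 1 / 1"
            using \<open>1 \<le> cmod a\<close> unfolding norm_divide norm_power by (intro frac_le) auto
        qed
        moreover have "cmod (exp (- a * complex_of_real x)) = exp (- x)"
          using a(2) by (simp add: norm_exp_eq_Re)
        ultimately show ?case
          unfolding F_def norm_mult norm_minus_cancel using elim by (intro mult_mono) auto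
      qed
    qed
    then show "((F \<circ> real_of_ereal) \<longlongrightarrow> 0) (at_left \<infinity>)"
      by (simp add: ereal_tendsto_simps1)
  qed simp
  finally show ?thesis by (simp add: g_def a_def)
qed

theorem theorem2p7:
  fixes M :: "real \<Rightarrow> 'a measure"
    and \<pi> :: "real \<Rightarrow> (real \<times> real) measure"
    and b :: "nat \<Rightarrow> real"
  assumes "\<And>\<beta>. \<beta> > 0 \<Longrightarrow> stationary_distribution (M \<beta>) \<beta> (\<pi> \<beta>)"
    and "\<And>n. b n > 0"
    and "b \<longlonglongrightarrow> 0"
  shows "weak_conv_m (\<lambda>n. distr (\<pi> (b n)) borel (\<lambda>(q1, q2). b n * q2))
           (density lborel (\<lambda>x. ennreal (if x \<ge> 0 then x * exp (- x) else 0)))"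
proof (rule levy_continuity)
  have stat: "\<exists>W Q1 Q2 L. stationary_diffusion (M (b n)) (b n) (\<pi> (b n)) W Q1 Q2 L" for n
  proof -
    obtain W Q1 Q2 L where diff: "diffusion (M (b n)) (b n) W Q1 Q2 L"
      and law: "\<forall>t\<ge>0. distr (M (b n)) borel (\<lambda>\<omega>. (Q1 t \<omega>, Q2 t \<omega>)) = \<pi> (b n)"
      using assms(1)[OF assms(2)] unfolding stationary_distribution_def by blast
    have "prob_space (M (b n))"
      using diff by (simp add: diffusion_def standard_brownian_motion_def)
    with diff law assms(2) have "stationary_diffusion (M (b n)) (b n) (\<pi> (b n)) W Q1 Q2 L"
      by (simp add: stationary_diffusion_def stationary_diffusion_axioms_def)
    then show ?thesis by blast
  qed
  show "real_distribution (distr (\<pi> (b n)) borel (\<lambda>(q1, q2). b n * q2))" for n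
    using stat[of n] stationary_diffusion.real_distribution_scaled by blast
  show "real_distribution (density lborel (\<lambda>x. ennreal (if x \<ge> 0 then x * exp (- x) else 0)))"
    by (rule real_distribution_gamma2)
  fix t :: real
  define K where "K = \<bar>t\<bar> * (1 + \<bar>t\<bar>) * (2 * (9 * \<bar>t\<bar> + 7)) + \<bar>t\<bar>"
  \<comment> \<open>\<open>char_close\<close> asks for \<beta> \<le> 1, which holds from some index
    on; there its bound is b n times a constant depending on t alone.\<close>
  have "eventually (\<lambda>n. b n < 1) sequentially"
    using assms(3) by (rule order_tendstoD) simp
  then have "eventually (\<lambda>n. norm (char (distr (\<pi> (b n)) borel (\<lambda>(q1, q2). b n * q2)) t - 1 / (1 - \<i> * t)\<^sup>2) \<le> b n * K) sequentially"
  proof eventually_elim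
    case (elim n)
    obtain W Q1 Q2 L where "stationary_diffusion (M (b n)) (b n) (\<pi> (b n)) W Q1 Q2 L"
      using stat by blast
    from stationary_diffusion.char_close[OF this less_imp_le[OF elim], of t] show ?case
      by (simp add: K_def)
  qed
  moreover have "(\<lambda>n. b n * K) \<longlonglongrightarrow> 0"
    using assms(3) by (rule tendsto_mult_left_zero)
  ultimately have "(\<lambda>n. char (distr (\<pi> (b n)) borel (\<lambda>(q1, q2). b n * q2)) t - 1 / (1 - \<i> * t)\<^sup>2) \<longlonglongrightarrow> 0"
    by (rule Lim_null_comparison)
  then show "(\<lambda>n. char (distr (\<pi> (b n)) borel (\<lambda>(q1, q2). b n * q2)) t)
    \<longlonglongrightarrow> char (density lborel (\<lambda>x. ennreal (if x \<ge> 0 then x * exp (- x) else 0))) t"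
    unfolding char_gamma2 by (rule LIM_zero_cancel)
qed

end
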